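(* Let $p\in(0,1]$. As $n\to\infty$, for the topology of uniform convergence on compact subsets of $[0,\infty)$, $$\left(\Big(\frac{V_{p,n}(\lfloor nt\rfloor)}{n},\frac{E_{p,n}(\lfloor nt\rfloor)}{n},R_{p,n}(\lfloor nt\rfloor)\Big),\ t\ge0\right)\longrightarrow\big((v_p(t),e_p(t),r_p(t)),\ t\ge0\big)\quad\text{in probability},$$ where $v_p(t)=1-g_p(t)$, $e_p(t)=t(1-g_p(t))^2$ and $r_p(t)=t(1-g_p(t))$. Moreover, for the topology of uniform convergence on compact subsets of $[0,\infty)$, $$\left(\Big(\frac{k\,N^{(k)}_{p,n}(\lfloor nt\rfloor)}{n}\Big)_{k\ge1},\ t\ge0\right)\longrightarrow\left(\big(k\,t_{p,k}(t)\big)_{k\ge1},\ t\ge0\right)\quad\text{in probability},$$ where sequences are viewed as elements of the space $\ell^1$ of summable sequences with its usual norm $\|x\|_1=\sum_{k\ge1}|x_k|$.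
   Context: Discrete $p$-frozen model. Fix $p\in(0,1]$. For an integer $n\ge 2$ the random (multi)graph process $(F_{p,n}(m))_{m\in\mathbb Z_+}$ on vertex set $\{1,\dots,n\}$ is defined recursively. All its connected components are either trees (number of edges = number of vertices minus one) or unicycles (number of edges = number of vertices); vertices of unicycles are called frozen. $F_{p,n}(0)$ has $n$ isolated non-frozen vertices. At step $m\ge 1$, given $F_{p,n}(m-1)$, one of the $n(n-1)/2$ possible edges is selected uniformly at random, independently of the past (the same edge may be selected several times), and: (i) if it connects two vertices of trees of $F_{p,n}(m-1)$ (possibly the same tree), it is added; if two different trees are involved this produces a new tree (non-frozen), otherwise it produces a unicycle whose vertices become frozen (if the selected edge is already present in the tree, it is added as a parallel edge, creating a cycle of length two); (ii) if it connects two vertices of unicycles (possibly the same), it is discarded; (iii) if it connects a tree and a unicycle, it is added with probability $p$ (the tree is glued to the unicycle and all its vertices become frozen) and discarded with probability $1-p$. Notation: the forest part of $F_{p,n}(m)$ is the subgraph formed by its tree components; $V_{p,n}(m)$ and $E_{p,n}(m)$ are the numbers of vertices and edges of the forest part; $R_{p,n}(m)=E_{p,n}(m)/V_{p,n}(m)$ with the convention $0/0=0$; $N^{(k)}_{p,n}(m)$ is the number of tree components with exactly $k$ vertices in $F_{p,n}(m)$. Limit functions: let $f_p:[0,1)\to[1/2,\infty)$, $f_p(s)=\frac12\sum_{j=0}^\infty \frac{s^j}{1+pj}$, an increasing bijection. The function $g_p:[0,\infty)\to[0,1)$ is $0$ on $[0,1/2]$ and is the inverse of $f_p$ on $[1/2,\infty)$.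 For $k\ge1$ and $t\ge 0$, $$t_{p,k}(t)=\frac{k^{k-2}}{k!}(2t)^{k-1}(1-g_p(t))^k e^{-2kt(1-g_p(t))}$$ (with $0^0=1$). *)

theory Defs
  imports "HOL-Probability.Probability" "HOL-Library.Multiset"
begin

text \<open>A loopless multigraph on the vertex set \<open>{1..n}\<close> is given by its multiset of edges,
  an edge being a set of two vertices; the vertex set is passed separately, through \<open>n\<close>.\<close>

type_synonym multigraph = "nat set multiset"

definition possible_edges :: "nat \<Rightarrow> nat set set" where
  "possible_edges n = {e. e \<subseteq> {1..n} \<and> card e = 2}"

definition adj :: "multigraph \<Rightarrow> (nat \<times> nat) set" where
  "adj G = {(u, v). {u, v} \<in># G}"

definition component :: "multigraph \<Rightarrow> nat \<Rightarrow> nat set" where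
  "component G v = (adj G)\<^sup>* `` {v}"

definition components :: "nat \<Rightarrow> multigraph \<Rightarrow> nat set set" where
  "components n G = component G ` {1..n}"

text \<open>Edges are counted with multiplicity: two parallel edges form a cycle of length two.\<close>

definition num_edges :: "multigraph \<Rightarrow> nat set \<Rightarrow> nat" where
  "num_edges G C = size {#e \<in># G. e \<subseteq> C#}"

definition is_tree :: "multigraph \<Rightarrow> nat set \<Rightarrow> bool" where
  "is_tree G C \<longleftrightarrow> num_edges G C + 1 = card C"

definition is_unicycle :: "multigraph \<Rightarrow> nat set \<Rightarrow> bool" where
  "is_unicycle G C \<longleftrightarrow> num_edges G C = card C"

definition in_tree :: "multigraph \<Rightarrow> nat \<Rightarrow> bool" where
  "in_tree G v \<longleftrightarrow> is_tree G (component G v)"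

definition frozen :: "multigraph \<Rightarrow> nat \<Rightarrow> bool" where
  "frozen G v \<longleftrightarrow> is_unicycle G (component G v)"

text \<open>The last case of the transition is that of an edge between a tree and a unicycle, as all
  components of the multigraphs that can be reached are trees or unicycles.\<close>

definition frozen_step :: "real \<Rightarrow> nat \<Rightarrow> multigraph \<Rightarrow> multigraph pmf" where
  "frozen_step p n G =
     bind_pmf (pmf_of_set (possible_edges n)) (\<lambda>e.
       if \<forall>v\<in>e. in_tree G v then return_pmf (add_mset e G)
       else if \<forall>v\<in>e. frozen G v then return_pmf G
       else map_pmf (\<lambda>kept. if kept then add_mset e G else G) (bernoulli_pmf p))"

text \<open>\<open>F\<close> is a realisation, on the probability space \<open>M\<close>, of the Markov chain started from
  \<open>n\<close> isolated vertices with transition kernel \<^const>\<open>frozen_step\<close>.\<close>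

definition frozen_process ::
    "real \<Rightarrow> nat \<Rightarrow> 'w measure \<Rightarrow> (nat \<Rightarrow> 'w \<Rightarrow> multigraph) \<Rightarrow> bool" where
  "frozen_process p n M F \<longleftrightarrow>
     prob_space M \<and>
     (\<forall>m. F m \<in> M \<rightarrow>\<^sub>M count_space UNIV) \<and>
     (AE w in M. F 0 w = {#}) \<and>
     (\<forall>m x. measure M {w \<in> space M. \<forall>i\<le>Suc m. F i w = x i} =
            measure M {w \<in> space M. \<forall>i\<le>m. F i w = x i} * pmf (frozen_step p n (x m)) (x (Suc m)))"

definition forest_vertices :: "nat \<Rightarrow> multigraph \<Rightarrow> nat set" where
  "forest_vertices n G = {v \<in> {1..n}. in_tree G v}"

definition forest_V :: "nat \<Rightarrow> multigraph \<Rightarrow> nat" where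
  "forest_V n G = card (forest_vertices n G)"

definition forest_E :: "nat \<Rightarrow> multigraph \<Rightarrow> nat" where
  "forest_E n G = num_edges G (forest_vertices n G)"

definition forest_R :: "nat \<Rightarrow> multigraph \<Rightarrow> real" where
  "forest_R n G = real (forest_E n G) / real (forest_V n G)"

definition num_trees :: "nat \<Rightarrow> nat \<Rightarrow> multigraph \<Rightarrow> nat" where
  "num_trees n k G = card {C \<in> components n G. is_tree G C \<and> card C = k}"

definition f_lim :: "real \<Rightarrow> real \<Rightarrow> real" where
  "f_lim p s = (1 / 2) * (\<Sum>j. s ^ j / (1 + p * real j))"

definition g_lim :: "real \<Rightarrow> real \<Rightarrow> real" where
  "g_lim p t = (if t \<le> 1 / 2 then 0 else inv_into {0..<1} (f_lim p) t)"

definition v_lim :: "real \<Rightarrow> real \<Rightarrow> real" where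
  "v_lim p t = 1 - g_lim p t"

definition e_lim :: "real \<Rightarrow> real \<Rightarrow> real" where
  "e_lim p t = t * (1 - g_lim p t)\<^sup>2"

definition r_lim :: "real \<Rightarrow> real \<Rightarrow> real" where
  "r_lim p t = t * (1 - g_lim p t)"

text \<open>For \<open>k = 1\<close> the truncated exponent \<open>k - 2 = 0\<close> is harmless: the base is \<open>1\<close>.\<close>

definition t_lim :: "real \<Rightarrow> nat \<Rightarrow> real \<Rightarrow> real" where
  "t_lim p k t = real k ^ (k - 2) / fact k * (2 * t) ^ (k - 1) * (1 - g_lim p t) ^ k
                   * exp (- 2 * real k * t * (1 - g_lim p t))"

text \<open>The distance of \<open>\<ell>\<^sup>1\<close>, for sequences indexed by \<open>k \<ge> 1\<close> (the value at \<open>0\<close> is ignored).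
  It is extended-valued, hence meaningful, and infinite, when the difference is not summable.\<close>

definition l1_edist :: "(nat \<Rightarrow> real) \<Rightarrow> (nat \<Rightarrow> real) \<Rightarrow> ennreal" where
  "l1_edist a b = (\<Sum>k. ennreal \<bar>a (Suc k) - b (Suc k)\<bar>)"

text \<open>Convergence in probability of processes \<open>X n\<close>, each on its own space \<open>M n\<close>, to a deterministic
  function \<open>x\<close> on \<open>[0,\<infinity>)\<close>, for uniform convergence on compact sets with respect to the distance
  \<open>d\<close>. Measurability of the events is demanded because \<^const>\<open>measure\<close> is \<open>0\<close>
  on non-measurable sets.\<close>

definition ucp_converges ::
    "('b \<Rightarrow> 'b \<Rightarrow> ennreal) \<Rightarrow> (nat \<Rightarrow> 'w measure) \<Rightarrow> (nat \<Rightarrow> real \<Rightarrow> 'w \<Rightarrow> 'b) \<Rightarrow>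
     (real \<Rightarrow> 'b) \<Rightarrow> bool" where
  "ucp_converges d M X x \<longleftrightarrow>
     (\<forall>K \<epsilon>. compact K \<and> K \<subseteq> {0..} \<and> (0::real) < \<epsilon> \<longrightarrow>
        (let bad = (\<lambda>n. {w \<in> space (M n). (SUP t\<in>K. d (X n t w) (x t)) > ennreal \<epsilon>})
         in (\<forall>\<^sub>F n in sequentially. bad n \<in> sets (M n)) \<and>
            (\<lambda>n. measure (M n) (bad n)) \<longlonglongrightarrow> 0))"

end

theory Submission
  imports Defs
begin

text \<open>
  Let \<open>c\<^sub>k\<close> be the fraction of vertices in trees of size \<open>k\<close>, \<open>v = V / n\<close> and \<open>w = v + p (1 - v)\<close>. In the
  limit the \<open>c\<^sub>k / k\<close> solve Smoluchowski equations with gain \<open>\<Sum>i+j=k. c\<^sub>i c\<^sub>j\<close> and loss \<open>2 c\<^sub>k w\<close>,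
  so with the integrated rate \<open>W = \<integral>2 w\<close> the quantities \<open>c\<^sub>k exp (k W)\<close> converge to polynomials given by
  Cayley's formula, whatever \<open>v\<close> does. It remains to see that no mass escapes to large trees, that is
  \<open>v = u\<close> for \<open>u = \<Sum>k. c\<^sub>k\<close>. The number of trees decreases at rate \<open>v\<^sup>2 + 2 p v (1 - v)\<close>, while the sum of the
  Smoluchowski equations gives the rate \<open>2 u w - u\<^sup>2\<close>; since only few trees are large, these agree, so
  \<open>(v - u)\<^sup>2 + 2 p (1 - v) (v - u)\<close> vanishes and \<open>v = u\<close>. Then \<open>W' = 2 w\<close> is an equation for \<open>W\<close> whose right-hand
  side decreases in \<open>W\<close>, hence it is stable, and \<open>W = 2 t v - ln v\<close> is its solution. All of this is
  done at finite \<open>n\<close> with explicit error terms and second moments.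
\<close>

section \<open>The tree function\<close>

text \<open>The obstacle is that v has no usable drift of its own: an edge inside a tree freezes the
  whole tree, so the expected change of v involves second moments of the tree sizes. Hence v is an
  unknown input of the equations for the c_k, and it is recovered from the number of trees, which
  changes by at most 1 per step. That bookkeeping closes because two sizes up to L add up to at most
  2 L, at the cost of the mass between L and 2 L. The cost need not be small at a given scale, but
  it telescopes over the scales 2^j. So v = u is first known only in time average. Uniformity in
  time is regained at the end: c_k changes by at most 2 k / n per step, while v, which has no such
  bound, is nonincreasing and dominates the sums of finitely many c_k. The form of W is read off the
  limit, where v^k exp (- 2 k t v) = exp (- k W) for W = 2 t v - ln v. The series defining f_p says
  2 f + 2 p s f' = 1 / (1 - s), which is W' = 2 w in the variable s = g_p(t).\<close>

definition abel_poly :: "nat \<Rightarrow> real \<Rightarrow> real" where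
  "abel_poly k x = (if k = 0 then 1 else x * (x + real k) ^ (k - 1) / fact k)"

lemma abel_poly_0 [simp]: "abel_poly 0 x = 1"
  by (simp add: abel_poly_def)

lemma abel_poly_Suc_0 [simp]: "abel_poly (Suc k) 0 = 0"
  by (simp add: abel_poly_def)

text \<open>Abel's polynomials are the coefficients of exp (x H) for the rooted tree series H. Since
  H = z exp H, the derivative in x is z exp ((x + 1) H): the degree drops by one and the argument
  shifts by one.\<close>

lemma abel_poly_has_derivative:
  "(abel_poly (Suc k) has_real_derivative abel_poly k (x + 1)) (at x)"
proof (cases k)
  case 0
  then show ?thesis
    by (auto simp: abel_poly_def [abs_def] intro!: derivative_eq_intros)
next
  case (Suc j)
  have *: "abel_poly (Suc k) = (\<lambda>x. x * (x + real (Suc k)) ^ k / fact (Suc k))"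
    by (simp add: abel_poly_def fun_eq_iff)
  have "((\<lambda>x. x * (x + real (Suc k)) ^ k / fact (Suc k)) has_real_derivative
          ((x + real (Suc k)) ^ k + x * (real k * (x + real (Suc k)) ^ (k - 1))) / fact (Suc k)) (at x)"
    by (auto intro!: derivative_eq_intros)
  moreover have "((x + real (Suc k)) ^ k + x * (real k * (x + real (Suc k)) ^ (k - 1))) / fact (Suc k)
      = abel_poly k (x + 1)"
  proof -
    have "(x + real (Suc k)) ^ k + x * (real k * (x + real (Suc k)) ^ (k - 1))
        = real (Suc k) * ((x + 1) * (x + 1 + real k) ^ (k - 1))"
      by (simp add: Suc algebra_simps)
    then have "((x + real (Suc k)) ^ k + x * (real k * (x + real (Suc k)) ^ (k - 1))) / fact (Suc k)
      = real (Suc k) * ((x + 1) * (x + 1 + real k) ^ (k - 1)) / (real (Suc k) * fact k)"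
      by (simp only: fact_Suc of_nat_mult of_nat_fact)
    also have "\<dots> = (x + 1) * (x + 1 + real k) ^ (k - 1) / fact k"
      by (rule mult_divide_mult_cancel_left) simp
    finally show ?thesis by (simp add: abel_poly_def Suc)
  qed
  ultimately show ?thesis by (simp add: *)
qed

text \<open>For fixed \<open>y\<close> both sides have the same derivative in \<open>x\<close>, by
  the induction hypothesis at \<open>x + 1\<close>. They agree at \<open>x = 0\<close>, where only
  the summand \<open>k = 0\<close> survives.\<close>

lemma abel_binomial:
  "abel_poly n (x + y) = (\<Sum>k\<le>n. abel_poly k x * abel_poly (n - k) y)"
proof (induction n arbitrary: x y)
  case 0
  then show ?case by simp
next
  case (Suc n)
  define D where "D = (\<lambda>x. abel_poly (Suc n) (x + y) - (\<Sum>k\<le>Suc n. abel_poly k x * abel_poly (Suc n - k) y))"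
  have "(D has_real_derivative 0) (at z)" for z
  proof -
    have "((\<lambda>x. abel_poly (Suc n) (x + y)) has_real_derivative abel_poly n (z + y + 1)) (at z)"
      using abel_poly_has_derivative [of n "z + y"] DERIV_shift [of "abel_poly (Suc n)" _ z y] by blast
    moreover have "((\<lambda>x. \<Sum>k\<le>n. abel_poly (Suc k) x * abel_poly (n - k) y) has_real_derivative
        (\<Sum>k\<le>n. abel_poly k (z + 1) * abel_poly (n - k) y)) (at z)"
      by (intro DERIV_sum DERIV_cmult_right abel_poly_has_derivative)
    moreover have "D = (\<lambda>x. abel_poly (Suc n) (x + y) - abel_poly (Suc n) y
        - (\<Sum>k\<le>n. abel_poly (Suc k) x * abel_poly (n - k) y))"
      by (auto simp: D_def fun_eq_iff sum.atMost_Suc_shift simp del: sum.atMost_Suc)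
    ultimately show ?thesis
      using DERIV_diff [OF DERIV_diff [OF _ DERIV_const [of "abel_poly (Suc n) y"]]] Suc.IH [of "z + 1" y]
      by (fastforce simp: add.commute add.left_commute)
  qed
  then have "D x = D 0"
    using DERIV_isconst_all by blast
  also have "D 0 = 0"
    by (simp add: D_def sum.atMost_Suc_shift del: sum.atMost_Suc)
  finally show ?case by (simp add: D_def)
qed

text \<open>\<open>k ^ (k - 1) / fact k\<close> is the exponential generating function coefficient of rooted labelled
  trees; it is set to \<open>0\<close> for \<open>k = 0\<close>, where the formula would give \<open>1\<close>.\<close>

definition tree_coeff :: "nat \<Rightarrow> real" where
  "tree_coeff k = (if k = 0 then 0 else real k ^ (k - 1) / fact k)"

lemma tree_coeff_0 [simp]: "tree_coeff 0 = 0"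
  by (simp add: tree_coeff_def)

lemma tree_coeff_1 [simp]: "tree_coeff (Suc 0) = 1"
  by (simp add: tree_coeff_def)

lemma tree_coeff_nonneg: "tree_coeff k \<ge> 0"
  by (simp add: tree_coeff_def)

lemma tree_coeff_Suc: "tree_coeff (Suc k) = abel_poly k 1"
proof (cases k)
  case (Suc j)
  have "real (Suc k) ^ k / (real (Suc k) * fact k) = real (Suc k) ^ j / fact k"
    by (simp add: Suc)
  then show ?thesis
    by (simp add: Suc tree_coeff_def abel_poly_def add.commute)
qed simp

text \<open>Joining the roots of two rooted trees gives a tree with an oriented edge, and a tree on
  k vertices has 2 (k - 1) of these. Analytically this is Abel's identity at x = y = 1 with index k
  - 2.\<close>

lemma tree_coeff_convolution:
  "(\<Sum>i\<le>k. tree_coeff i * tree_coeff (k - i)) = 2 * (tree_coeff k - tree_coeff k / real k)"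
proof -
  consider "k = 0" | "k = 1" | n where "k = Suc (Suc n)"
    by (metis One_nat_def not0_implies_Suc)
  then show ?thesis
  proof cases
    case 3
    have "(\<Sum>i\<le>k. tree_coeff i * tree_coeff (k - i)) = (\<Sum>i\<le>n. tree_coeff (Suc i) * tree_coeff (Suc (n - i)))"
      by (simp add: 3 sum.atMost_Suc_shift [of _ "Suc n"] Suc_diff_le del: sum.atMost_Suc)
        (simp add: Suc_diff_le)
    also have "\<dots> = abel_poly n 2"
      by (simp add: tree_coeff_Suc abel_binomial [of n 1 1, simplified])
    also have "\<dots> = 2 * (tree_coeff k - tree_coeff k / real k)"
    proof (cases n)
      case 0
      then show ?thesis by (simp add: 3 tree_coeff_def)
    next
      case (Suc m)
      have k: "real k = 3 + real m" by (simp add: 3 Suc)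
      have "fact k = (3 + real m) * (2 + real m) * fact n"
        by (simp add: 3 Suc algebra_simps)
      moreover have "tree_coeff k = (3 + real m) ^ Suc (Suc m) / fact k"
        using k by (simp add: tree_coeff_def 3 Suc)
      moreover have "abel_poly n 2 = 2 * (3 + real m) ^ m / fact n"
        by (simp add: abel_poly_def Suc)
      moreover have "2 * b ^ m / f = 2 * (b ^ Suc (Suc m) / (b * a * f) - b ^ Suc (Suc m) / (b * a * f) / b)"
        if "a > 0" "b = a + 1" "f > 0" for a b f :: real
      proof -
        have "b > 0" using that by simp
        have "2 * (b ^ Suc (Suc m) / (b * a * f) - b ^ Suc (Suc m) / (b * a * f) / b) = 2 * b ^ m * (b - 1) / (a * f)"
          using that \<open>b > 0\<close> by (simp add: divide_simps) (simp add: algebra_simps)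
        then show ?thesis using that by simp
      qed
      from this [of "2 + real m" "3 + real m" "fact n"]
      have "2 * (3 + real m) ^ m / fact n = 2 * ((3 + real m) ^ Suc (Suc m) / ((3 + real m) * (2 + real m) * fact n) -
         (3 + real m) ^ Suc (Suc m) / ((3 + real m) * (2 + real m) * fact n) / (3 + real m))" by simp
      ultimately show ?thesis
        by (simp only: k)
    qed
    finally show ?thesis .
  qed (simp_all add: tree_coeff_def)
qed

lemma tree_coeff_le_exp: "tree_coeff k \<le> exp (real k)"
proof (cases "k = 0")
  case False
  have "real k ^ k / fact k \<le> exp (real k)"
  proof -
    have s: "(\<lambda>n. real k ^ n / fact n) sums exp (real k)"
      using exp_converges [of "real k"] by (simp add: divide_inverse mult.commute)
    have "(\<Sum>n\<in>{k}. real k ^ n / fact n) \<le> (\<Sum>n. real k ^ n / fact n)"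
      by (rule sum_le_suminf) (use s in \<open>auto simp: sums_iff\<close>)
    then show ?thesis using s by (simp add: sums_iff)
  qed
  moreover have "tree_coeff k \<le> real k ^ k / fact k"
    using False by (auto simp: tree_coeff_def intro!: divide_right_mono power_increasing)
  ultimately show ?thesis by linarith
qed auto

lemma tree_series_summable:
  assumes "0 \<le> z" "z < exp (-1)"
  shows "summable (\<lambda>k. tree_coeff k * z ^ k)"
proof (rule summable_comparison_test')
  have "exp 1 * z < 1"
    using assms by (simp add: exp_minus field_simps)
  then show "summable (\<lambda>k. (exp 1 * z) ^ k)"
    using assms by (intro summable_geometric) auto
next
  fix k :: nat
  have "tree_coeff k * z ^ k \<le> exp (real k) * z ^ k"
    using assms by (intro mult_right_mono tree_coeff_le_exp) auto
  then show "norm (tree_coeff k * z ^ k) \<le> (exp 1 * z) ^ k"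
    using assms tree_coeff_nonneg [of k] by (simp add: power_mult_distrib abs_mult flip: exp_of_nat_mult)
qed

text \<open>The identity behind the number of trees: for the generating function \<open>H\<close> of rooted trees, that of
  unrooted trees is \<open>H - H\<^sup>2 / 2\<close>.\<close>

lemma unrooted_tree_series:
  assumes "0 \<le> z" and sums: "summable (\<lambda>k. tree_coeff k * z ^ k)"
  shows "(\<lambda>k. tree_coeff k / real k * z ^ k) sums
    ((\<Sum>k. tree_coeff k * z ^ k) - (\<Sum>k. tree_coeff k * z ^ k)\<^sup>2 / 2)"
proof -
  let ?H = "\<Sum>k. tree_coeff k * z ^ k"
  have n: "summable (\<lambda>k. norm (tree_coeff k * z ^ k))"
    using assms tree_coeff_nonneg by (simp add: abs_mult)
  have "(\<lambda>k. \<Sum>i\<le>k. tree_coeff i * z ^ i * (tree_coeff (k - i) * z ^ (k - i))) sums (?H * ?H)"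
    using Cauchy_product_sums [OF n n] .
  also have "(\<lambda>k. \<Sum>i\<le>k. tree_coeff i * z ^ i * (tree_coeff (k - i) * z ^ (k - i)))
      = (\<lambda>k. 2 * (tree_coeff k * z ^ k) - 2 * (tree_coeff k / real k * z ^ k))"
  proof
    fix k
    have "(\<Sum>i\<le>k. tree_coeff i * z ^ i * (tree_coeff (k - i) * z ^ (k - i)))
      = (\<Sum>i\<le>k. tree_coeff i * tree_coeff (k - i)) * z ^ k"
      unfolding sum_distrib_right
    proof (rule sum.cong)
      fix i assume "i \<in> {..k}"
      then have "z ^ k = z ^ i * z ^ (k - i)" by (simp flip: power_add)
      then show "tree_coeff i * z ^ i * (tree_coeff (k - i) * z ^ (k - i))
        = tree_coeff i * tree_coeff (k - i) * z ^ k" by simp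
    qed simp
    also have "\<dots> = 2 * (tree_coeff k * z ^ k) - 2 * (tree_coeff k / real k * z ^ k)"
      by (simp add: tree_coeff_convolution algebra_simps)
    finally show "(\<Sum>i\<le>k. tree_coeff i * z ^ i * (tree_coeff (k - i) * z ^ (k - i)))
      = 2 * (tree_coeff k * z ^ k) - 2 * (tree_coeff k / real k * z ^ k)" .
  qed
  finally have "(\<lambda>k. 2 * (tree_coeff k * z ^ k) - 2 * (tree_coeff k / real k * z ^ k)) sums (?H * ?H)" .
  from sums_diff [OF sums_mult [OF summable_sums [OF sums], of 2] this]
  have "(\<lambda>k. 2 * (tree_coeff k / real k * z ^ k)) sums (2 * ?H - ?H * ?H)" by simp
  from sums_mult [OF this, of "1/2"] show ?thesis
    by (simp add: power2_eq_square algebra_simps diff_divide_distrib)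
qed

text \<open>Write H = z Q and let L = H - H^2 / 2 be the unrooted series, so that L' = Q termwise.
  Differentiating both relations gives Q' = Q H', hence Q exp (- H) is constant, with value 1 at
  0.\<close>

lemma rooted_tree_equation:
  assumes "0 \<le> z" "z < exp (-1)"
  shows "(\<Sum>k. tree_coeff k * z ^ k) = z * exp (\<Sum>k. tree_coeff k * z ^ k)"
proof -
  define H where "H = (\<lambda>z::real. \<Sum>k. tree_coeff k * z ^ k)"
  define Q where "Q = (\<lambda>z::real. \<Sum>k. tree_coeff (Suc k) * z ^ k)"
  define L where "L = (\<lambda>z::real. \<Sum>k. tree_coeff k / real k * z ^ k)"
  \<comment> \<open>A point strictly inside the disc of convergence, so that all series can be
    differentiated termwise on [0, b).\<close>
  obtain b where b: "z < b" "b < exp (-1)" using assms dense by blast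
  have "0 < b" using b assms by linarith
  have sb: "summable (\<lambda>k. tree_coeff k * b ^ k)"
    using b assms by (intro tree_series_summable) auto
  have sb': "summable (\<lambda>k. tree_coeff (Suc k) * b ^ k)"
  proof -
    have "summable (\<lambda>k. tree_coeff (Suc k) * b ^ Suc k)"
      using sb by (subst summable_Suc_iff) 
    then have "summable (\<lambda>k. inverse b * (tree_coeff (Suc k) * b ^ Suc k))"
      by (rule summable_mult)
    then show ?thesis using \<open>0 < b\<close> by (simp add: field_simps)
  qed
  have sL: "summable (\<lambda>k. tree_coeff k / real k * b ^ k)"
    using unrooted_tree_series [OF _ sb] \<open>0 < b\<close> by (simp add: sums_iff)
  have diffL: "diffs (\<lambda>k. tree_coeff k / real k) = (\<lambda>k. tree_coeff (Suc k))"
    by (auto simp: diffs_def fun_eq_iff)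
  have dL: "(L has_real_derivative Q x) (at x)" if "0 \<le> x" "x < b" for x
    using termdiffs_strong [OF sL, of x] that unfolding L_def Q_def diffL by simp
  have dH: "\<exists>h. (H has_real_derivative h) (at x)" if "0 \<le> x" "x < b" for x
    using termdiffs_strong [OF sb, of x] that unfolding H_def by auto
  have dQ: "\<exists>h. (Q has_real_derivative h) (at x)" if "0 \<le> x" "x < b" for x
    using termdiffs_strong [OF sb', of x] that unfolding Q_def by auto
  have sQ: "summable (\<lambda>k. tree_coeff (Suc k) * x ^ k)" if "0 \<le> x" "x < b" for x
    using powser_inside [OF sb', of x] that by auto
  have sH: "summable (\<lambda>k. tree_coeff k * x ^ k)" if "0 \<le> x" "x < b" for x
    using powser_inside [OF sb, of x] that by auto
  have HQ: "H x = x * Q x" if "0 \<le> x" "x < b" for x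
  proof -
    have "H x = (\<Sum>k. tree_coeff (Suc k) * x ^ Suc k)"
      using suminf_split_head [OF sH [OF that]] by (simp add: H_def)
    also have "\<dots> = (\<Sum>k. x * (tree_coeff (Suc k) * x ^ k))" by (simp add: algebra_simps)
    also have "\<dots> = x * Q x" using suminf_mult [OF sQ [OF that]] by (simp add: Q_def)
    finally show ?thesis .
  qed
  have LH: "L x = H x - (H x)\<^sup>2 / 2" if "0 \<le> x" "x < b" for x
    using unrooted_tree_series [OF _ sH] that by (simp add: L_def H_def sums_iff)
  have dphi: "((\<lambda>x. Q x * exp (- H x)) has_real_derivative 0) (at x)" if x: "0 < x" "x < b" for x
  proof -
    obtain h q where h: "(H has_real_derivative h) (at x)" and q: "(Q has_real_derivative q) (at x)"
      using dH dQ x by (meson less_imp_le)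
    have "eventually (\<lambda>y. y \<in> {0<..<b}) (nhds x)"
      using x by (intro eventually_nhds_in_open) auto
    then have ev: "eventually (\<lambda>y. H y = y * Q y) (nhds x)" "eventually (\<lambda>y. L y = H y - (H y)\<^sup>2 / 2) (nhds x)"
      by (auto elim!: eventually_mono intro: HQ LH)
    have "((\<lambda>y. y * Q y) has_real_derivative Q x + x * q) (at x)"
      using q by (auto intro!: derivative_eq_intros)
    then have "(H has_real_derivative Q x + x * q) (at x)"
      using DERIV_cong_ev [OF refl ev(1) refl] by blast
    then have 1: "h = Q x + x * q" using h DERIV_unique by blast
    have "((\<lambda>y. H y - (H y)\<^sup>2 / 2) has_real_derivative h - H x * h) (at x)"
      using h by (auto intro!: derivative_eq_intros)
    then have "(L has_real_derivative h - H x * h) (at x)"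
      using DERIV_cong_ev [OF refl ev(2) refl] by blast
    then have 2: "Q x = h - H x * h" using dL [of x] x DERIV_unique by (meson less_imp_le)
    have "x * q = x * (Q x * h)"
    proof -
      have "x * q = h - Q x" using 1 by simp
      also have "\<dots> = H x * h" by (subst 2) simp
      finally show ?thesis using HQ [of x] x by (simp add: mult.assoc)
    qed
    then have "q = Q x * h" using x by simp
    moreover have "((\<lambda>x. Q x * exp (- H x)) has_real_derivative (q - Q x * h) * exp (- H x)) (at x)"
      using h q by (auto intro!: derivative_eq_intros simp: algebra_simps)
    ultimately show ?thesis by simp
  qed
  have "Q z * exp (- H z) = Q 0 * exp (- H 0)"
  proof (cases "z = 0")
    case False
    show ?thesis
    proof (rule DERIV_isconst2 [of 0 z "\<lambda>x. Q x * exp (- H x)" z])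
      show "continuous_on {0..z} (\<lambda>x. Q x * exp (- H x))"
        using dH dQ b by (intro continuous_intros continuous_at_imp_continuous_on ballI)
          (metis DERIV_isCont atLeastAtMost_iff le_less_trans)+
    qed (use False assms b dphi in auto)
  qed simp
  moreover have "Q 0 = 1" "H 0 = 0" by (simp_all add: Q_def H_def)
  ultimately have "Q z = exp (H z)"
    by (simp add: exp_minus field_simps)
  then show ?thesis using HQ [of z] assms b by (simp add: H_def)
qed

lemma mult_exp_minus_strict_mono:
  fixes x y :: real
  assumes "0 \<le> x" "x < y" "y \<le> 1"
  shows "x * exp (- x) < y * exp (- y)"
proof (rule DERIV_pos_imp_increasing_open [OF \<open>x < y\<close>])
  fix t assume "x < t" "t < y"
  moreover have "((\<lambda>t. t * exp (- t)) has_real_derivative (1 - t) * exp (- t)) (at t)"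
    by (auto intro!: derivative_eq_intros simp: algebra_simps)
  ultimately show "\<exists>d. ((\<lambda>t. t * exp (- t)) has_real_derivative d) (at t) \<and> 0 < d"
    using assms by (intro exI [of _ "(1 - t) * exp (- t)"]) auto
qed (auto intro!: continuous_intros)

text \<open>The series inverts y exp (- y), which is injective only up to y = 1. So it has to be
  shown that the sum stays on the branch below 1; the endpoint y = 1 follows by monotone passage to
  the limit.\<close>

lemma rooted_tree_series:
  assumes "0 \<le> y" "y \<le> (1::real)"
  shows "(\<lambda>k. tree_coeff k * (y * exp (- y)) ^ k) sums y"
proof -
  define H where "H = (\<lambda>z::real. \<Sum>k. tree_coeff k * z ^ k)"
  \<comment> \<open>If the sum reached 1, by continuity it would equal 1 at some x in the open disc,
    and the functional equation would force x = exp (-1), the radius.\<close>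
  have H_lt: "H z < 1" if z: "0 \<le> z" "z < exp (-1)" for z
  proof (rule ccontr)
    assume "\<not> H z < 1"
    have cont: "isCont H x" if x: "0 \<le> x" "x \<le> z" for x
    proof -
      obtain b where b: "z < b" "b < exp (-1)" using z dense by blast
      then have "summable (\<lambda>k. tree_coeff k * b ^ k)"
        using z by (intro tree_series_summable) auto
      then show ?thesis
        unfolding H_def by (rule isCont_powser) (use x b in auto)
    qed
    have "H 0 = 0" by (simp add: H_def)
    then obtain x where x: "0 \<le> x" "x \<le> z" "H x = 1"
      using IVT [of H 0 1 z] cont \<open>\<not> H z < 1\<close> z by auto
    then have "1 = x * exp 1"
      using rooted_tree_equation [of x] z by (simp add: H_def)
    moreover have "x * exp 1 < exp (-1) * exp 1" using x z by (intro mult_strict_right_mono) auto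
    then have "x * exp 1 < 1" by (simp flip: exp_add)
    ultimately show False by simp
  qed
  have less1: "(\<lambda>k. tree_coeff k * (y * exp (- y)) ^ k) sums y" if y: "0 \<le> y" "y < (1::real)" for y
  proof -
    let ?z = "y * exp (- y)"
    have z: "0 \<le> ?z" "?z < exp (-1)"
      using y mult_exp_minus_strict_mono [of y 1] by simp_all
    have s: "summable (\<lambda>k. tree_coeff k * ?z ^ k)"
      using tree_series_summable z by blast
    have "0 \<le> H ?z"
      unfolding H_def using z tree_coeff_nonneg by (intro suminf_nonneg s) auto
    moreover have "H ?z < 1" using H_lt z by blast
    moreover have "H ?z * exp (- H ?z) = y * exp (- y)"
    proof -
      have "H ?z = ?z * exp (H ?z)"
        unfolding H_def using z by (rule rooted_tree_equation)
      then have "H ?z * exp (- H ?z) = ?z * exp (H ?z) * exp (- H ?z)" by simp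
      then show ?thesis by (simp add: mult.assoc flip: exp_add)
    qed
    ultimately have "H ?z = y"
      using mult_exp_minus_strict_mono [of "H ?z" y] mult_exp_minus_strict_mono [of y "H ?z"] y
      by (cases "H ?z" y rule: linorder_cases) auto
    then show ?thesis using s by (simp add: H_def sums_iff)
  qed
  show ?thesis
  proof (cases "y < 1")
    case True
    then show ?thesis using less1 assms by blast
  next
    case False
    then have y: "y = 1" using assms by simp
    \<comment> \<open>A partial sum is continuous in y and at most y for y < 1; letting y tend to 1
      bounds it at the critical point.\<close>
    have part: "(\<Sum>k<N. tree_coeff k * exp (-1) ^ k) \<le> 1" for N
    proof -
      have "((\<lambda>y. \<Sum>k<N. tree_coeff k * (y * exp (- y)) ^ k) \<longlongrightarrow> (\<Sum>k<N. tree_coeff k * (1 * exp (- 1)) ^ k)) (at_left 1)"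
        by (intro tendsto_intros)
      moreover have "eventually (\<lambda>y::real. (\<Sum>k<N. tree_coeff k * (y * exp (- y)) ^ k) \<le> 1) (at_left 1)"
        using eventually_at_left_real [of "0::real" 1]
      proof (rule eventually_mono)
        show "(0::real) < 1" by simp
        fix y :: real assume y: "y \<in> {0<..<1}"
        have "(\<Sum>k<N. tree_coeff k * (y * exp (- y)) ^ k) \<le> (\<Sum>k. tree_coeff k * (y * exp (- y)) ^ k)"
          using less1 [of y] y tree_coeff_nonneg by (intro sum_le_suminf) (auto simp: sums_iff)
        also have "\<dots> = y" using less1 [of y] y by (simp add: sums_iff)
        finally show "(\<Sum>k<N. tree_coeff k * (y * exp (- y)) ^ k) \<le> 1" using y by simp
      qed
      ultimately show ?thesis
        by (intro tendsto_upperbound [of _ _ "at_left 1"]) auto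
    qed
    have s: "summable (\<lambda>k. tree_coeff k * exp (-1) ^ k)"
      using part tree_coeff_nonneg
      by (intro bounded_imp_summable [where B = 1]) (simp_all only: flip: lessThan_Suc_atMost, auto)
    have "(\<Sum>k. tree_coeff k * exp (-1) ^ k) \<le> 1"
      using part by (intro suminf_le_const s) auto
    moreover have "1 \<le> (\<Sum>k. tree_coeff k * exp (-1) ^ k)"
    proof (rule dense_le_bounded [of 0])
      fix x :: real assume x: "0 < x" "x < 1"
      have "x = (\<Sum>k. tree_coeff k * (x * exp (- x)) ^ k)"
        using less1 [of x] x by (simp add: sums_iff)
      also have "\<dots> \<le> (\<Sum>k. tree_coeff k * exp (-1) ^ k)"
        using less1 [of x] x s tree_coeff_nonneg mult_exp_minus_strict_mono [of x 1]
        by (intro suminf_le mult_left_mono power_mono) (auto simp: sums_iff)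
      finally show "x \<le> (\<Sum>k. tree_coeff k * exp (-1) ^ k)" .
    qed simp
    ultimately show ?thesis using s by (simp add: y sums_iff)
  qed
qed

section \<open>The limit functions\<close>

definition c_lim :: "real \<Rightarrow> nat \<Rightarrow> real \<Rightarrow> real" where
  "c_lim p k t = real k * t_lim p k t"

definition W_lim :: "real \<Rightarrow> real \<Rightarrow> real" where
  "W_lim p t = 2 * t * v_lim p t - ln (v_lim p t)"

context
  fixes p :: real
  assumes p: "0 < p" "p \<le> 1"
begin

section \<open>The series \<open>f_lim\<close> and its differential equation\<close>

lemma f_lim_summable:
  assumes "0 \<le> s" "s < 1"
  shows "summable (\<lambda>j. s ^ j / (1 + p * real j))"
proof (rule summable_comparison_test')
  show "summable (\<lambda>j. s ^ j)" using assms by (intro summable_geometric) auto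
  fix j :: nat
  have "1 \<le> 1 + p * real j" using p by simp
  then have "s ^ j / (1 + p * real j) \<le> s ^ j / 1"
    using assms by (intro divide_left_mono) auto
  then show "norm (s ^ j / (1 + p * real j)) \<le> s ^ j"
    using assms p by simp
qed

lemma f_lim_0: "f_lim p 0 = 1 / 2"
proof -
  have "(\<lambda>j. (1 / (1 + p * real j)) * 0 ^ j) sums (1 / (1 + p * real 0))"
    by (rule powser_sums_zero)
  then show ?thesis by (simp add: f_lim_def sums_iff)
qed

text \<open>The coefficients a_j = 1 / (1 + p j) satisfy a_j + p j a_j = 1, so the combination of
  series on the left is the geometric series. This identity is what turns \<open>W_lim\<close> into
  a solution of the limit equation.\<close>

lemma f_lim_has_derivative:
  assumes "0 \<le> s" "s < 1"
  shows "\<exists>d>0. (f_lim p has_real_derivative d) (at s) \<and> 2 * f_lim p s + 2 * p * s * d = 1 / (1 - s)"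
proof -
  define c where "c = (\<lambda>j. 1 / (1 + p * real j))"
  have cpos: "c j > 0" for j using p by (auto simp: c_def intro!: add_pos_nonneg)
  obtain b where b: "s < b" "b < 1" using assms dense by blast
  have sb: "summable (\<lambda>j. c j * b ^ j)"
    using f_lim_summable [of b] b assms by (simp add: c_def)
  define d where "d = (\<Sum>j. diffs c j * s ^ j)"
  have "((\<lambda>s. \<Sum>j. c j * s ^ j) has_real_derivative d) (at s)"
    unfolding d_def using b assms by (intro termdiffs_strong [OF sb]) auto
  then have "((\<lambda>s. 1 / 2 * (\<Sum>j. c j * s ^ j)) has_real_derivative (1 / 2 * d)) (at s)"
    by (rule DERIV_cmult)
  moreover have f: "f_lim p = (\<lambda>s. 1 / 2 * (\<Sum>j. c j * s ^ j))"
    by (simp add: f_lim_def fun_eq_iff c_def)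
  ultimately have deriv: "(f_lim p has_real_derivative (1 / 2 * d)) (at s)" by simp
  have sd: "summable (\<lambda>j. diffs c j * s ^ j)"
    using b assms sb by (intro termdiff_converges [of s b])
      (auto intro: powser_inside [of c b])
  have "0 < d"
    unfolding d_def
  proof (rule suminf_pos2 [OF sd, of 0])
    show "0 \<le> diffs c j * s ^ j" for j
      using cpos [of "Suc j"] assms by (simp add: diffs_def)
    show "0 < diffs c 0 * s ^ 0"
      using cpos [of 1] by (simp add: diffs_def)
  qed
  have "(\<lambda>n. real n * c n * s ^ (n - Suc 0)) sums d"
    unfolding d_def using diffs_equiv [OF sd] by simp
  from sums_mult [OF this, of s]
  have 1: "(\<lambda>n. real n * c n * s ^ n) sums (s * d)"
  proof (rule sums_cong [THEN iffD1, rotated])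
    show "s * (real n * c n * s ^ (n - Suc 0)) = real n * c n * s ^ n" for n
      by (cases n) auto
  qed
  have 2: "(\<lambda>n. c n * s ^ n) sums (2 * f_lim p s)"
    using f_lim_summable [OF assms] by (simp add: f c_def sums_iff)
  have "(\<lambda>n. c n * s ^ n + p * (real n * c n * s ^ n)) sums (2 * f_lim p s + p * (s * d))"
    by (intro sums_add sums_mult 1 2)
  also have "(\<lambda>n. c n * s ^ n + p * (real n * c n * s ^ n)) = (\<lambda>n. s ^ n)"
  proof
    fix n
    have "1 + p * real n > 0" using p by (intro add_pos_nonneg) auto
    then have "c n * (1 + p * real n) = 1" by (simp add: c_def)
    then have "s ^ n * (c n * (1 + p * real n)) = s ^ n" by simp
    then show "c n * s ^ n + p * (real n * c n * s ^ n) = s ^ n" by (simp add: algebra_simps)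
  qed
  finally have "2 * f_lim p s + p * (s * d) = 1 / (1 - s)"
    using geometric_sums [of s] assms sums_unique2 by fastforce
  then show ?thesis
    using deriv \<open>0 < d\<close> by (intro exI [of _ "1 / 2 * d"]) auto
qed

lemma f_lim_continuous_on: "continuous_on {0..<1} (f_lim p)"
  by (intro continuous_at_imp_continuous_on ballI)
    (metis DERIV_isCont atLeastLessThan_iff f_lim_has_derivative)

lemma f_lim_strict_mono:
  assumes "0 \<le> s" "s < u" "u < 1"
  shows "f_lim p s < f_lim p u"
proof (rule DERIV_pos_imp_increasing_open [OF \<open>s < u\<close>])
  show "\<exists>d. (f_lim p has_real_derivative d) (at x) \<and> 0 < d" if "s < x" "x < u" for x
    using f_lim_has_derivative [of x] that assms by fastforce
  show "continuous_on {s..u} (f_lim p)"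
    by (rule continuous_on_subset [OF f_lim_continuous_on]) (use assms in auto)
qed

lemma f_lim_mono: "0 \<le> s \<Longrightarrow> s \<le> u \<Longrightarrow> u < 1 \<Longrightarrow> f_lim p s \<le> f_lim p u"
  using f_lim_strict_mono [of s u] by (cases "s = u") auto

text \<open>At s = 1 the terms dominate the harmonic series because p \<le> 1. A large partial sum
  there is a polynomial in s, hence still large for s slightly below 1.\<close>

lemma f_lim_unbounded: "\<exists>s. 0 \<le> s \<and> s < 1 \<and> f_lim p s \<ge> t"
proof -
  have ns: "\<not> summable (\<lambda>n. 1 / (1 + p * real n))"
  proof
    assume "summable (\<lambda>n. 1 / (1 + p * real n))"
    then have "summable (\<lambda>n. 1 / real (Suc n))"
    proof (rule summable_comparison_test')
      fix n
      have "1 + p * real n \<le> real (Suc n)" using p by (auto intro: mult_left_le_one_le)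
      then show "norm (1 / real (Suc n)) \<le> 1 / (1 + p * real n)"
        using p by (auto intro!: divide_left_mono mult_pos_pos add_pos_nonneg)
    qed
    then show False
      using not_summable_harmonic [where 'a = real] summable_Suc_iff [of "\<lambda>n. 1 / real n"]
      by (simp add: inverse_eq_divide)
  qed
  have "\<exists>N. (\<Sum>j<N. 1 / (1 + p * real j)) > 2 * t + 1"
  proof (rule ccontr)
    assume *: "\<not> ?thesis"
    have "summable (\<lambda>n. 1 / (1 + p * real n))"
    proof (rule bounded_imp_summable [where B = "2 * t + 1"])
      show "0 \<le> 1 / (1 + p * real n)" for n using p by simp
      show "(\<Sum>k\<le>n. 1 / (1 + p * real k)) \<le> 2 * t + 1" for n
        using * by (simp only: flip: lessThan_Suc_atMost) (meson not_le)
    qed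
    then show False using ns by blast
  qed
  then obtain N where N: "(\<Sum>j<N. 1 / (1 + p * real j)) > 2 * t + 1" by blast
  have "((\<lambda>s. \<Sum>j<N. s ^ j / (1 + p * real j)) \<longlongrightarrow> (\<Sum>j<N. 1 ^ j / (1 + p * real j))) (at_left 1)"
    by (intro tendsto_intros) (use p in \<open>smt (verit) mult_nonneg_nonneg of_nat_0_le_iff\<close>)
  then have "eventually (\<lambda>s. (\<Sum>j<N. s ^ j / (1 + p * real j)) > 2 * t) (at_left 1)"
    by (rule order_tendstoD) (use N in simp)
  moreover have "eventually (\<lambda>s::real. s \<in> {0<..<1}) (at_left 1)"
    by (rule eventually_at_left_real) simp
  ultimately have "eventually (\<lambda>s. (\<Sum>j<N. s ^ j / (1 + p * real j)) > 2 * t \<and> s \<in> {0<..<1}) (at_left (1::real))"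
    by eventually_elim auto
  then obtain s where s: "(\<Sum>j<N. s ^ j / (1 + p * real j)) > 2 * t" "0 < s" "s < 1"
    using eventually_happens' [OF trivial_limit_at_left_real] by fastforce
  have "(\<Sum>j<N. s ^ j / (1 + p * real j)) \<le> (\<Sum>j. s ^ j / (1 + p * real j))"
    using f_lim_summable [of s] s p by (intro sum_le_suminf) (auto intro!: divide_nonneg_nonneg)
  then show ?thesis using s by (intro exI [of _ s]) (simp add: f_lim_def)
qed

section \<open>The inverse function \<open>g_lim\<close> and the forest mass
  \<open>v_lim\<close>\<close>

lemma g_lim_ge_half:
  assumes "1 / 2 \<le> t"
  shows "0 \<le> g_lim p t" "g_lim p t < 1" "f_lim p (g_lim p t) = t"
proof -
  have inj: "inj_on (f_lim p) {0..<1}"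
    by (rule linorder_inj_onI) (use f_lim_strict_mono in \<open>force+\<close>)
  obtain s where s: "0 \<le> s" "s < 1" "t \<le> f_lim p s" using f_lim_unbounded by blast
  have "\<exists>x\<ge>0. x \<le> s \<and> f_lim p x = t"
    using s assms f_lim_0
    by (intro IVT') (auto intro: continuous_on_subset [OF f_lim_continuous_on])
  then have t: "t \<in> f_lim p ` {0..<1}" using s by force
  \<comment> \<open>At t = 1/2 the definition takes its constant branch; the two branches agree
    there because \<open>f_lim p 0 = 1 / 2\<close>.\<close>
  have "g_lim p t = inv_into {0..<1} (f_lim p) t"
  proof (cases "t = 1 / 2")
    case True
    have "inv_into {0..<1} (f_lim p) (f_lim p 0) = 0"
      by (rule inv_into_f_f [OF inj]) simp
    then show ?thesis by (simp add: g_lim_def f_lim_0 True)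
  qed (use assms in \<open>simp add: g_lim_def\<close>)
  then show "0 \<le> g_lim p t" "g_lim p t < 1" "f_lim p (g_lim p t) = t"
    using inv_into_into [OF t] f_inv_into_f [OF t] by auto
qed

lemma g_lim_le_half: "t \<le> 1 / 2 \<Longrightarrow> g_lim p t = 0"
  by (simp add: g_lim_def)

lemma g_lim_bounds: "0 \<le> g_lim p t" "g_lim p t < 1"
  using g_lim_ge_half [of t] g_lim_le_half [of t] by (cases "t \<le> 1 / 2"; simp)+

lemma g_lim_f_lim:
  assumes "0 \<le> s" "s < 1"
  shows "g_lim p (f_lim p s) = s"
proof -
  have "1 / 2 \<le> f_lim p s" using f_lim_mono [of 0 s] assms f_lim_0 by simp
  then show ?thesis
    using g_lim_ge_half [of "f_lim p s"] f_lim_strict_mono [of s "g_lim p (f_lim p s)"]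
      f_lim_strict_mono [of "g_lim p (f_lim p s)" s] assms
    by (cases s "g_lim p (f_lim p s)" rule: linorder_cases) auto
qed

lemma g_lim_mono: "s \<le> t \<Longrightarrow> g_lim p s \<le> g_lim p t"
proof (cases "s \<le> 1 / 2")
  case False
  assume "s \<le> t"
  show ?thesis
  proof (rule ccontr)
    assume "\<not> ?thesis"
    then have "f_lim p (g_lim p t) < f_lim p (g_lim p s)"
      by (intro f_lim_strict_mono g_lim_bounds) auto
    then show False using False \<open>s \<le> t\<close> by (simp add: g_lim_ge_half)
  qed
qed (simp add: g_lim_le_half g_lim_bounds)

lemma g_lim_continuous_on: "continuous_on {0..T} (g_lim p)"
proof -
  define b where "b = max T (1 / 2)"
  have "continuous_on (f_lim p ` {0..g_lim p b}) (g_lim p)"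
  proof (rule continuous_on_inv)
    show "continuous_on {0..g_lim p b} (f_lim p)"
      by (rule continuous_on_subset [OF f_lim_continuous_on]) (use g_lim_bounds [of b] in auto)
    show "\<forall>x\<in>{0..g_lim p b}. g_lim p (f_lim p x) = x"
      using g_lim_bounds [of b] by (auto intro: g_lim_f_lim)
  qed simp
  moreover have "{1 / 2..b} \<subseteq> f_lim p ` {0..g_lim p b}"
  proof
    fix t assume t: "t \<in> {1 / 2..b}"
    then show "t \<in> f_lim p ` {0..g_lim p b}"
      using g_lim_ge_half [of t] g_lim_mono [of t b] by (intro image_eqI [of _ _ "g_lim p t"]) auto
  qed
  ultimately have 1: "continuous_on {1 / 2..b} (g_lim p)"
    by (rule continuous_on_subset)
  have 2: "continuous_on {..1 / 2} (g_lim p)"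
    by (rule continuous_on_eq [of _ "\<lambda>_. 0"]) (auto simp: g_lim_le_half)
  have "continuous_on ({..1 / 2} \<union> {1 / 2..b}) (g_lim p)"
    by (intro continuous_on_closed_Un 1 2) auto
  then show ?thesis
    by (rule continuous_on_subset) (auto simp: b_def)
qed

lemma v_lim_bounds: "0 < v_lim p t" "v_lim p t \<le> 1"
  using g_lim_bounds [of t] by (auto simp: v_lim_def)

lemma v_lim_antimono: "s \<le> t \<Longrightarrow> v_lim p t \<le> v_lim p s"
  using g_lim_mono by (simp add: v_lim_def)

lemma v_lim_continuous_on: "continuous_on {0..T} (v_lim p)"
  unfolding v_lim_def by (intro continuous_intros g_lim_continuous_on)

lemma v_lim_le_half: "t \<le> 1 / 2 \<Longrightarrow> v_lim p t = 1"
  by (simp add: v_lim_def g_lim_le_half)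

text \<open>Dropping p j from the denominators gives 2 f(s) \<le> 1 / (1 - s). The bound places y =
  2 t v in the range [0, 1] where the rooted tree series returns y.\<close>

lemma two_t_v_lim_le_1: "2 * t * v_lim p t \<le> 1"
proof (cases "t \<le> 1 / 2")
  case False
  define s where "s = g_lim p t"
  have s: "0 \<le> s" "s < 1" "f_lim p s = t" using False g_lim_ge_half by (auto simp: s_def)
  have "(\<Sum>j. s ^ j / (1 + p * real j)) \<le> (\<Sum>j. s ^ j)"
  proof (intro suminf_le f_lim_summable summable_geometric s)
    fix j
    have "1 \<le> 1 + p * real j" using p by simp
    then have "s ^ j / (1 + p * real j) \<le> s ^ j / 1"
      using s by (intro divide_left_mono) auto
    then show "s ^ j / (1 + p * real j) \<le> s ^ j" by simp
  qed (use s in auto)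
  also have "\<dots> = 1 / (1 - s)" using s by (intro suminf_geometric) auto
  finally have "2 * t \<le> 1 / (1 - s)" using s by (simp add: f_lim_def)
  then show ?thesis using s by (simp add: v_lim_def field_simps flip: s_def)
qed (simp add: v_lim_le_half)

section \<open>The integrated rate \<open>W_lim\<close>\<close>

lemma W_lim_0: "W_lim p 0 = 0"
  by (simp add: W_lim_def v_lim_le_half)

lemma W_lim_f_lim:
  assumes "0 \<le> s" "s < 1"
  shows "W_lim p (f_lim p s) = 2 * f_lim p s * (1 - s) - ln (1 - s)"
  using assms by (simp add: W_lim_def v_lim_def g_lim_f_lim)

text \<open>In the variable \<open>s = g_lim p t\<close> the function \<^const>\<open>W_lim\<close> is differentiable across the
  critical time, and its derivative is \<open>2 * (1 - (1 - p) * s)\<close> times that of \<^const>\<open>f_lim\<close>.\<close>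

lemma W_lim_increment_ge_half:
  assumes "1 / 2 \<le> a" "a \<le> b"
  shows "2 * (b - a) * (p + (1 - p) * v_lim p b) \<le> W_lim p b - W_lim p a"
    and "W_lim p b - W_lim p a \<le> 2 * (b - a) * (p + (1 - p) * v_lim p a)"
proof -
  define s u where "s = g_lim p a" and "u = g_lim p b"
  have s: "0 \<le> s" "s < 1" "f_lim p s = a" "v_lim p a = 1 - s"
    using assms g_lim_ge_half [of a] by (auto simp: s_def v_lim_def)
  have u: "0 \<le> u" "u < 1" "f_lim p u = b" "v_lim p b = 1 - u"
    using assms g_lim_ge_half [of b] by (auto simp: u_def v_lim_def)
  have su: "s \<le> u" using assms g_lim_mono by (simp add: s_def u_def)
  \<comment> \<open>\<open>\<Psi> q\<close> is \<open>W_lim - 2 * q * t\<close> in the variable s.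
    The sign of its derivative is that of the rate at s minus q, so taking for q the rate at one end
    of the interval makes it monotone.\<close>
  define \<Psi> where "\<Psi> q x = 2 * f_lim p x * (1 - x) - ln (1 - x) - 2 * q * f_lim p x" for q x
  have deriv: "\<exists>d>0. (\<Psi> q has_real_derivative 2 * d * (p + (1 - p) * (1 - x) - q)) (at x)"
    if x: "0 \<le> x" "x < 1" for q x
  proof -
    obtain d where d: "d > 0" "(f_lim p has_real_derivative d) (at x)"
        "2 * f_lim p x + 2 * p * x * d = 1 / (1 - x)"
      using f_lim_has_derivative [OF x] by blast
    have "(\<Psi> q has_real_derivative (2 * d * (1 - x) - 2 * f_lim p x + 1 / (1 - x) - 2 * q * d)) (at x)"
      unfolding \<Psi>_def [abs_def] using x d(2) by (auto intro!: derivative_eq_intros simp: algebra_simps)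
    also have "2 * d * (1 - x) - 2 * f_lim p x + 1 / (1 - x) - 2 * q * d = 2 * d * (p + (1 - p) * (1 - x) - q)"
      by (simp flip: d(3)) (simp add: algebra_simps)
    finally show ?thesis using d(1) by blast
  qed
  have "\<Psi> (p + (1 - p) * v_lim p a) u \<le> \<Psi> (p + (1 - p) * v_lim p a) s"
  proof (rule DERIV_nonpos_imp_nonincreasing [OF su])
    fix x assume x: "s \<le> x" "x \<le> u"
    obtain d where d: "d > 0" "(\<Psi> (p + (1 - p) * v_lim p a) has_real_derivative
        2 * d * (p + (1 - p) * (1 - x) - (p + (1 - p) * v_lim p a))) (at x)"
      using deriv [of x] x s u by (meson le_less_trans order_trans)
    have "(1 - p) * (1 - x) \<le> (1 - p) * v_lim p a"
      using s x p by (intro mult_left_mono) auto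
    then show "\<exists>y. (\<Psi> (p + (1 - p) * v_lim p a) has_real_derivative y) (at x) \<and> y \<le> 0"
      using d by (intro exI [of _ "2 * d * (p + (1 - p) * (1 - x) - (p + (1 - p) * v_lim p a))"] conjI mult_nonneg_nonpos) auto
  qed
  then show "W_lim p b - W_lim p a \<le> 2 * (b - a) * (p + (1 - p) * v_lim p a)"
    using W_lim_f_lim [OF s(1,2)] W_lim_f_lim [OF u(1,2)]
    by (simp add: \<Psi>_def s(3) u(3) algebra_simps)
  have "\<Psi> (p + (1 - p) * v_lim p b) s \<le> \<Psi> (p + (1 - p) * v_lim p b) u"
  proof (rule DERIV_nonneg_imp_nondecreasing [OF su])
    fix x assume x: "s \<le> x" "x \<le> u"
    obtain d where d: "d > 0" "(\<Psi> (p + (1 - p) * v_lim p b) has_real_derivative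
        2 * d * (p + (1 - p) * (1 - x) - (p + (1 - p) * v_lim p b))) (at x)"
      using deriv [of x] x s u by (meson le_less_trans order_trans)
    have "(1 - p) * (1 - x) \<ge> (1 - p) * v_lim p b"
      using u x p by (intro mult_left_mono) auto
    then show "\<exists>y. (\<Psi> (p + (1 - p) * v_lim p b) has_real_derivative y) (at x) \<and> 0 \<le> y"
      using d by (intro exI [of _ "2 * d * (p + (1 - p) * (1 - x) - (p + (1 - p) * v_lim p b))"] conjI mult_nonneg_nonneg) auto
  qed
  then show "2 * (b - a) * (p + (1 - p) * v_lim p b) \<le> W_lim p b - W_lim p a"
    using W_lim_f_lim [OF s(1,2)] W_lim_f_lim [OF u(1,2)]
    by (simp add: \<Psi>_def s(3) u(3) algebra_simps)
qed

lemma W_lim_increment_le_half: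
  assumes "a \<le> b" "b \<le> 1 / 2"
  shows "W_lim p b - W_lim p a = 2 * (b - a)"
  using assms by (simp add: W_lim_def v_lim_le_half)

text \<open>Integrated form of W' = 2 w, using that w = p + (1 - p) v decreases in time: an
  increment lies between the rates at the two ends. In this form it passes across the kink at t =
  1/2 by adding the two pieces.\<close>

lemma W_lim_increment:
  assumes "a \<le> b"
  shows "2 * (b - a) * (p + (1 - p) * v_lim p b) \<le> W_lim p b - W_lim p a"
    and "W_lim p b - W_lim p a \<le> 2 * (b - a) * (p + (1 - p) * v_lim p a)"
proof -
  consider "b \<le> 1 / 2" | "1 / 2 \<le> a" | "a \<le> 1 / 2" "1 / 2 \<le> b" using assms by linarith
  then have "2 * (b - a) * (p + (1 - p) * v_lim p b) \<le> W_lim p b - W_lim p a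
    \<and> W_lim p b - W_lim p a \<le> 2 * (b - a) * (p + (1 - p) * v_lim p a)"
  proof cases
    case 1
    then show ?thesis using assms by (simp add: W_lim_increment_le_half v_lim_le_half)
  next
    case 2
    then show ?thesis using assms W_lim_increment_ge_half by blast
  next
    case 3
    have W: "W_lim p (1 / 2) - W_lim p a = 2 * (1 / 2 - a)"
      using 3 by (intro W_lim_increment_le_half) auto
    have v: "(1 - p) * v_lim p b \<le> (1 - p) * 1"
      using p v_lim_bounds by (intro mult_left_mono) auto
    have "2 * (1 / 2 - a) * (p + (1 - p) * v_lim p b) \<le> 2 * (1 / 2 - a) * 1"
      using v 3 by (intro mult_left_mono) auto
    moreover have "2 * (b - 1 / 2) * (p + (1 - p) * v_lim p b) \<le> W_lim p b - W_lim p (1 / 2)"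
      using 3 W_lim_increment_ge_half(1) [of "1 / 2" b] by simp
    ultimately have "2 * (b - a) * (p + (1 - p) * v_lim p b) \<le> W_lim p b - W_lim p a"
      using W by (simp add: left_diff_distrib right_diff_distrib distrib_right distrib_left)
    moreover have "W_lim p b - W_lim p (1 / 2) \<le> 2 * (b - 1 / 2) * 1"
      using 3 W_lim_increment_ge_half(2) [of "1 / 2" b] by (simp add: v_lim_le_half)
    ultimately show ?thesis using W 3 by (simp add: v_lim_le_half)
  qed
  then show "2 * (b - a) * (p + (1 - p) * v_lim p b) \<le> W_lim p b - W_lim p a"
    and "W_lim p b - W_lim p a \<le> 2 * (b - a) * (p + (1 - p) * v_lim p a)" by auto
qed

section \<open>The limiting tree masses and their sums\<close>

lemma c_lim_0 [simp]: "c_lim p 0 t = 0"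
  by (simp add: c_lim_def)

lemma c_lim_eq:
  "c_lim p k t = tree_coeff k * (2 * t) ^ (k - 1) * exp (- real k * W_lim p t)"
proof (cases k)
  case (Suc j)
  have "exp (real k * ln (v_lim p t)) = v_lim p t ^ k"
    using v_lim_bounds [of t] by (simp add: exp_of_nat_mult)
  then have "exp (- real k * W_lim p t) = exp (- 2 * real k * t * v_lim p t) * v_lim p t ^ k"
    using exp_add [of "real k * ln (v_lim p t)" "- 2 * real k * t * v_lim p t"]
    by (simp add: W_lim_def algebra_simps)
  moreover have "real k * (real k ^ (k - 2) / fact k) = tree_coeff k"
    by (cases j) (simp_all add: tree_coeff_def Suc)
  moreover have "c_lim p k t = real k * (real k ^ (k - 2) / fact k) * (2 * t) ^ (k - 1)
      * (exp (- 2 * real k * t * v_lim p t) * v_lim p t ^ k)"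
    by (simp add: c_lim_def t_lim_def v_lim_def)
  ultimately show ?thesis
    by (simp only:)
qed simp

lemma c_lim_nonneg: "t \<ge> 0 \<Longrightarrow> 0 \<le> c_lim p k t"
  by (simp add: c_lim_eq tree_coeff_nonneg)

text \<open>With y = 2 t v these are the terms of the rooted tree series at y exp (- y). The first
  form serves to sum them; the second has one factor 2 t cancelled and therefore gives bounds down
  to t = 0.\<close>

lemma c_lim_tree_series:
  assumes "k \<noteq> 0"
  shows "2 * t * c_lim p k t = tree_coeff k * ((2 * t * v_lim p t) * exp (- (2 * t * v_lim p t))) ^ k"
    and "c_lim p k t = tree_coeff k * ((2 * t * v_lim p t) * exp (- (2 * t * v_lim p t))) ^ (k - 1)
       * v_lim p t * exp (- (2 * t * v_lim p t))"
proof -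
  obtain j where k: "k = Suc j" using assms by (cases k) auto
  have "exp (real k * ln (v_lim p t)) = v_lim p t ^ k"
    using v_lim_bounds [of t] by (simp add: exp_of_nat_mult)
  then have e: "exp (- real k * W_lim p t) = exp (- (2 * t * v_lim p t)) ^ k * v_lim p t ^ k"
    using exp_add [of "real k * ln (v_lim p t)" "real k * (- (2 * t * v_lim p t))"]
      exp_of_nat_mult [of k "- (2 * t * v_lim p t)"]
    by (simp add: W_lim_def algebra_simps)
  show "2 * t * c_lim p k t = tree_coeff k * ((2 * t * v_lim p t) * exp (- (2 * t * v_lim p t))) ^ k"
    unfolding c_lim_eq e by (simp add: k power_mult_distrib)
  show "c_lim p k t = tree_coeff k * ((2 * t * v_lim p t) * exp (- (2 * t * v_lim p t))) ^ (k - 1)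
       * v_lim p t * exp (- (2 * t * v_lim p t))"
    unfolding c_lim_eq e by (simp add: k power_mult_distrib)
qed

lemma c_lim_zero: "c_lim p k 0 = (if k = 1 then 1 else 0)"
  by (cases k) (auto simp: c_lim_eq W_lim_0)

text \<open>The rooted series at y exp (- y) sums to y = 2 t v, the unrooted one to y - y^2 / 2 = 2
  t (v - t v^2). At t = 0 the factor 2 t cannot be cancelled, so that case is computed
  directly.\<close>

lemma c_lim_sums:
  assumes "0 \<le> t"
  shows "(\<lambda>k. c_lim p k t) sums v_lim p t"
    and "(\<lambda>k. c_lim p k t / real k) sums (v_lim p t - t * (v_lim p t)\<^sup>2)"
proof -
  let ?y = "2 * t * v_lim p t"
  let ?z = "?y * exp (- ?y)"
  have y: "0 \<le> ?y" "?y \<le> 1" using assms v_lim_bounds [of t] two_t_v_lim_le_1 by auto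
  have "(\<lambda>k. c_lim p k t) sums v_lim p t \<and> (\<lambda>k. c_lim p k t / real k) sums (v_lim p t - t * (v_lim p t)\<^sup>2)"
  proof (cases "t = 0")
    case True
    have "(\<lambda>k. if k = 1 then 1 else 0 :: real) sums 1"
      using sums_single [of 1 "\<lambda>_. 1::real"] by simp
    moreover have "(\<lambda>k. (if k = 1 then 1 else 0 :: real) / real k) = (\<lambda>k. if k = 1 then 1 else 0)"
      by auto
    ultimately show ?thesis
      by (simp add: True c_lim_zero v_lim_le_half del: One_nat_def)
  next
    case False
    have eq: "tree_coeff k * ?z ^ k = 2 * t * c_lim p k t" for k
      using c_lim_tree_series(1) [of k t] by (cases k) auto
    have s: "(\<lambda>k. 2 * t * c_lim p k t) sums ?y"
      using rooted_tree_series [OF y] by (simp only: eq)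
    have z: "0 \<le> ?z" using y by simp
    have "(\<lambda>k. tree_coeff k / real k * ?z ^ k) sums (?y - ?y\<^sup>2 / 2)"
      using unrooted_tree_series [OF z] rooted_tree_series [OF y] by (simp only: sums_iff)
    moreover have "tree_coeff k / real k * ?z ^ k = 2 * t * (c_lim p k t / real k)" for k
      using eq [of k] by (simp only: times_divide_eq_left times_divide_eq_right)
    ultimately have s2: "(\<lambda>k. 2 * t * (c_lim p k t / real k)) sums (?y - ?y\<^sup>2 / 2)"
      by (simp only:)
    have "?y - ?y\<^sup>2 / 2 = 2 * t * (v_lim p t - t * (v_lim p t)\<^sup>2)"
      by (simp add: power2_eq_square algebra_simps)
    with s2 have "(\<lambda>k. 2 * t * (c_lim p k t / real k)) sums (2 * t * (v_lim p t - t * (v_lim p t)\<^sup>2))"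
      by simp
    then have "(\<lambda>k. c_lim p k t / real k) sums (v_lim p t - t * (v_lim p t)\<^sup>2)"
      using False by (rule_tac iffD1 [OF sums_mult_iff, of "2 * t"]) auto
    moreover have "(\<lambda>k. c_lim p k t) sums v_lim p t"
      using s False by (rule_tac iffD1 [OF sums_mult_iff, of "2 * t"]) auto
    ultimately show ?thesis by blast
  qed
  then show "(\<lambda>k. c_lim p k t) sums v_lim p t"
    and "(\<lambda>k. c_lim p k t / real k) sums (v_lim p t - t * (v_lim p t)\<^sup>2)" by auto
qed

text \<open>y exp (- y) is largest at y = 1, so every term is dominated by the critical one, whose
  series converges. The exponent k - 1 in place of k accounts for the factor exp 1. This gives tails
  that are small uniformly in t, even at the critical time.\<close>

lemma c_lim_dominated:
  assumes "0 \<le> t"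
  shows "c_lim p k t \<le> exp 1 * (tree_coeff k * exp (-1) ^ k)"
proof (cases k)
  case (Suc j)
  let ?y = "2 * t * v_lim p t"
  have y: "0 \<le> ?y" "?y \<le> 1" using assms v_lim_bounds [of t] two_t_v_lim_le_1 by auto
  have "?y * exp (- ?y) \<le> exp (-1)"
    using mult_exp_minus_strict_mono [of ?y 1] y by (cases "?y = 1") auto
  then have "(?y * exp (- ?y)) ^ j \<le> exp (-1) ^ j" using y by (intro power_mono) auto
  moreover have "v_lim p t * exp (- ?y) \<le> 1"
    using y v_lim_bounds [of t] by (intro mult_le_one) auto
  ultimately have "(?y * exp (- ?y)) ^ j * (v_lim p t * exp (- ?y)) \<le> exp (-1) ^ j * 1"
    using v_lim_bounds [of t] by (intro mult_mono) auto
  then have "tree_coeff k * ((?y * exp (- ?y)) ^ j * (v_lim p t * exp (- ?y))) \<le> tree_coeff k * exp (-1) ^ j"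
    using tree_coeff_nonneg [of k] by (intro mult_left_mono) auto
  then have "c_lim p k t \<le> tree_coeff k * exp (-1) ^ j"
    using c_lim_tree_series(2) [of k t] Suc by (simp add: mult.assoc)
  also have "\<dots> = exp 1 * (tree_coeff k * exp (-1) ^ k)"
    by (simp add: Suc exp_minus)
  finally show ?thesis .
qed simp

lemma c_lim_tail:
  assumes "0 < \<epsilon>"
  obtains K where "\<And>t. 0 \<le> t \<Longrightarrow> v_lim p t - (\<Sum>k\<le>K. c_lim p k t) \<le> \<epsilon>"
proof -
  let ?b = "\<lambda>k. exp 1 * (tree_coeff k * exp (-1) ^ k)"
  have sb: "summable ?b"
    using rooted_tree_series [of 1] by (intro summable_mult) (auto simp: sums_iff)
  then obtain N where N: "norm (\<Sum>k. ?b (k + N)) < \<epsilon>"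
    using suminf_exist_split [OF assms sb] by blast
  show ?thesis
  proof (rule that [of N])
    fix t :: real assume t: "0 \<le> t"
    have s: "summable (\<lambda>k. c_lim p k t)" "(\<Sum>k. c_lim p k t) = v_lim p t"
      using c_lim_sums(1) [OF t] by (auto simp: sums_iff)
    have "v_lim p t - (\<Sum>k\<le>N. c_lim p k t) \<le> v_lim p t - (\<Sum>k<N. c_lim p k t)"
      using c_lim_nonneg [OF t] by (simp add: lessThan_Suc_atMost [symmetric])
    also have "\<dots> = (\<Sum>k. c_lim p (k + N) t)"
      using suminf_minus_initial_segment [OF s(1), of N] s(2) by simp
    also have "\<dots> \<le> (\<Sum>k. ?b (k + N))"
      by (intro suminf_le c_lim_dominated t summable_ignore_initial_segment [OF s(1)] summable_ignore_initial_segment [OF sb])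
    also have "\<dots> \<le> \<epsilon>" using N by simp
    finally show "v_lim p t - (\<Sum>k\<le>N. c_lim p k t) \<le> \<epsilon>" .
  qed
qed

lemma c_lim_continuous_on: "continuous_on {0..T} (c_lim p k)"
  unfolding c_lim_def t_lim_def
  by (intro continuous_intros g_lim_continuous_on)

end

section \<open>Adding an edge to a multigraph of trees and unicycles\<close>

lemma sym_adj: "sym (adj G)"
  by (auto simp: adj_def sym_def insert_commute)

lemma component_refl [simp]: "v \<in> component G v"
  by (simp add: component_def)

lemma component_sym: "w \<in> component G v \<longleftrightarrow> v \<in> component G w"
  using sym_rtrancl [OF sym_adj [of G]] by (auto simp: component_def sym_def)

lemma component_eq_iff: "component G v = component G w \<longleftrightarrow> w \<in> component G v"
proof
  assume "w \<in> component G v"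
  moreover from this have "v \<in> component G w" by (simp add: component_sym)
  ultimately show "component G v = component G w"
    by (auto simp: component_def)
qed (metis component_refl)

lemma component_disjoint:
  "component G v \<noteq> component G w \<Longrightarrow> component G v \<inter> component G w = {}"
  by (metis component_eq_iff disjoint_iff)

lemma edge_in_component:
  assumes "e \<in># G" "card e = 2" "e \<inter> component G v \<noteq> {}"
  shows "e \<subseteq> component G v"
proof -
  obtain x y where e: "e = {x, y}" using assms by (auto simp: card_2_iff)
  then have "(x, y) \<in> adj G" "(y, x) \<in> adj G" using assms by (auto simp: adj_def insert_commute)
  then show ?thesis using assms e
    by (auto simp: component_def intro: rtrancl_into_rtrancl)
qed

lemma component_subset:
  assumes "set_mset G \<subseteq> possible_edges n" "v \<in> {1..n}"
  shows "component G v \<subseteq> {1..n}"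
proof
  fix w assume "w \<in> component G v"
  then have "(v, w) \<in> (adj G)\<^sup>*" by (simp add: component_def)
  then show "w \<in> {1..n}"
    by (induction rule: rtrancl_induct) (use assms in \<open>auto simp: adj_def possible_edges_def\<close>)
qed

lemma adj_add_edge: "adj (add_mset {u, v} G) = insert (u, v) (insert (v, u) (adj G))"
  by (auto simp: adj_def doubleton_eq_iff)

lemma component_add_edge:
  "component (add_mset {u, v} G) w =
     (if w \<in> component G u \<union> component G v then component G u \<union> component G v else component G w)"
proof -
  have iff: "(x, y) \<in> (adj G)\<^sup>* \<longleftrightarrow> component G x = component G y" for x y
    unfolding component_eq_iff by (simp add: component_def)
  have "y \<in> component (add_mset {u, v} G) w \<longleftrightarrow> (w, y) \<in> (adj G)\<^sup>* \<or>
     (w, v) \<in> (adj G)\<^sup>* \<and> (u, y) \<in> (adj G)\<^sup>* \<or> (w, u) \<in> (adj G)\<^sup>* \<and> (v, y) \<in> (adj G)\<^sup>*" for y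
    unfolding component_def adj_add_edge rtrancl_insert
    by (auto intro: rtrancl_trans simp: iff)
  then have 1: "y \<in> component (add_mset {u, v} G) w \<longleftrightarrow> component G w = component G y \<or>
     component G w = component G v \<and> component G u = component G y \<or>
     component G w = component G u \<and> component G v = component G y" for y
    by (simp only: iff)
  have 2: "y \<in> component G x \<longleftrightarrow> component G x = component G y" for x y
    by (rule component_eq_iff [symmetric])
  show ?thesis
  proof (rule set_eqI)
    fix y
    have "y \<in> component (add_mset {u, v} G) w \<longleftrightarrow> (if component G u = component G w \<or> component G v = component G w
       then component G u = component G y \<or> component G v = component G y else component G w = component G y)"
      unfolding 1 by (cases "component G u = component G w"; cases "component G v = component G w"; simp)
        (auto dest: sym)
    then show "y \<in> component (add_mset {u, v} G) w \<longleftrightarrow> y \<in> (if w \<in> component G u \<union> component G v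
       then component G u \<union> component G v else component G w)"
      by (cases "component G u = component G w \<or> component G v = component G w")
        (simp_all only: Un_iff 2 if_True if_False simp_thms)
  qed
qed

lemma num_edges_add_edge:
  "num_edges (add_mset e G) C = num_edges G C + (if e \<subseteq> C then 1 else 0)"
  by (simp add: num_edges_def)

text \<open>\<open>A\<close> and \<open>B\<close> are unions of components, so no edge runs between
  them, and being disjoint they share none.\<close>

lemma num_edges_Un:
  assumes edges: "set_mset G \<subseteq> possible_edges n"
    and A: "\<And>x. x \<in> A \<Longrightarrow> component G x \<subseteq> A" and B: "\<And>x. x \<in> B \<Longrightarrow> component G x \<subseteq> B"
    and disj: "A \<inter> B = {}"
  shows "num_edges G (A \<union> B) = num_edges G A + num_edges G B"
proof -
  have e: "e \<subseteq> A \<union> B \<longleftrightarrow> e \<subseteq> A \<or> e \<subseteq> B" "\<not> (e \<subseteq> A \<and> e \<subseteq> B)" if "e \<in># G" for e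
  proof -
    have c: "card e = 2" using that edges by (auto simp: possible_edges_def)
    then obtain x where x: "x \<in> e" by fastforce
    have "e \<subseteq> component G x" using edge_in_component [OF that c, of x] x component_refl by blast
    then show "e \<subseteq> A \<union> B \<longleftrightarrow> e \<subseteq> A \<or> e \<subseteq> B" using A B x by blast
    show "\<not> (e \<subseteq> A \<and> e \<subseteq> B)" using x disj by blast
  qed
  have "{#e \<in># G. e \<subseteq> A \<union> B#} = {#e \<in># G. e \<subseteq> A#} + {#e \<in># G. e \<subseteq> B#}"
  proof (rule multiset_eqI)
    fix e
    show "count {#e \<in># G. e \<subseteq> A \<union> B#} e = count ({#e \<in># G. e \<subseteq> A#} + {#e \<in># G. e \<subseteq> B#}) e"
      using e [of e] by (cases "e \<in># G") (auto simp: not_in_iff)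
  qed
  then show ?thesis by (simp add: num_edges_def)
qed

text \<open>The invariant of the chain. On it, the last case of \<open>frozen_step\<close> really is
  an edge between a tree and a unicycle.\<close>

definition good_graph :: "nat \<Rightarrow> multigraph \<Rightarrow> bool" where
  "good_graph n G \<longleftrightarrow> set_mset G \<subseteq> possible_edges n \<and> (\<forall>v\<in>{1..n}. in_tree G v \<or> frozen G v)"

text \<open>A set \<open>S\<close> of admissible sizes lets one computation serve both a single size
  \<open>{k}\<close> and all trees \<open>{1..}\<close>.\<close>

definition trees :: "nat \<Rightarrow> nat set \<Rightarrow> multigraph \<Rightarrow> nat set set" where
  "trees n S G = {C \<in> components n G. is_tree G C \<and> card C \<in> S}"

text \<open>The value 0 encodes a frozen vertex; hence the recurring condition
  \<open>0 \<notin> S\<close>.\<close>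

definition tree_size :: "multigraph \<Rightarrow> nat \<Rightarrow> nat" where
  "tree_size G v = (if in_tree G v then card (component G v) else 0)"

lemma num_trees_eq: "num_trees n k G = card (trees n {k} G)"
  by (simp add: num_trees_def trees_def)

lemma finite_trees [simp]: "finite (trees n S G)"
  by (simp add: trees_def components_def)

section \<open>Effect of one added edge on the tree components\<close>

context
  fixes n :: nat and G :: multigraph
  assumes good: "good_graph n G"
begin

lemma good_edges: "set_mset G \<subseteq> possible_edges n"
  using good by (simp add: good_graph_def)

lemma finite_component: "v \<in> {1..n} \<Longrightarrow> finite (component G v)"
  using component_subset [OF good_edges, of v] finite_subset by blast

lemma card_component_pos: "v \<in> {1..n} \<Longrightarrow> 0 < card (component G v)"
  by (metis finite_component card_gt_0_iff component_refl empty_iff)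

lemma tree_size_pos_iff: "v \<in> {1..n} \<Longrightarrow> 0 < tree_size G v \<longleftrightarrow> in_tree G v"
  using card_component_pos by (simp add: tree_size_def)

lemma tree_size_le: "v \<in> {1..n} \<Longrightarrow> tree_size G v \<le> n"
  using card_mono [OF _ component_subset [OF good_edges, of v]] by (simp add: tree_size_def)

lemma num_edges_component_Un:
  assumes "component G u \<noteq> component G v"
  shows "num_edges G (component G u \<union> component G v) = num_edges G (component G u) + num_edges G (component G v)"
proof (rule num_edges_Un [OF good_edges])
  show "component G x \<subseteq> component G u" if "x \<in> component G u" for x using that component_eq_iff by blast
  show "component G x \<subseteq> component G v" if "x \<in> component G v" for x using that component_eq_iff by blast
qed (use assms component_disjoint in auto)

text \<open>Compare vertices minus edges, which is 1 for a tree and 0 for a unicycle. It adds up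
  over distinct components and the new edge lowers it by 1: two trees give 1, a tree with a unicycle
  or an edge inside a tree gives 0, and anything else is negative.\<close>

lemma is_tree_merged:
  assumes "u \<in> {1..n}" "v \<in> {1..n}"
  shows "is_tree (add_mset {u, v} G) (component G u \<union> component G v) \<longleftrightarrow>
     component G u \<noteq> component G v \<and> in_tree G u \<and> in_tree G v"
    and "in_tree G u \<or> in_tree G v \<Longrightarrow>
       is_tree (add_mset {u, v} G) (component G u \<union> component G v) \<or>
       is_unicycle (add_mset {u, v} G) (component G u \<union> component G v)"
proof -
  have tf: "in_tree G w \<or> frozen G w" if "w \<in> {1..n}" for w
    using good that by (simp add: good_graph_def)
  have num: "num_edges (add_mset {u, v} G) (component G u \<union> component G v)
    = num_edges G (component G u \<union> component G v) + 1"
    by (simp add: num_edges_add_edge)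
  have "(is_tree (add_mset {u, v} G) (component G u \<union> component G v) \<longleftrightarrow>
       component G u \<noteq> component G v \<and> in_tree G u \<and> in_tree G v) \<and>
     (in_tree G u \<or> in_tree G v \<longrightarrow>
       is_tree (add_mset {u, v} G) (component G u \<union> component G v) \<or>
       is_unicycle (add_mset {u, v} G) (component G u \<union> component G v))"
  proof (cases "component G u = component G v")
    case True
    then show ?thesis
      using tf [OF assms(1)] tf [OF assms(2)] num
      by (auto simp: in_tree_def frozen_def is_tree_def is_unicycle_def)
  next
    case False
    have "card (component G u \<union> component G v) = card (component G u) + card (component G v)"
      using assms False component_disjoint by (intro card_Un_disjoint finite_component) auto
    then show ?thesis
      using tf [OF assms(1)] tf [OF assms(2)] num num_edges_component_Un [OF False] False
      by (auto simp: in_tree_def frozen_def is_tree_def is_unicycle_def)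
  qed
  then show "is_tree (add_mset {u, v} G) (component G u \<union> component G v) \<longleftrightarrow>
     component G u \<noteq> component G v \<and> in_tree G u \<and> in_tree G v"
    and "in_tree G u \<or> in_tree G v \<Longrightarrow>
       is_tree (add_mset {u, v} G) (component G u \<union> component G v) \<or>
       is_unicycle (add_mset {u, v} G) (component G u \<union> component G v)" by blast+
qed

lemma is_tree_add_edge_other:
  assumes "w \<notin> component G u \<union> component G v"
  shows "is_tree (add_mset {u, v} G) (component G w) = is_tree G (component G w)"
    "is_unicycle (add_mset {u, v} G) (component G w) = is_unicycle G (component G w)"
proof -
  have "u \<notin> component G w" using assms component_sym by blast
  then show "is_tree (add_mset {u, v} G) (component G w) = is_tree G (component G w)"
    "is_unicycle (add_mset {u, v} G) (component G w) = is_unicycle G (component G w)"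
    by (simp_all add: is_tree_def is_unicycle_def num_edges_add_edge)
qed

text \<open>Freezing is irreversible. This is the source of the monotonicity of the forest mass, on
  which the uniform convergence of v rests.\<close>

lemma in_tree_add_edge:
  assumes "u \<in> {1..n}" "v \<in> {1..n}" "in_tree (add_mset {u, v} G) w"
  shows "in_tree G w"
proof (cases "w \<in> component G u \<union> component G v")
  case True
  then have "in_tree G u" "in_tree G v"
    using assms is_tree_merged(1) [OF assms(1,2)] by (auto simp: in_tree_def component_add_edge)
  then show ?thesis using True by (auto simp: in_tree_def) (metis component_eq_iff)+
next
  case False
  then show ?thesis
    using assms is_tree_add_edge_other by (auto simp: in_tree_def component_add_edge)
qed

lemma good_graph_add_edge:
  assumes "u \<in> {1..n}" "v \<in> {1..n}" "u \<noteq> v" "in_tree G u \<or> in_tree G v"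
  shows "good_graph n (add_mset {u, v} G)"
  unfolding good_graph_def
proof (intro conjI ballI)
  have "{u, v} \<in> possible_edges n" using assms(1-3) by (simp add: possible_edges_def)
  then show "set_mset (add_mset {u, v} G) \<subseteq> possible_edges n"
    using good_edges by simp
  fix w assume w: "w \<in> {1..n}"
  show "in_tree (add_mset {u, v} G) w \<or> frozen (add_mset {u, v} G) w"
  proof (cases "w \<in> component G u \<union> component G v")
    case True
    then show ?thesis
      using is_tree_merged(2) [OF assms(1,2,4)] by (simp add: in_tree_def frozen_def component_add_edge)
  next
    case False
    then show ?thesis
      using is_tree_add_edge_other [OF False] good w
      by (simp add: in_tree_def frozen_def component_add_edge good_graph_def)
  qed
qed

lemma components_add_edge:
  assumes "u \<in> {1..n}" "v \<in> {1..n}"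
  shows "components n (add_mset {u, v} G) =
    (components n G - {component G u, component G v}) \<union> {component G u \<union> component G v}"
proof -
  have "w \<in> component G u \<union> component G v \<longleftrightarrow> component G w \<in> {component G u, component G v}" for w
    by (metis Un_iff component_eq_iff insert_iff singleton_iff)
  then show ?thesis
    using assms by (auto simp: components_def component_add_edge image_iff)
qed

lemma trees_add_edge:
  assumes "u \<in> {1..n}" "v \<in> {1..n}"
  shows "trees n S (add_mset {u, v} G) = (trees n S G - {component G u, component G v}) \<union>
    (if component G u \<noteq> component G v \<and> in_tree G u \<and> in_tree G v \<and> tree_size G u + tree_size G v \<in> S
     then {component G u \<union> component G v} else {})"
proof -
  let ?A = "component G u" and ?B = "component G v"
  have other: "is_tree (add_mset {u, v} G) C = is_tree G C" if C: "C \<in> components n G" "C \<noteq> ?A" "C \<noteq> ?B" for C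
  proof -
    obtain w where w: "C = component G w" using C by (auto simp: components_def)
    have "w \<notin> ?A \<union> ?B" using C w component_eq_iff by (metis Un_iff)
    then show ?thesis using is_tree_add_edge_other(1) w by blast
  qed
  have "card (?A \<union> ?B) = card ?A + card ?B" if "?A \<noteq> ?B"
    using assms that component_disjoint by (intro card_Un_disjoint finite_component) auto
  then have "{C \<in> {?A \<union> ?B}. is_tree (add_mset {u, v} G) C \<and> card C \<in> S} =
    (if ?A \<noteq> ?B \<and> in_tree G u \<and> in_tree G v \<and> tree_size G u + tree_size G v \<in> S
     then {?A \<union> ?B} else {})"
    using is_tree_merged(1) [OF assms] by (simp add: tree_size_def cong: conj_cong)
  moreover have "{C \<in> components n G - {?A, ?B}. is_tree (add_mset {u, v} G) C \<and> card C \<in> S}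
    = trees n S G - {?A, ?B}"
    unfolding trees_def using other by blast
  moreover have "trees n S (add_mset {u, v} G)
    = {C \<in> components n G - {?A, ?B}. is_tree (add_mset {u, v} G) C \<and> card C \<in> S}
      \<union> {C \<in> {?A \<union> ?B}. is_tree (add_mset {u, v} G) C \<and> card C \<in> S}"
    unfolding trees_def components_add_edge [OF assms] by blast
  ultimately show ?thesis by (simp only:)
qed

lemma component_in_trees:
  assumes "v \<in> {1..n}" "0 \<notin> S"
  shows "component G v \<in> trees n S G \<longleftrightarrow> tree_size G v \<in> S"
  using assms by (auto simp: trees_def tree_size_def in_tree_def components_def)

text \<open>Change of the number of trees with size in \<open>S\<close> when the edge uv is added:
  the merged tree may enter, the old ones leave. The last indicator excludes equal components, so
  that a common tree is removed only once.\<close>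

definition jump :: "nat set \<Rightarrow> nat \<Rightarrow> nat \<Rightarrow> real" where
  "jump S u v =
    of_bool (component G u \<noteq> component G v \<and> 0 < tree_size G u \<and> 0 < tree_size G v \<and> tree_size G u + tree_size G v \<in> S)
    - of_bool (tree_size G u \<in> S) - of_bool (component G u \<noteq> component G v \<and> tree_size G v \<in> S)"

lemma card_trees_add_edge:
  assumes uv: "u \<in> {1..n}" "v \<in> {1..n}" and S: "0 \<notin> S"
  shows "real (card (trees n S (add_mset {u, v} G))) = real (card (trees n S G)) + jump S u v"
proof -
  let ?A = "component G u" and ?B = "component G v"
  let ?new = "component G u \<noteq> component G v \<and> in_tree G u \<and> in_tree G v \<and> tree_size G u + tree_size G v \<in> S"
  have notin: "?A \<union> ?B \<notin> trees n S G" if "?A \<noteq> ?B"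
  proof
    assume "?A \<union> ?B \<in> trees n S G"
    then obtain w where "?A \<union> ?B = component G w" by (auto simp: trees_def components_def)
    then have "u \<in> component G w" "v \<in> component G w" using component_refl by blast+
    then have "component G w = ?A" "component G w = ?B" by (simp_all add: component_eq_iff)
    then show False using that by simp
  qed
  have 1: "real (card (trees n S G - {?A, ?B}))
     = real (card (trees n S G)) - of_bool (?A \<in> trees n S G) - of_bool (?A \<noteq> ?B \<and> ?B \<in> trees n S G)"
  proof -
    have "trees n S G - {?A, ?B} = trees n S G - (trees n S G \<inter> {?A, ?B})" by blast
    then have "card (trees n S G - {?A, ?B}) = card (trees n S G) - card (trees n S G \<inter> {?A, ?B})"
      by (metis card_Diff_subset finite_Int finite_trees inf_le1)
    moreover have "card (trees n S G \<inter> {?A, ?B}) \<le> card (trees n S G)"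
      by (intro card_mono) auto
    moreover have "card (trees n S G \<inter> {?A, ?B}) = of_bool (?A \<in> trees n S G) + of_bool (?A \<noteq> ?B \<and> ?B \<in> trees n S G)"
      by (cases "?A \<in> trees n S G"; cases "?B \<in> trees n S G"; cases "?A = ?B") auto
    ultimately show ?thesis by auto
  qed
  have 2: "real (card (trees n S (add_mset {u, v} G))) = real (card (trees n S G - {?A, ?B})) + of_bool ?new"
    unfolding trees_add_edge [OF uv] using notin by (auto simp: card_insert_if)
  show ?thesis
    unfolding 2 1 jump_def component_in_trees [OF uv(1) S] component_in_trees [OF uv(2) S]
    using uv by (simp add: tree_size_pos_iff)
qed

text \<open>Passes from counting components to counting vertices, so that the drift becomes a double
  sum of indicators over \<open>{1..n}\<close>.\<close>

lemma card_tree_size_eq: "card {v \<in> {1..n}. tree_size G v = k} = k * num_trees n k G" if "0 < k"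
proof -
  have sub: "C \<subseteq> {1..n}" if "C \<in> trees n {k} G" for C
    using that component_subset [OF good_edges] unfolding trees_def components_def by blast
  have "v \<in> {1..n} \<and> tree_size G v = k \<longleftrightarrow> v \<in> \<Union> (trees n {k} G)" for v
  proof
    assume "v \<in> {1..n} \<and> tree_size G v = k"
    then have "component G v \<in> trees n {k} G"
      using component_in_trees [of v "{k}"] \<open>0 < k\<close> by auto
    then show "v \<in> \<Union> (trees n {k} G)" using component_refl by blast
  next
    assume "v \<in> \<Union> (trees n {k} G)"
    then obtain w where w: "w \<in> {1..n}" "component G w \<in> trees n {k} G" "v \<in> component G w"
      by (auto simp: trees_def components_def)
    then have "component G v = component G w" "v \<in> {1..n}" using sub component_eq_iff by blast+
    then show "v \<in> {1..n} \<and> tree_size G v = k" using w component_in_trees [of v "{k}"] \<open>0 < k\<close> by auto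
  qed
  then have "{v \<in> {1..n}. tree_size G v = k} = \<Union> (trees n {k} G)" by blast
  also have "card \<dots> = (\<Sum>C\<in>trees n {k} G. card C)"
  proof (rule card_Union_disjoint)
    show "pairwise disjnt (trees n {k} G)"
      unfolding pairwise_def disjnt_def trees_def components_def using component_disjoint by blast
    show "finite C" if "C \<in> trees n {k} G" for C using sub [OF that] finite_subset by blast
  qed
  also have "\<dots> = (\<Sum>C\<in>trees n {k} G. k)" by (intro sum.cong) (auto simp: trees_def)
  finally show ?thesis by (simp add: num_trees_eq)
qed

lemma forest_V_eq_sum: "forest_V n G = (\<Sum>k\<in>{1..n}. k * num_trees n k G)"
proof -
  have "forest_vertices n G = (\<Union>k\<in>{1..n}. {v \<in> {1..n}. tree_size G v = k})"
    using tree_size_pos_iff tree_size_le by (force simp: forest_vertices_def)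
  then have "forest_V n G = (\<Sum>k\<in>{1..n}. card {v \<in> {1..n}. tree_size G v = k})"
    unfolding forest_V_def by (simp only:) (intro card_UN_disjoint, auto)
  also have "\<dots> = (\<Sum>k\<in>{1..n}. k * num_trees n k G)"
    by (intro sum.cong card_tree_size_eq) auto
  finally show ?thesis .
qed

lemma card_trees_eq_sum: "card (trees n {1..} G) = (\<Sum>k\<in>{1..n}. num_trees n k G)"
proof -
  have "card C \<le> n" if "C \<in> components n G" for C
    using that card_mono [OF _ component_subset [OF good_edges]] by (auto simp: components_def)
  then have "trees n {1..} G = (\<Union>k\<in>{1..n}. trees n {k} G)"
    by (auto simp: trees_def)
  then have "card (trees n {1..} G) = (\<Sum>k\<in>{1..n}. card (trees n {k} G))"
    by (simp only:) (intro card_UN_disjoint ballI impI finite_trees, auto simp: trees_def)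
  then show ?thesis by (simp add: num_trees_eq)
qed

lemma num_trees_eq_0: "n < k \<Longrightarrow> num_trees n k G = 0"
  using card_mono [OF _ component_subset [OF good_edges]]
  by (auto simp: num_trees_def components_def card_eq_0_iff)
    (metis atLeastAtMost_iff card_atLeastAtMost diff_Suc_1 not_le)

text \<open>Each tree has one edge fewer than vertices. So the limit of the edges follows from those
  of the vertices and of the number of trees: v - (v - t v^2) = t v^2.\<close>

lemma forest_E_eq: "forest_E n G + card (trees n {1..} G) = forest_V n G"
proof -
  have gen: "num_edges G (\<Union> \<C>) + card \<C> = card (\<Union> \<C>)"
    if "finite \<C>" "\<C> \<subseteq> trees n {1..} G" for \<C>
    using that
  proof (induction \<C> rule: finite_induct)
    case empty
    have "{#e \<in># G. e \<subseteq> {}#} = {#}"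
      using good_edges by (intro multiset_eqI) (auto simp: possible_edges_def not_in_iff [symmetric])
    then show ?case by (simp add: num_edges_def)
  next
    case (insert C \<C>)
    have comp: "\<exists>w\<in>{1..n}. D = component G w" if "D \<in> insert C \<C>" for D
      using that insert.prems by (auto simp: trees_def components_def)
    have fin: "finite D" if "D \<in> insert C \<C>" for D
      using comp [OF that] finite_component by blast
    have closed: "component G x \<subseteq> D" if "D \<in> insert C \<C>" "x \<in> D" for D x
      using comp [OF that(1)] that(2) component_eq_iff by blast
    have disj: "C \<inter> \<Union> \<C> = {}"
    proof -
      have "C \<inter> D = {}" if "D \<in> \<C>" for D
        using comp [of C] comp [of D] component_disjoint that \<open>C \<notin> \<C>\<close> by (metis insertCI)
      then show ?thesis by blast
    qed
    have "num_edges G (C \<union> \<Union> \<C>) = num_edges G C + num_edges G (\<Union> \<C>)"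
      using closed by (intro num_edges_Un [OF good_edges _ _ disj]) blast+
    moreover have "card (C \<union> \<Union> \<C>) = card C + card (\<Union> \<C>)"
      using fin insert.hyps disj by (intro card_Un_disjoint) auto
    moreover have "num_edges G C + 1 = card C"
      using insert.prems by (auto simp: trees_def is_tree_def)
    ultimately show ?case using insert by simp
  qed
  have "forest_vertices n G = \<Union> (trees n {1..} G)"
  proof (intro equalityI subsetI)
    fix v assume "v \<in> forest_vertices n G"
    then have "component G v \<in> trees n {1..} G"
      using tree_size_pos_iff [of v] by (subst component_in_trees) (auto simp: forest_vertices_def)
    then show "v \<in> \<Union> (trees n {1..} G)" using component_refl by blast
  next
    fix v assume "v \<in> \<Union> (trees n {1..} G)"
    then obtain w where w: "w \<in> {1..n}" "is_tree G (component G w)" "v \<in> component G w"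
      by (auto simp: trees_def components_def)
    then have "component G v = component G w" "v \<in> {1..n}"
      using component_subset [OF good_edges] component_eq_iff by blast+
    then show "v \<in> forest_vertices n G" using w by (simp add: forest_vertices_def in_tree_def)
  qed
  then show ?thesis
    using gen [of "trees n {1..} G"] by (simp add: forest_E_def forest_V_def)
qed

end

lemma forest_V_add_edge_le:
  assumes "good_graph n G" "u \<in> {1..n}" "v \<in> {1..n}"
  shows "forest_V n (add_mset {u, v} G) \<le> forest_V n G"
  unfolding forest_V_def forest_vertices_def
  using in_tree_add_edge [OF assms] by (intro card_mono) auto

lemma component_empty [simp]: "component {#} v = {v}"
  by (simp add: component_def adj_def)

lemma in_tree_empty [simp]: "in_tree {#} v"
  by (simp add: in_tree_def is_tree_def num_edges_def)

lemma good_graph_empty: "good_graph n {#}"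
  by (simp add: good_graph_def)

lemma num_trees_empty: "num_trees n k {#} = (if k = 1 then n else 0)"
proof -
  have "{C \<in> components n {#}. is_tree {#} C \<and> card C = k} = (if k = 1 then (\<lambda>v. {v}) ` {1..n} else {})"
    by (auto simp: components_def is_tree_def num_edges_def)
  moreover have "card ((\<lambda>v. {v}) ` {1..n}) = n" by (simp add: card_image)
  ultimately show ?thesis by (simp add: num_trees_def)
qed

section \<open>Drift of the tree masses\<close>

lemma sum_of_bool_card:
  "finite A \<Longrightarrow> (\<Sum>x\<in>A. of_bool (P x)) = real (card {x \<in> A. P x})"
  by (simp add: Int_def)

lemma finite_possible_edges [simp]: "finite (possible_edges n)"
  by (rule finite_subset [of _ "Pow {1..n}"]) (auto simp: possible_edges_def)

text \<open>Each edge comes from two ordered pairs. Sums over ordered pairs are preferred because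
  they factorise.\<close>

lemma sum_possible_edges:
  fixes \<phi> :: "nat set \<Rightarrow> real"
  shows "2 * (\<Sum>e\<in>possible_edges n. \<phi> e)
    = (\<Sum>u\<in>{1..n}. \<Sum>v\<in>{1..n}. if u = v then 0 else \<phi> {u, v})"
proof -
  define S where "S = {(u, v). u \<in> {1..n} \<and> v \<in> {1..n} \<and> u \<noteq> v}"
  define g where "g = (\<lambda>(u, v). {u, v :: nat})"
  have fin: "finite S"
    by (rule finite_subset [of _ "{1..n} \<times> {1..n}"]) (auto simp: S_def)
  have fibre: "(\<Sum>x\<in>{x \<in> S. g x = e}. \<phi> (g x)) = 2 * \<phi> e" if e_in: "e \<in> possible_edges n" for e
  proof -
    obtain a b where e: "e = {a, b}" "a \<noteq> b" using e_in unfolding possible_edges_def card_2_iff by blast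
    then have "{x \<in> S. g x = e} = {(a, b), (b, a)}"
      using e_in by (auto simp: S_def g_def possible_edges_def doubleton_eq_iff)
    then show ?thesis using e by (simp add: g_def insert_commute)
  qed
  have "(\<Sum>e\<in>possible_edges n. 2 * \<phi> e) = (\<Sum>e\<in>possible_edges n. \<Sum>x\<in>{x \<in> S. g x = e}. \<phi> (g x))"
    by (intro sum.cong refl fibre [symmetric])
  also have "\<dots> = (\<Sum>x\<in>S. \<phi> (g x))"
    by (intro sum.group fin finite_possible_edges) (auto simp: S_def g_def possible_edges_def)
  also have "\<dots> = (\<Sum>x\<in>{1..n} \<times> {1..n}. if fst x = snd x then 0 else \<phi> {fst x, snd x})"
    by (intro sum.mono_neutral_cong_left) (auto simp: S_def g_def)
  also have "\<dots> = (\<Sum>u\<in>{1..n}. \<Sum>v\<in>{1..n}. if u = v then 0 else \<phi> {u, v})"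
    by (simp add: sum.cartesian_product case_prod_unfold)
  finally show ?thesis by (simp add: sum_distrib_left)
qed

lemma card_possible_edges: "2 * real (card (possible_edges n)) = real n * (real n - 1)"
proof -
  have "(\<Sum>v\<in>{1..n}. if u = v then 0 else (1::real)) = real n - 1" if "u \<in> {1..n}" for u
  proof -
    have "(\<Sum>v\<in>{1..n}. if u = v then 0 else (1::real)) = (\<Sum>v\<in>{1..n} - {u}. 1)"
      using that by (intro sum.mono_neutral_cong_right) auto
    then show ?thesis using that by (simp add: of_nat_diff)
  qed
  then have "(\<Sum>u\<in>{1..n}. \<Sum>v\<in>{1..n}. if u = v then 0 else (1::real)) = real n * (real n - 1)"
    by simp
  then show ?thesis using sum_possible_edges [of "\<lambda>_. 1" n] by simp
qed

lemma possible_edges_nonempty: "2 \<le> n \<Longrightarrow> possible_edges n \<noteq> {}"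
  using card_possible_edges [of n] by auto

text \<open>Probability that the selected edge uv is kept. When u is in a tree it reduces to a
  weight of v alone, which makes the loss terms factorise; the last factor excludes pairs of frozen
  vertices, where the product would be p^2.\<close>

definition rate :: "real \<Rightarrow> multigraph \<Rightarrow> nat \<Rightarrow> nat \<Rightarrow> real" where
  "rate p G u v = (if in_tree G u then 1 else p) * (if in_tree G v then 1 else p)
     * of_bool (in_tree G u \<or> in_tree G v)"

context
  fixes p :: real and n :: nat and G :: multigraph
  assumes p: "0 < p" "p \<le> 1" and n: "2 \<le> n" and good: "good_graph n G"
begin

lemma set_pmf_frozen_step:
  assumes "H \<in> set_pmf (frozen_step p n G)"
  shows "H = G \<or> (\<exists>u v. u \<in> {1..n} \<and> v \<in> {1..n} \<and> u \<noteq> v \<and> (in_tree G u \<or> in_tree G v) \<and> H = add_mset {u, v} G)"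
proof -
  obtain e where e: "e \<in> possible_edges n"
     "H \<in> set_pmf (if \<forall>v\<in>e. in_tree G v then return_pmf (add_mset e G)
       else if \<forall>v\<in>e. frozen G v then return_pmf G
       else map_pmf (\<lambda>kept. if kept then add_mset e G else G) (bernoulli_pmf p))"
    using assms possible_edges_nonempty [OF n] by (auto simp: frozen_step_def)
  obtain u v where uv: "e = {u, v}" "u \<noteq> v" "u \<in> {1..n}" "v \<in> {1..n}"
    using e(1) unfolding possible_edges_def card_2_iff by blast
  have "in_tree G u \<or> frozen G u" "in_tree G v \<or> frozen G v"
    using good uv by (auto simp: good_graph_def)
  with e(2) uv(1) have "H = G \<or> (in_tree G u \<or> in_tree G v) \<and> H = add_mset e G"
    by (auto split: if_splits)
  then show ?thesis using uv by blast
qed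

lemma good_graph_frozen_step: "H \<in> set_pmf (frozen_step p n G) \<Longrightarrow> good_graph n H"
  using set_pmf_frozen_step [of H] good_graph_add_edge [OF good] good by auto

lemma finite_set_pmf_frozen_step: "finite (set_pmf (frozen_step p n G))"
proof (rule finite_subset)
  show "set_pmf (frozen_step p n G) \<subseteq> insert G ((\<lambda>e. add_mset e G) ` (possible_edges n))"
  proof
    fix H assume "H \<in> set_pmf (frozen_step p n G)"
    from set_pmf_frozen_step [OF this] show "H \<in> insert G ((\<lambda>e. add_mset e G) ` (possible_edges n))"
      by (auto simp: possible_edges_def image_iff)
  qed
qed auto

lemma expectation_frozen_step:
  fixes h :: "multigraph \<Rightarrow> real"
  shows "measure_pmf.expectation (frozen_step p n G) h - h G
    = (\<Sum>u\<in>{1..n}. \<Sum>v\<in>{1..n}. if u = v then 0 else rate p G u v * (h (add_mset {u, v} G) - h G))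
      / (real n * (real n - 1))"
proof -
  define k where "k e = (if \<forall>v\<in>e. in_tree G v then return_pmf (add_mset e G)
       else if \<forall>v\<in>e. frozen G v then return_pmf G
       else map_pmf (\<lambda>kept. if kept then add_mset e G else G) (bernoulli_pmf p))" for e
  define \<phi> where "\<phi> e = measure_pmf.expectation (k e) h - h G" for e
  have N: "2 * real (card (possible_edges n)) = real n * (real n - 1)" "0 < card (possible_edges n)"
    using card_possible_edges possible_edges_nonempty [OF n] by (auto simp: card_gt_0_iff)
  have "measure_pmf.expectation (frozen_step p n G) h
    = (\<Sum>e\<in>possible_edges n. pmf (pmf_of_set (possible_edges n)) e *\<^sub>R measure_pmf.expectation (k e) h)"
    unfolding frozen_step_def k_def [symmetric]
    by (rule pmf_expectation_bind) (use possible_edges_nonempty [OF n] in \<open>auto simp: k_def\<close>)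
  also have "\<dots> = (\<Sum>e\<in>possible_edges n. (h G + \<phi> e) / real (card (possible_edges n)))"
    using possible_edges_nonempty [OF n] by (intro sum.cong) (auto simp: \<phi>_def)
  also have "\<dots> = h G + (\<Sum>e\<in>possible_edges n. \<phi> e) / real (card (possible_edges n))"
    using N possible_edges_nonempty [OF n] by (simp add: sum.distrib add_divide_distrib flip: sum_divide_distrib)
  finally have "measure_pmf.expectation (frozen_step p n G) h - h G
    = 2 * (\<Sum>e\<in>possible_edges n. \<phi> e) / (2 * real (card (possible_edges n)))" by simp
  also have "\<dots> = (\<Sum>u\<in>{1..n}. \<Sum>v\<in>{1..n}. if u = v then 0 else \<phi> {u, v}) / (real n * (real n - 1))"
    by (simp only: sum_possible_edges N)
  also have "(\<Sum>u\<in>{1..n}. \<Sum>v\<in>{1..n}. if u = v then 0 else \<phi> {u, v})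
    = (\<Sum>u\<in>{1..n}. \<Sum>v\<in>{1..n}. if u = v then 0 else rate p G u v * (h (add_mset {u, v} G) - h G))"
  proof (intro sum.cong refl)
    fix u v assume uv: "u \<in> {1..n}" "v \<in> {1..n}"
    have tf: "in_tree G w \<longleftrightarrow> \<not> frozen G w" if "w \<in> {1..n}" for w
      using good that by (auto simp: good_graph_def in_tree_def frozen_def is_tree_def is_unicycle_def)
    have "\<phi> {u, v} = rate p G u v * (h (add_mset {u, v} G) - h G)"
      using p tf [OF uv(1)] tf [OF uv(2)]
      by (cases "in_tree G u"; cases "in_tree G v")
        (simp_all add: \<phi>_def k_def rate_def algebra_simps)
    then show "(if u = v then 0 else \<phi> {u, v}) = (if u = v then 0 else rate p G u v * (h (add_mset {u, v} G) - h G))"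
      by simp
  qed
  finally show ?thesis .
qed

lemma expectation_card_trees:
  assumes "0 \<notin> S"
  shows "measure_pmf.expectation (frozen_step p n G) (\<lambda>H. real (card (trees n S H))) - real (card (trees n S G))
    = (\<Sum>u\<in>{1..n}. \<Sum>v\<in>{1..n}. if u = v then 0 else rate p G u v * jump G S u v)
      / (real n * (real n - 1))"
proof -
  have "(\<Sum>u\<in>{1..n}. \<Sum>v\<in>{1..n}. if u = v then 0 else rate p G u v *
        (real (card (trees n S (add_mset {u, v} G))) - real (card (trees n S G))))
     = (\<Sum>u\<in>{1..n}. \<Sum>v\<in>{1..n}. if u = v then 0 else rate p G u v * jump G S u v)"
  proof (intro sum.cong refl)
    fix u v assume "u \<in> {1..n}" "v \<in> {1..n}"
    from card_trees_add_edge [OF good this assms]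
    show "(if u = v then 0 else rate p G u v * (real (card (trees n S (add_mset {u, v} G))) - real (card (trees n S G))))
     = (if u = v then 0 else rate p G u v * jump G S u v)" by simp
  qed
  then show ?thesis
    using expectation_frozen_step [of "\<lambda>H. real (card (trees n S H))"] by (simp only:)
qed

lemma rate_bounds: "0 \<le> rate p G u v" "rate p G u v \<le> 1"
  using p by (auto simp: rate_def)

lemma sum_of_bool_tree_size:
  "(\<Sum>u\<in>{1..n}. of_bool (tree_size G u = k \<and> 0 < k)) = real (k * num_trees n k G)"
proof (cases "0 < k")
  case True
  have "(\<Sum>u\<in>{1..n}. of_bool (tree_size G u = k \<and> 0 < k)) = real (card {u \<in> {1..n}. tree_size G u = k})"
    using True by (subst sum_of_bool_card) auto
  then show ?thesis using card_tree_size_eq [OF good True] by simp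
qed simp

lemma sum_weight: "(\<Sum>u\<in>{1..n}. if in_tree G u then 1 else p) = real (forest_V n G) + p * (real n - real (forest_V n G))"
proof -
  have "(\<Sum>u\<in>{1..n}. if in_tree G u then 1 else p) = (\<Sum>u\<in>{1..n}. p + (1 - p) * of_bool (in_tree G u))"
    by (intro sum.cong) auto
  also have "\<dots> = real n * p + (1 - p) * (\<Sum>u\<in>{1..n}. of_bool (in_tree G u))"
    by (simp add: sum.distrib sum_distrib_left del: sum_of_bool_eq)
  also have "(\<Sum>u\<in>{1..n}. of_bool (in_tree G u)) = real (forest_V n G)"
    by (subst sum_of_bool_card) (auto simp: forest_V_def forest_vertices_def)
  finally show ?thesis by (simp add: algebra_simps)
qed

text \<open>The pairs inside a common component, of which there are at most \<open>n * k\<close> in the components of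
  size \<open>k\<close>, are responsible for the error term.\<close>

lemma sum_rate_jump_approx:
  assumes k: "0 < k"
  shows "\<bar>(\<Sum>u\<in>{1..n}. \<Sum>v\<in>{1..n}. if u = v then 0 else rate p G u v * jump G {k} u v)
     - ((\<Sum>i\<le>k. real (i * num_trees n i G) * real ((k - i) * num_trees n (k - i) G))
        - 2 * (real (k * num_trees n k G) * (real (forest_V n G) + p * (real n - real (forest_V n G)))))\<bar>
     \<le> 5 * real k * real n"
proof -
  define s where "s = tree_size G"
  define ind where "ind i u = (of_bool (s u = i \<and> 0 < i) :: real)" for i u
  define w where "w u = (if in_tree G u then 1 else p)" for u
  \<comment> \<open>The decoupled jump, a sum of products of a function of u and a function of v, as
    if u and v were always in different components. Its double sum is exactly gain minus twice the
    loss.\<close>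
  define Q where "Q u v = (\<Sum>i\<le>k. ind i u * ind (k - i) v) - ind k u * w v - w u * ind k v" for u v
  have sum_chi: "(\<Sum>u\<in>{1..n}. ind i u) = real (i * num_trees n i G)" for i
    unfolding ind_def s_def by (rule sum_of_bool_tree_size)
  have sum_w: "(\<Sum>u\<in>{1..n}. w u) = real (forest_V n G) + p * (real n - real (forest_V n G))"
    unfolding w_def by (rule sum_weight)
  have prod: "(\<Sum>u\<in>{1..n}. \<Sum>v\<in>{1..n}. f u * g v) = (\<Sum>u\<in>{1..n}. f u) * (\<Sum>v\<in>{1..n}. g v)"
    for f g :: "nat \<Rightarrow> real" by (simp add: sum_product)
  have "(\<Sum>u\<in>{1..n}. \<Sum>v\<in>{1..n}. \<Sum>i\<le>k. ind i u * ind (k - i) v)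
     = (\<Sum>i\<le>k. \<Sum>u\<in>{1..n}. \<Sum>v\<in>{1..n}. ind i u * ind (k - i) v)"
    by (subst sum.swap [of _ "{1..n}" "{..k}"], subst sum.swap [of _ "{..k}" "{1..n}"])
      (auto intro!: sum.cong sum.swap)
  also have "\<dots> = (\<Sum>i\<le>k. real (i * num_trees n i G) * real ((k - i) * num_trees n (k - i) G))"
    by (simp only: prod sum_chi)
  finally have sum_Q: "(\<Sum>u\<in>{1..n}. \<Sum>v\<in>{1..n}. Q u v)
     = (\<Sum>i\<le>k. real (i * num_trees n i G) * real ((k - i) * num_trees n (k - i) G))
        - 2 * (real (k * num_trees n k G) * (real (forest_V n G) + p * (real n - real (forest_V n G))))"
    unfolding Q_def sum_subtractf by (simp only: prod sum_chi sum_w) simp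
  have Q_eq: "Q u v = of_bool (0 < s u \<and> 0 < s v \<and> s u + s v = k) - ind k u * w v - w u * ind k v" for u v
  proof -
    have "(\<Sum>i\<le>k. ind i u * ind (k - i) v) = (\<Sum>i\<le>k. if s u = i then of_bool (0 < s u \<and> 0 < s v \<and> s u + s v = k) else 0)"
      by (intro sum.cong) (auto simp: ind_def)
    also have "\<dots> = of_bool (0 < s u \<and> 0 < s v \<and> s u + s v = k)"
      by (auto simp: sum.delta)
    finally show ?thesis by (simp add: Q_def)
  qed
  \<comment> \<open>In different components the two expressions coincide. In a common component a
    tree of size k is removed once instead of twice, and one of size k / 2 is not merged with
    itself; the last term covers the diagonal.\<close>
  have diff: "\<bar>(if u = v then 0 else rate p G u v * jump G {k} u v) - Q u v\<bar>
    \<le> of_bool (v \<in> component G u) * (of_bool (2 * s u = k) + of_bool (s u = k)) + 3 * of_bool (u = v)"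
    if uv: "u \<in> {1..n}" "v \<in> {1..n}" for u v
  proof -
    have pos: "in_tree G u \<longleftrightarrow> 0 < s u" "in_tree G v \<longleftrightarrow> 0 < s v"
      using tree_size_pos_iff [OF good] uv by (auto simp: s_def)
    have w: "0 \<le> w u" "w u \<le> 1" "0 \<le> w v" "w v \<le> 1" using p by (auto simp: w_def)
    show ?thesis
    proof (cases "u = v")
      case True
      then show ?thesis using w k by (auto simp: Q_eq ind_def)
    next
      case False
      show ?thesis
      proof (cases "component G u = component G v")
        case True
        have "s u = s v" using True by (simp add: s_def tree_size_def in_tree_def)
        moreover have "v \<in> component G u" using True by (simp add: component_eq_iff)
        ultimately show ?thesis using k pos True False
          by (cases "0 < s v") (auto simp: Q_eq ind_def w_def jump_def [OF good] rate_def simp flip: s_def)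
      next
        case neq: False
        have "rate p G u v * jump G {k} u v = Q u v"
          using k pos neq
          by (cases "0 < s u"; cases "0 < s v")
            (auto simp: Q_eq ind_def w_def jump_def [OF good] rate_def simp flip: s_def)
        then show ?thesis using False by simp
      qed
    qed
  qed
  have inner: "(\<Sum>v\<in>{1..n}. of_bool (v \<in> component G u) * (of_bool (2 * s u = k) + of_bool (s u = k)) + 3 * of_bool (u = v))
     \<le> 2 * real k + 3" if u: "u \<in> {1..n}" for u
  proof -
    have "{1..n} \<inter> component G u = component G u"
      using component_subset [OF good_edges [OF good] u] by blast
    then have "(\<Sum>v\<in>{1..n}. of_bool (v \<in> component G u)) = real (card (component G u))"
      by (subst sum_of_bool_card) (auto simp: Int_def)
    moreover have "(\<Sum>v\<in>{1..n}. of_bool (u = v)) = (1::real)"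
      using u by (simp add: of_bool_def)
    moreover have "real (card (component G u)) * (of_bool (2 * s u = k) + of_bool (s u = k)) \<le> 2 * real k"
      using k by (auto simp: s_def tree_size_def of_bool_def split: if_splits)
    ultimately show ?thesis
      unfolding sum.distrib sum_distrib_left [symmetric] sum_distrib_right [symmetric] by simp
  qed
  have "\<bar>(\<Sum>u\<in>{1..n}. \<Sum>v\<in>{1..n}. if u = v then 0 else rate p G u v * jump G {k} u v)
      - (\<Sum>u\<in>{1..n}. \<Sum>v\<in>{1..n}. Q u v)\<bar>
    = \<bar>\<Sum>u\<in>{1..n}. \<Sum>v\<in>{1..n}. (if u = v then 0 else rate p G u v * jump G {k} u v) - Q u v\<bar>"
    by (simp add: sum_subtractf)
  also have "\<dots> \<le> (\<Sum>u\<in>{1..n}. \<Sum>v\<in>{1..n}. \<bar>(if u = v then 0 else rate p G u v * jump G {k} u v) - Q u v\<bar>)"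
    by (intro order_trans [OF sum_abs] sum_mono sum_abs)
  also have "\<dots> \<le> (\<Sum>u\<in>{1..n}. 2 * real k + 3)"
  proof (intro sum_mono)
    fix u assume u: "u \<in> {1..n}"
    have "(\<Sum>v\<in>{1..n}. \<bar>(if u = v then 0 else rate p G u v * jump G {k} u v) - Q u v\<bar>)
      \<le> (\<Sum>v\<in>{1..n}. of_bool (v \<in> component G u) * (of_bool (2 * s u = k) + of_bool (s u = k)) + 3 * of_bool (u = v))"
      by (intro sum_mono diff u)
    also have "\<dots> \<le> 2 * real k + 3" by (rule inner [OF u])
    finally show "(\<Sum>v\<in>{1..n}. \<bar>(if u = v then 0 else rate p G u v * jump G {k} u v) - Q u v\<bar>) \<le> 2 * real k + 3" .
  qed
  also have "\<dots> \<le> 5 * real k * real n"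
  proof -
    have "2 * real k + 3 \<le> 5 * real k" using k by simp
    then have "real n * (2 * real k + 3) \<le> real n * (5 * real k)" by (intro mult_left_mono) auto
    then show ?thesis by (simp add: algebra_simps)
  qed
  finally show ?thesis unfolding sum_Q .
qed

text \<open>Every kept edge lowers the number of trees by exactly one, whether it merges two trees,
  closes a cycle or attaches a tree to a unicycle. So the sum just counts weighted pairs, and the
  leading V corrects for the diagonal.\<close>

lemma sum_rate_jump_all:
  "(\<Sum>u\<in>{1..n}. \<Sum>v\<in>{1..n}. if u = v then 0 else rate p G u v * jump G {1..} u v)
   = real (forest_V n G) - ((real (forest_V n G))\<^sup>2 + 2 * p * real (forest_V n G) * (real n - real (forest_V n G)))"
proof -
  define w where "w u = (if in_tree G u then 1 else p)" for u
  define ind where "ind u = (of_bool (in_tree G u) :: real)" for u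
  define V where "V = real (forest_V n G)"
  have sum_w: "(\<Sum>u\<in>{1..n}. w u) = V + p * (real n - V)"
    unfolding w_def V_def by (rule sum_weight)
  have sum_chi: "(\<Sum>u\<in>{1..n}. ind u) = V"
    unfolding ind_def by (subst sum_of_bool_card) (auto simp: V_def forest_V_def forest_vertices_def)
  have prod: "(\<Sum>u\<in>{1..n}. \<Sum>v\<in>{1..n}. f u * g v) = (\<Sum>u\<in>{1..n}. f u) * (\<Sum>v\<in>{1..n}. g v)"
    for f g :: "nat \<Rightarrow> real" by (simp add: sum_product)
  have eq: "(if u = v then 0 else rate p G u v * jump G {1..} u v)
     = of_bool (u = v) * ind u - (ind u * w v + w u * ind v - ind u * ind v)"
    if uv: "u \<in> {1..n}" "v \<in> {1..n}" for u v
  proof -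
    have pos: "in_tree G u \<longleftrightarrow> 0 < tree_size G u" "in_tree G v \<longleftrightarrow> 0 < tree_size G v"
      using tree_size_pos_iff [OF good] uv by auto
    have same: "in_tree G u \<longleftrightarrow> in_tree G v" if "component G u = component G v"
      using that by (simp add: in_tree_def)
    show ?thesis using pos same
      by (cases "in_tree G u"; cases "in_tree G v")
        (auto simp: ind_def w_def jump_def [OF good] rate_def Suc_le_eq)
  qed
  have "(\<Sum>u\<in>{1..n}. \<Sum>v\<in>{1..n}. if u = v then 0 else rate p G u v * jump G {1..} u v)
    = (\<Sum>u\<in>{1..n}. \<Sum>v\<in>{1..n}. of_bool (u = v) * ind u - (ind u * w v + w u * ind v - ind u * ind v))"
    by (intro sum.cong refl eq)
  also have "\<dots> = (\<Sum>u\<in>{1..n}. \<Sum>v\<in>{1..n}. of_bool (u = v) * ind u)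
     - (V * (V + p * (real n - V)) + (V + p * (real n - V)) * V - V * V)"
    unfolding sum_subtractf sum.distrib by (simp only: prod sum_chi sum_w)
  also have "(\<Sum>u\<in>{1..n}. \<Sum>v\<in>{1..n}. of_bool (u = v) * ind u) = (\<Sum>u\<in>{1..n}. ind u)"
    by (intro sum.cong refl) (simp add: of_bool_def if_distrib [where f = "\<lambda>x. x * _"] sum.delta cong: if_cong)
  finally show ?thesis
    unfolding sum_chi by (simp add: V_def power2_eq_square algebra_simps)
qed

end

lemma forest_V_le: "forest_V n G \<le> n"
proof -
  have "forest_V n G \<le> card {1..n}"
    unfolding forest_V_def forest_vertices_def by (intro card_mono) auto
  then show ?thesis by simp
qed

definition tree_mass :: "nat \<Rightarrow> nat \<Rightarrow> multigraph \<Rightarrow> real" where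
  "tree_mass n k G = real (k * num_trees n k G) / real n"

context
  fixes p :: real and n :: nat and G :: multigraph
  assumes p: "0 < p" "p \<le> 1" and n: "2 \<le> n" and good: "good_graph n G"
begin

lemma tree_mass_sum: "(\<Sum>k\<le>n. tree_mass n k G) = real (forest_V n G) / real n"
proof -
  have "(\<Sum>k\<le>n. tree_mass n k G) = (\<Sum>k\<in>{1..n}. tree_mass n k G)"
    by (rule sum.mono_neutral_right) (auto simp: tree_mass_def)
  then show ?thesis
    using forest_V_eq_sum [OF good] by (simp add: tree_mass_def sum_divide_distrib)
qed

lemma tree_count_sum: "(\<Sum>k\<le>n. tree_mass n k G / real k) = real (card (trees n {1..} G)) / real n"
proof -
  have "(\<Sum>k\<le>n. tree_mass n k G / real k) = (\<Sum>k\<in>{1..n}. tree_mass n k G / real k)"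
    by (rule sum.mono_neutral_right) (auto simp: tree_mass_def)
  also have "\<dots> = (\<Sum>k\<in>{1..n}. real (num_trees n k G) / real n)"
    by (intro sum.cong) (auto simp: tree_mass_def)
  finally show ?thesis
    using card_trees_eq_sum [OF good] by (simp add: sum_divide_distrib)
qed

lemma tree_mass_drift:
  "\<bar>measure_pmf.expectation (frozen_step p n G) (tree_mass n k) - tree_mass n k G
     - real k / real n * ((\<Sum>i\<le>k. tree_mass n i G * tree_mass n (k - i) G)
        - 2 * tree_mass n k G * (real (forest_V n G) / real n + p * (1 - real (forest_V n G) / real n)))\<bar>
   \<le> 8 * (real k)\<^sup>2 / (real n)\<^sup>2"
proof (cases "k = 0")
  case True
  then show ?thesis by (simp add: tree_mass_def [abs_def])
next
  case False
  define N where "N = real n"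
  define X where "X = (\<Sum>u\<in>{1..n}. \<Sum>v\<in>{1..n}. if u = v then 0 else rate p G u v * jump G {k} u v)"
  define B where "B = (\<Sum>i\<le>k. tree_mass n i G * tree_mass n (k - i) G)
        - 2 * tree_mass n k G * (real (forest_V n G) / N + p * (1 - real (forest_V n G) / N))"
  have N: "2 \<le> N" using n by (simp add: N_def)
  have 1: "measure_pmf.expectation (frozen_step p n G) (\<lambda>H. real (num_trees n k H)) - real (num_trees n k G)
    = X / (N * (N - 1))"
    using expectation_card_trees [OF p n good, of "{k}"] False by (simp add: num_trees_eq X_def N_def)
  have "measure_pmf.expectation (frozen_step p n G) (tree_mass n k)
    = real k / N * measure_pmf.expectation (frozen_step p n G) (\<lambda>H. real (num_trees n k H))"
    by (simp add: tree_mass_def [abs_def] N_def)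
  then have E: "measure_pmf.expectation (frozen_step p n G) (tree_mass n k) - tree_mass n k G
    = real k / N * (X / (N * (N - 1)))"
    unfolding 1 [symmetric] by (simp add: tree_mass_def N_def right_diff_distrib)
  have "N\<^sup>2 * B = (\<Sum>i\<le>k. real (i * num_trees n i G) * real ((k - i) * num_trees n (k - i) G))
        - 2 * (real (k * num_trees n k G) * (real (forest_V n G) + p * (N - real (forest_V n G))))"
  proof -
    have "N\<^sup>2 * (\<Sum>i\<le>k. tree_mass n i G * tree_mass n (k - i) G)
      = (\<Sum>i\<le>k. real (i * num_trees n i G) * real ((k - i) * num_trees n (k - i) G))"
      unfolding sum_distrib_left using N by (intro sum.cong) (auto simp: tree_mass_def N_def power2_eq_square)
    moreover have "N\<^sup>2 * (2 * tree_mass n k G * (real (forest_V n G) / N + p * (1 - real (forest_V n G) / N)))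
      = 2 * ((N * tree_mass n k G) * (N * (real (forest_V n G) / N) + p * (N - N * (real (forest_V n G) / N))))"
      by (simp add: power2_eq_square algebra_simps)
    moreover have "N * tree_mass n k G = real (k * num_trees n k G)" "N * (real (forest_V n G) / N) = real (forest_V n G)"
      using N by (simp_all add: tree_mass_def N_def)
    ultimately show ?thesis by (simp only: B_def right_diff_distrib [of "N\<^sup>2"])
  qed
  with sum_rate_jump_approx [OF p n good, of k] False
  have XB: "\<bar>X - N\<^sup>2 * B\<bar> \<le> 5 * real k * N" by (simp add: X_def N_def)
  \<comment> \<open>A crude bound from at most two trees lost per edge; it pays for replacing
    \<open>N * (N - 1)\<close> by \<open>N * N\<close> in the denominator.\<close>
  have X3: "\<bar>X\<bar> \<le> 2 * (N * (N - 1))"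
  proof -
    have "\<bar>X\<bar> \<le> (\<Sum>u\<in>{1..n}. \<Sum>v\<in>{1..n}. \<bar>if u = v then 0 else rate p G u v * jump G {k} u v\<bar>)"
      unfolding X_def by (intro order_trans [OF sum_abs] sum_mono sum_abs)
    also have "\<dots> \<le> (\<Sum>u\<in>{1..n}. \<Sum>v\<in>{1..n}. if u = v then 0 else 2)"
    proof (intro sum_mono)
      fix u v
      have "\<bar>jump G {k} u v\<bar> \<le> 2"
        by (simp add: jump_def [OF good])
      then have "rate p G u v * \<bar>jump G {k} u v\<bar> \<le> 1 * 2"
        using rate_bounds [OF p n good, of u v] by (intro mult_mono) auto
      then show "\<bar>if u = v then 0 else rate p G u v * jump G {k} u v\<bar> \<le> (if u = v then 0 else 2)"
        using rate_bounds [OF p n good, of u v] by (simp add: abs_mult)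
    qed
    also have "\<dots> = 2 * (N * (N - 1))"
      using sum_possible_edges [of "\<lambda>_. 2" n] card_possible_edges [of n] by (simp add: N_def)
    finally show ?thesis .
  qed
  have "\<bar>X / (N * (N - 1)) - B\<bar> \<le> \<bar>X / (N * (N - 1)) - X / N\<^sup>2\<bar> + \<bar>X / N\<^sup>2 - B\<bar>" by simp
  also have "X / (N * (N - 1)) - X / N\<^sup>2 = X / (N * (N - 1)) / N"
    using N by (simp add: field_simps power2_eq_square)
  also have "\<bar>X / (N * (N - 1)) / N\<bar> \<le> 2 / N"
    using X3 N by (simp add: abs_mult divide_le_eq mult_ac)
  also have "X / N\<^sup>2 - B = (X - N\<^sup>2 * B) / N\<^sup>2" using N by (simp add: field_simps)
  also have "\<bar>(X - N\<^sup>2 * B) / N\<^sup>2\<bar> \<le> 5 * real k * N / N\<^sup>2"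
    using XB by (simp add: divide_right_mono)
  also have "2 / N + 5 * real k * N / N\<^sup>2 \<le> 8 * real k / N"
    using N False by (simp add: power2_eq_square field_simps)
  finally have "\<bar>X / (N * (N - 1)) - B\<bar> \<le> 8 * real k / N" by simp
  then have "real k / N * \<bar>X / (N * (N - 1)) - B\<bar> \<le> real k / N * (8 * real k / N)"
    using N by (intro mult_left_mono) auto
  then have "\<bar>real k / N * (X / (N * (N - 1)) - B)\<bar> \<le> 8 * (real k)\<^sup>2 / N\<^sup>2"
    using N by (simp add: abs_mult power2_eq_square mult_ac)
  moreover have "measure_pmf.expectation (frozen_step p n G) (tree_mass n k) - tree_mass n k G - real k / N * B
      = real k / N * (X / (N * (N - 1)) - B)"
    unfolding E by (rule right_diff_distrib [symmetric])
  ultimately show ?thesis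
    by (simp only: B_def N_def)
qed

text \<open>Only an upper bound is stated, as the number of large trees will be bounded below by 0.
  Since the drift is nonpositive, passing from n (n - 1) to n^2 goes in the right direction; the
  diagonal contributes 1 / n^2.\<close>

lemma tree_count_drift:
  defines "v \<equiv> real (forest_V n G) / real n"
  shows "measure_pmf.expectation (frozen_step p n G) (\<lambda>H. real (card (trees n {1..} H)) / real n)
   \<le> real (card (trees n {1..} G)) / real n - (v\<^sup>2 + 2 * p * v * (1 - v)) / real n + 1 / (real n)\<^sup>2"
proof -
  define N where "N = real n"
  define X where "X = (\<Sum>u\<in>{1..n}. \<Sum>v\<in>{1..n}. if u = v then 0 else rate p G u v * jump G {1..} u v)"
  define V where "V = real (forest_V n G)"
  have N: "2 \<le> N" using n by (simp add: N_def)
  have V: "0 \<le> V" "V \<le> N" using forest_V_le by (auto simp: V_def N_def)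
  have X: "X = V - (V\<^sup>2 + 2 * p * V * (N - V))"
    unfolding X_def V_def N_def by (rule sum_rate_jump_all [OF p n good])
  \<comment> \<open>V is a natural number, hence V \<le> V^2.\<close>
  have "X \<le> 0"
  proof -
    have "V \<le> V\<^sup>2"
    proof (cases "forest_V n G = 0")
      case False
      then have "1 \<le> V" by (simp add: V_def)
      then show ?thesis using self_le_power [of V 2] by simp
    qed (simp add: V_def)
    moreover have "0 \<le> 2 * p * V * (N - V)" using V p by simp
    ultimately show ?thesis unfolding X by linarith
  qed
  have "X / (N * (N - 1)) \<le> X / N\<^sup>2"
    using \<open>X \<le> 0\<close> N by (intro divide_left_mono_neg) (auto simp: power2_eq_square algebra_simps)
  also have "\<dots> = V / N\<^sup>2 - (v\<^sup>2 + 2 * p * v * (1 - v))"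
    using N by (simp add: X v_def power2_eq_square field_simps flip: N_def V_def)
  also have "V / N\<^sup>2 \<le> 1 / N" using V N by (simp add: power2_eq_square field_simps)
  finally have "X / (N * (N - 1)) / N \<le> (1 / N - (v\<^sup>2 + 2 * p * v * (1 - v))) / N"
    using N by (intro divide_right_mono) auto
  moreover have "measure_pmf.expectation (frozen_step p n G) (\<lambda>H. real (card (trees n {1..} H)) / real n)
    = (real (card (trees n {1..} G)) + X / (N * (N - 1))) / N"
    using expectation_card_trees [OF p n good, of "{1..}"] by (simp add: X_def N_def)
  ultimately show ?thesis by (simp add: N_def add_divide_distrib diff_divide_distrib power2_eq_square)
qed

lemma tree_mass_step:
  assumes "H \<in> set_pmf (frozen_step p n G)"
  shows "\<bar>tree_mass n k H - tree_mass n k G\<bar> \<le> 2 * real k / real n"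
    and "forest_V n H \<le> forest_V n G"
proof -
  consider "H = G" | u v where "u \<in> {1..n}" "v \<in> {1..n}" "u \<noteq> v" "H = add_mset {u, v} G"
    using set_pmf_frozen_step [OF p n good assms] by blast
  then have "\<bar>tree_mass n k H - tree_mass n k G\<bar> \<le> 2 * real k / real n \<and> forest_V n H \<le> forest_V n G"
  proof cases
    case 2
    have "\<bar>real (num_trees n k H) - real (num_trees n k G)\<bar> \<le> 2" if "0 < k"
    proof -
      have "real (num_trees n k H) - real (num_trees n k G) = jump G {k} u v"
        using card_trees_add_edge [OF good 2(1,2), of "{k}"] that by (simp add: num_trees_eq 2)
      then show ?thesis by (simp add: jump_def [OF good])
    qed
    then have "real k * \<bar>real (num_trees n k H) - real (num_trees n k G)\<bar> \<le> real k * 2"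
      by (cases "k = 0") auto
    moreover have "\<bar>tree_mass n k H - tree_mass n k G\<bar> = real k * \<bar>real (num_trees n k H) - real (num_trees n k G)\<bar> / real n"
      by (simp add: tree_mass_def abs_mult flip: diff_divide_distrib right_diff_distrib)
    ultimately show ?thesis
      using forest_V_add_edge_le [OF good 2(1,2)] 2 n by (simp add: divide_right_mono)
  qed simp
  then show "\<bar>tree_mass n k H - tree_mass n k G\<bar> \<le> 2 * real k / real n"
    and "forest_V n H \<le> forest_V n G" by auto
qed

end

section \<open>Paths of finite Markov chains\<close>

text \<open>Law of the first \<open>m\<close> steps on total functions. Coordinates beyond
  \<open>m\<close> are set to \<open>x0\<close>, so a path in the support is determined by its first
  coordinates and the support is finite for the chains considered.\<close>

primrec path_pmf :: "('s \<Rightarrow> 's pmf) \<Rightarrow> 's \<Rightarrow> nat \<Rightarrow> (nat \<Rightarrow> 's) pmf" where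
  "path_pmf K x0 0 = return_pmf (\<lambda>_. x0)"
| "path_pmf K x0 (Suc m) = bind_pmf (path_pmf K x0 m) (\<lambda>x. map_pmf (\<lambda>y. x(Suc m := y)) (K (x m)))"

definition adapted :: "nat \<Rightarrow> ((nat \<Rightarrow> 's) \<Rightarrow> 'b) \<Rightarrow> bool" where
  "adapted m f \<longleftrightarrow> (\<forall>x y. (\<forall>i\<le>m. x i = y i) \<longrightarrow> f x = f y)"

lemma adaptedD: "adapted m f \<Longrightarrow> (\<And>i. i \<le> m \<Longrightarrow> x i = y i) \<Longrightarrow> f x = f y"
  by (simp add: adapted_def)

lemma adapted_mono: "adapted m f \<Longrightarrow> m \<le> k \<Longrightarrow> adapted k f"
  unfolding adapted_def by (meson order_trans)

lemma expectation_finite: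
  fixes f :: "'a \<Rightarrow> real"
  assumes "finite (set_pmf M)"
  shows "measure_pmf.expectation M f = (\<Sum>x\<in>set_pmf M. pmf M x * f x)"
  using integral_measure_pmf [of "set_pmf M" M f] assms by simp

lemma pmf_path_pmf_extends:
  "x \<in> set_pmf (path_pmf K x0 m) \<Longrightarrow> m < i \<Longrightarrow> x i = x0"
  by (induction m arbitrary: x i) auto

locale finite_chain =
  fixes K :: "'s \<Rightarrow> 's pmf" and x0 :: 's and S :: "'s set"
  assumes start: "x0 \<in> S"
    and closed: "x \<in> S \<Longrightarrow> y \<in> set_pmf (K x) \<Longrightarrow> y \<in> S"
    and finite_step: "x \<in> S \<Longrightarrow> finite (set_pmf (K x))"
begin

abbreviation P :: "nat \<Rightarrow> (nat \<Rightarrow> 's) pmf" where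
  "P \<equiv> path_pmf K x0"

abbreviation E :: "nat \<Rightarrow> ((nat \<Rightarrow> 's) \<Rightarrow> real) \<Rightarrow> real" where
  "E N f \<equiv> measure_pmf.expectation (P N) f"

lemma path_support:
  assumes "x \<in> set_pmf (P N)"
  shows "x 0 = x0" "x i \<in> S" "m < N \<Longrightarrow> x (Suc m) \<in> set_pmf (K (x m))"
proof -
  have "x 0 = x0 \<and> (\<forall>i. x i \<in> S) \<and> (\<forall>m<N. x (Suc m) \<in> set_pmf (K (x m)))"
    using assms
  proof (induction N arbitrary: x)
    case 0
    then show ?case using start by simp
  next
    case (Suc N)
    then obtain z y where z: "z \<in> set_pmf (P N)" "y \<in> set_pmf (K (z N))" "x = z(Suc N := y)"
      by auto
    with Suc.IH [OF z(1)] show ?case by (auto simp: less_Suc_eq intro: closed)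
  qed
  then show "x 0 = x0" "x i \<in> S" "m < N \<Longrightarrow> x (Suc m) \<in> set_pmf (K (x m))" by auto
qed

lemma finite_paths [simp]: "finite (set_pmf (P N))"
proof (induction N)
  case (Suc N)
  have "finite (set_pmf (K (x N)))" if "x \<in> set_pmf (P N)" for x
    using path_support(2) [OF that] finite_step by blast
  then show ?case using Suc by simp
qed simp

lemma integrable_path [simp]: "integrable (measure_pmf (P N)) (f :: _ \<Rightarrow> real)"
  by (rule integrable_measure_pmf_finite) simp

lemma E_Suc: "E (Suc N) f = E N (\<lambda>x. measure_pmf.expectation (K (x N)) (\<lambda>y. f (x(Suc N := y))))"
proof -
  have "finite (set_pmf (map_pmf (\<lambda>y. x(Suc N := y)) (K (x N))))" if "x \<in> set_pmf (P N)" for x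
    using path_support(2) [OF that, of N] finite_step by simp
  then have "E (Suc N) f = (\<Sum>x\<in>set_pmf (P N). pmf (P N) x *\<^sub>R
      measure_pmf.expectation (map_pmf (\<lambda>y. x(Suc N := y)) (K (x N))) f)"
    unfolding path_pmf.simps by (intro pmf_expectation_bind) auto
  then show ?thesis by (simp add: expectation_finite)
qed

lemma E_adapted:
  assumes "adapted m f" "m \<le> N"
  shows "E N f = E m f"
  using assms(2)
proof (induction N rule: dec_induct)
  case (step N)
  have "f (x(Suc N := y)) = f x" for x y
    by (rule adaptedD [OF assms(1)]) (use step in auto)
  then show ?case using step by (simp add: E_Suc del: path_pmf.simps)
qed simp

text \<open>Tower property: conditionally on the coordinates up to \<open>m\<close>, the next one is
  drawn from \<open>K (x m)\<close>.\<close>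

lemma E_step:
  assumes "adapted (Suc m) f" "Suc m \<le> N"
  shows "E N f = E N (\<lambda>x. measure_pmf.expectation (K (x m)) (\<lambda>y. f (x(Suc m := y))))"
proof -
  have "adapted m (\<lambda>x. measure_pmf.expectation (K (x m)) (\<lambda>y. f (x(Suc m := y))))"
    unfolding adapted_def
  proof (intro allI impI)
    fix x z :: "nat \<Rightarrow> 's" assume eq: "\<forall>i\<le>m. x i = z i"
    then have "f (x(Suc m := y)) = f (z(Suc m := y))" for y
      by (intro adaptedD [OF assms(1)]) (auto simp: le_Suc_eq)
    then show "measure_pmf.expectation (K (x m)) (\<lambda>y. f (x(Suc m := y)))
        = measure_pmf.expectation (K (z m)) (\<lambda>y. f (z(Suc m := y)))"
      using eq by simp
  qed
  then have "E N (\<lambda>x. measure_pmf.expectation (K (x m)) (\<lambda>y. f (x(Suc m := y))))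
     = E m (\<lambda>x. measure_pmf.expectation (K (x m)) (\<lambda>y. f (x(Suc m := y))))"
    using assms(2) by (intro E_adapted) auto
  then show ?thesis
    using E_adapted [OF assms] E_Suc by simp
qed

lemma E_mono: "(\<And>x. x \<in> set_pmf (P N) \<Longrightarrow> f x \<le> g x) \<Longrightarrow> E N f \<le> E N g"
  by (intro integral_mono_AE) (auto simp: AE_measure_pmf_iff)

lemma E_cong: "(\<And>x. x \<in> set_pmf (P N) \<Longrightarrow> f x = g x) \<Longrightarrow> E N f = E N g"
  by (intro integral_cong_AE) (auto simp: AE_measure_pmf_iff)

lemma E_add: "E N (\<lambda>x. f x + g x) = E N f + E N g"
  by (rule Bochner_Integration.integral_add) simp_all

lemma E_diff: "E N (\<lambda>x. f x - g x) = E N f - E N g"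
  by (rule Bochner_Integration.integral_diff) simp_all

lemma E_sum: "E N (\<lambda>x. \<Sum>i\<in>I. f i x) = (\<Sum>i\<in>I. E N (f i))"
  by (rule Bochner_Integration.integral_sum) simp

lemma E_nonneg: "(\<And>x. x \<in> set_pmf (P N) \<Longrightarrow> 0 \<le> f x) \<Longrightarrow> 0 \<le> E N f"
  using E_mono [of N "\<lambda>_. 0" f] by simp

text \<open>Expanding the square, the cross term has conditional mean at most |Z| times the drift b,
  and |Z| \<le> N a because the increments are bounded. The remaining a^2 per step is the
  orthogonality of martingale increments.\<close>

lemma approx_martingale_L2:
  assumes adapted: "\<And>m. adapted m (Z m)"
    and zero: "\<And>x. x \<in> set_pmf (P N) \<Longrightarrow> Z 0 x = 0"
    and a: "0 \<le> a" "\<And>x m. x \<in> set_pmf (P N) \<Longrightarrow> m < N \<Longrightarrow> \<bar>Z (Suc m) x - Z m x\<bar> \<le> a"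
    and b: "0 \<le> b" "\<And>x m. x \<in> set_pmf (P N) \<Longrightarrow> m < N \<Longrightarrow>
        \<bar>measure_pmf.expectation (K (x m)) (\<lambda>y. Z (Suc m) (x(Suc m := y))) - Z m x\<bar> \<le> b"
    and m: "m \<le> N"
  shows "E N (\<lambda>x. (Z m x)\<^sup>2) \<le> real m * (a\<^sup>2 + 2 * real N * a * b)"
  using m
proof (induction m)
  case 0
  have "E N (\<lambda>x. (Z 0 x)\<^sup>2) = E N (\<lambda>_. 0)" by (rule E_cong) (simp add: zero)
  then show ?case by simp
next
  case (Suc m)
  then have mN: "m < N" by simp
  have Z_le: "\<bar>Z j x\<bar> \<le> real j * a" if "x \<in> set_pmf (P N)" "j \<le> N" for x j
    using that(2)
  proof (induction j)
    case 0
    then show ?case using zero that by simp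
  next
    case (Suc j)
    then have "\<bar>Z (Suc j) x\<bar> \<le> \<bar>Z (Suc j) x - Z j x\<bar> + \<bar>Z j x\<bar>" by simp
    also have "\<dots> \<le> a + real j * a" using Suc a(2) [OF that(1), of j] by (intro add_mono) auto
    finally show ?case by (simp add: algebra_simps)
  qed
  define f where "f x = Z m x * (Z (Suc m) x - Z m x)" for x
  have "adapted (Suc m) f"
    unfolding adapted_def
  proof (intro allI impI)
    fix x y :: "nat \<Rightarrow> 's" assume "\<forall>i\<le>Suc m. x i = y i"
    then have "Z (Suc m) x = Z (Suc m) y" "Z m x = Z m y"
      by (auto intro: adaptedD [OF adapted])
    then show "f x = f y" by (simp add: f_def)
  qed
  from E_step [OF this] mN
  have "E N f = E N (\<lambda>x. measure_pmf.expectation (K (x m)) (\<lambda>y. f (x(Suc m := y))))" by simp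
  also have "\<dots> \<le> E N (\<lambda>_. real N * a * b)"
  proof (rule E_mono)
    fix x assume x: "x \<in> set_pmf (P N)"
    have Zm: "Z m (x(Suc m := y)) = Z m x" for y
      by (rule adaptedD [OF adapted]) auto
    have int: "integrable (measure_pmf (K (x m))) (g :: 's \<Rightarrow> real)" for g
      using finite_step path_support(2) [OF x] by (intro integrable_measure_pmf_finite) auto
    have "measure_pmf.expectation (K (x m)) (\<lambda>y. f (x(Suc m := y)))
       = Z m x * (measure_pmf.expectation (K (x m)) (\<lambda>y. Z (Suc m) (x(Suc m := y))) - Z m x)"
      by (simp add: f_def Zm Bochner_Integration.integral_diff int)
    also have "\<dots> \<le> \<bar>Z m x\<bar> * \<bar>measure_pmf.expectation (K (x m)) (\<lambda>y. Z (Suc m) (x(Suc m := y))) - Z m x\<bar>"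
      by (metis abs_ge_self abs_mult)
    also have "\<dots> \<le> (real N * a) * b"
    proof (intro mult_mono b(2) x mN)
      have "real m * a \<le> real N * a" using mN a by (intro mult_right_mono) auto
      then show "\<bar>Z m x\<bar> \<le> real N * a" using Z_le [OF x, of m] mN by linarith
    qed (use a in auto)
    finally show "measure_pmf.expectation (K (x m)) (\<lambda>y. f (x(Suc m := y))) \<le> real N * a * b" by simp
  qed
  finally have Ef: "E N f \<le> real N * a * b" by simp
  have "E N (\<lambda>x. (Z (Suc m) x)\<^sup>2) \<le> E N (\<lambda>x. (Z m x)\<^sup>2 + 2 * f x + a\<^sup>2)"
  proof (rule E_mono)
    fix x assume x: "x \<in> set_pmf (P N)"
    have "(Z (Suc m) x)\<^sup>2 = (Z m x)\<^sup>2 + 2 * f x + (Z (Suc m) x - Z m x)\<^sup>2"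
      by (simp add: f_def power2_eq_square algebra_simps)
    moreover have "(Z (Suc m) x - Z m x)\<^sup>2 \<le> a\<^sup>2"
      using a(2) [OF x mN] by (simp add: abs_le_square_iff [symmetric] a)
    ultimately show "(Z (Suc m) x)\<^sup>2 \<le> (Z m x)\<^sup>2 + 2 * f x + a\<^sup>2" by simp
  qed
  also have "\<dots> = E N (\<lambda>x. (Z m x)\<^sup>2) + 2 * E N f + a\<^sup>2"
    by (simp add: E_add)
  also have "\<dots> \<le> real m * (a\<^sup>2 + 2 * real N * a * b) + 2 * (real N * a * b) + a\<^sup>2"
    using Suc Ef by (intro add_mono) auto
  finally show ?case by (simp add: algebra_simps)
qed

text \<open>The same recursion as the one that characterises \<open>frozen_process\<close>, so the
  two laws of a finite path agree by induction.\<close>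

lemma pmf_path_Suc:
  "pmf (P (Suc m)) (\<lambda>i. if i \<le> Suc m then x i else x0)
   = pmf (P m) (\<lambda>i. if i \<le> m then x i else x0) * pmf (K (x m)) (x (Suc m))"
proof -
  define z where "z = (\<lambda>i. if i \<le> Suc m then x i else x0)"
  define t where "t = (\<lambda>i. if i \<le> m then x i else x0)"
  have step: "pmf (map_pmf (\<lambda>y. a(Suc m := y)) (K (a m))) z = (if a = t then pmf (K (x m)) (x (Suc m)) else 0)"
    if "a \<in> set_pmf (P m)" for a
  proof (cases "a = t")
    case True
    have inj: "inj (\<lambda>y. a(Suc m := y))" by (auto intro!: injI dest: fun_cong [of _ _ "Suc m"])
    have "z = a(Suc m := x (Suc m))" by (auto simp: z_def True t_def fun_eq_iff)
    then have "pmf (map_pmf (\<lambda>y. a(Suc m := y)) (K (a m))) z = pmf (K (a m)) (x (Suc m))"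
      using pmf_map_inj' [OF inj, of "K (a m)" "x (Suc m)"] by simp
    then show ?thesis using True by (simp add: t_def)
  next
    case False
    have "z \<notin> set_pmf (map_pmf (\<lambda>y. a(Suc m := y)) (K (a m)))"
    proof
      assume "z \<in> set_pmf (map_pmf (\<lambda>y. a(Suc m := y)) (K (a m)))"
      then obtain y where y: "z = a(Suc m := y)" by auto
      have "a i = t i" for i
      proof (cases "i \<le> m")
        case True
        then show ?thesis using fun_cong [OF y, of i] by (simp add: z_def t_def)
      next
        case False
        then show ?thesis using pmf_path_pmf_extends [OF that] by (simp add: t_def)
      qed
      then show False using False by auto
    qed
    then show ?thesis using False by (simp add: pmf_eq_0_set_pmf)
  qed
  have "pmf (P (Suc m)) z = E m (\<lambda>a. pmf (map_pmf (\<lambda>y. a(Suc m := y)) (K (a m))) z)"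
    by (simp add: pmf_bind)
  also have "\<dots> = E m (\<lambda>a. if a = t then pmf (K (x m)) (x (Suc m)) else 0)"
    by (rule E_cong) (rule step)
  also have "\<dots> = (\<Sum>a\<in>set_pmf (P m). if a = t then pmf (P m) t * pmf (K (x m)) (x (Suc m)) else 0)"
    unfolding expectation_finite [OF finite_paths] by (intro sum.cong) auto
  also have "\<dots> = pmf (P m) t * pmf (K (x m)) (x (Suc m))"
    by (auto simp: sum.delta pmf_eq_0_set_pmf)
  finally show ?thesis by (simp add: z_def t_def)
qed

text \<open>Only finitely many paths have positive probability, so that no joint measurability of the
  path, in the uncountable product of discrete spaces, is needed.\<close>

lemma realisation_bound:
  assumes M: "prob_space M"
    and F: "\<And>m. F m \<in> M \<rightarrow>\<^sub>M count_space UNIV"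
    and F0: "AE w in M. F 0 w = x0"
    and Fm: "\<And>m x. measure M {w \<in> space M. \<forall>i\<le>Suc m. F i w = x i} =
            measure M {w \<in> space M. \<forall>i\<le>m. F i w = x i} * pmf (K (x m)) (x (Suc m))"
    and Q: "{w \<in> space M. Q w} \<in> sets M"
    and imp: "\<And>w x. w \<in> space M \<Longrightarrow> Q w \<Longrightarrow> x \<in> set_pmf (P N) \<Longrightarrow> (\<And>i. i \<le> N \<Longrightarrow> F i w = x i) \<Longrightarrow> x \<in> A"
  shows "measure M {w \<in> space M. Q w} \<le> measure_pmf.prob (P N) A"
proof -
  interpret prob_space M by fact
  define B where "B x = {w \<in> space M. \<forall>i\<le>N. F i w = x i}" for x
  have meas: "{w \<in> space M. \<forall>i\<le>m. F i w = x i} \<in> sets M" for m x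
  proof -
    have "{w \<in> space M. F i w = x i} \<in> sets M" for i
      using measurable_sets [OF F [of i], of "{x i}"] by (simp add: vimage_def Int_def conj_commute)
    then have "(\<Inter>i\<in>{..m}. {w \<in> space M. F i w = x i}) \<in> sets M"
      by (intro sets.finite_INT) auto
    moreover have "(\<Inter>i\<in>{..m}. {w \<in> space M. F i w = x i}) = {w \<in> space M. \<forall>i\<le>m. F i w = x i}"
      by auto
    ultimately show ?thesis by (simp only:)
  qed
  have pm: "measure M {w \<in> space M. \<forall>i\<le>m. F i w = x i} = pmf (P m) (\<lambda>i. if i \<le> m then x i else x0)" for m x
  proof (induction m)
    case 0
    show ?case
    proof (cases "x 0 = x0")
      case True
      have "measure M {w \<in> space M. \<forall>i\<le>0. F i w = x i} = 1"
        using F0 True meas [of 0 x] by (subst prob_Collect_eq_1) auto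
      moreover have "(\<lambda>i::nat. if i \<le> 0 then x i else x0) = (\<lambda>_. x0)" using True by auto
      ultimately show ?thesis by simp
    next
      case False
      have "measure M {w \<in> space M. \<forall>i\<le>0. F i w = x i} = 0"
        using F0 False meas [of 0 x] by (subst prob_Collect_eq_0) auto
      moreover have "(\<lambda>i::nat. if i \<le> 0 then x i else x0) \<noteq> (\<lambda>_. x0)"
        using False by (metis order_refl)
      ultimately show ?thesis by (auto simp: pmf_return)
    qed
  next
    case (Suc m)
    then show ?case by (simp only: Fm pmf_path_Suc)
  qed
  have ext: "(\<lambda>i. if i \<le> N then x i else x0) = x" if "x \<in> set_pmf (P N)" for x
    using pmf_path_pmf_extends [OF that] by (auto simp: fun_eq_iff)
  have disj: "disjoint_family_on B (set_pmf (P N))"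
  proof (unfold disjoint_family_on_def, intro ballI impI)
    fix x y assume xy: "x \<in> set_pmf (P N)" "y \<in> set_pmf (P N)" "x \<noteq> y"
    then obtain i where "x i \<noteq> y i" by auto
    moreover have "i \<le> N"
      using pmf_path_pmf_extends [OF xy(1), of i] pmf_path_pmf_extends [OF xy(2), of i] calculation
      by (metis not_le)
    ultimately show "B x \<inter> B y = {}" by (auto simp: B_def)
  qed
  have Bs: "B x \<in> sets M" for x
    unfolding B_def by (rule meas)
  have mB: "measure M (\<Union>x\<in>D. B x) = measure_pmf.prob (P N) D" if "D \<subseteq> set_pmf (P N)" for D
  proof -
    have fin: "finite D" using that finite_paths finite_subset by blast
    have "measure M (\<Union>x\<in>D. B x) = (\<Sum>x\<in>D. measure M (B x))"
    proof (rule finite_measure_finite_Union [OF fin])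
      show "B ` D \<subseteq> sets M" using Bs by blast
      show "disjoint_family_on B D" using disj that unfolding disjoint_family_on_def by blast
    qed
    also have "\<dots> = (\<Sum>x\<in>D. pmf (P N) x)"
    proof (intro sum.cong refl)
      fix x assume "x \<in> D"
      then have "x \<in> set_pmf (P N)" using that by blast
      then show "measure M (B x) = pmf (P N) x" unfolding B_def pm by (simp only: ext)
    qed
    finally show ?thesis using fin by (simp add: measure_measure_pmf_finite)
  qed
  let ?D = "set_pmf (P N)"
  have measB: "(\<Union>x\<in>D. B x) \<in> sets M" if "D \<subseteq> set_pmf (P N)" for D
    using that Bs finite_paths by (intro sets.finite_UN) (blast intro: finite_subset)+
  have full: "prob (\<Union>x\<in>?D. B x) = 1"
    using mB [of ?D] by (simp add: measure_pmf.prob_eq_1 AE_measure_pmf)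
  \<comment> \<open>Outside the cylinders of the paths in the support the event is only known to lie
    in a null set.\<close>
  have "prob {w \<in> space M. Q w} \<le> prob ((\<Union>x\<in>?D \<inter> A. B x) \<union> (space M - (\<Union>x\<in>?D. B x)))"
  proof (rule finite_measure_mono)
    show "{w \<in> space M. Q w} \<subseteq> (\<Union>x\<in>?D \<inter> A. B x) \<union> (space M - (\<Union>x\<in>?D. B x))"
      using imp by (auto simp: B_def)
    show "(\<Union>x\<in>?D \<inter> A. B x) \<union> (space M - (\<Union>x\<in>?D. B x)) \<in> sets M"
      using measB [of ?D] measB [of "?D \<inter> A"] by auto
  qed
  also have "\<dots> \<le> prob (\<Union>x\<in>?D \<inter> A. B x) + prob (space M - (\<Union>x\<in>?D. B x))"
    using measB [of ?D] measB [of "?D \<inter> A"] by (intro measure_Un_le) auto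
  also have "prob (space M - (\<Union>x\<in>?D. B x)) = 0"
    using full measB [of ?D] by (simp add: prob_compl)
  also have "prob (\<Union>x\<in>?D \<inter> A. B x) = measure_pmf.prob (P N) (?D \<inter> A)"
    by (rule mB) auto
  also have "\<dots> \<le> measure_pmf.prob (P N) A"
    by (intro measure_pmf.finite_measure_mono) auto
  finally show ?thesis by simp
qed

lemma markov_inequality:
  assumes "\<And>x. x \<in> set_pmf (P N) \<Longrightarrow> 0 \<le> f x" "0 < a" "\<And>x. x \<in> set_pmf (P N) \<Longrightarrow> x \<in> A \<Longrightarrow> a \<le> f x"
  shows "measure_pmf.prob (P N) A \<le> E N f / a"
proof -
  have "measure_pmf.prob (P N) A = E N (indicator A)" by simp
  also have "\<dots> \<le> E N (\<lambda>x. f x / a)"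
    using assms by (intro E_mono) (auto simp: indicator_def)
  finally show ?thesis by simp
qed

end

section \<open>Conservation of mass\<close>

text \<open>Arithmetic-geometric mean; it plays the part of the Cauchy-Schwarz inequality when
  passing from second to first moments. With \<delta> = \<epsilon>, a second moment of at most
  \<open>\<epsilon>\<^sup>2\<close> gives a first moment of at most \<epsilon>.\<close>

lemma abs_le_square_split:
  fixes a \<delta> :: real
  assumes "0 < \<delta>"
  shows "\<bar>a\<bar> \<le> \<delta> / 2 + a\<^sup>2 / (2 * \<delta>)"
proof -
  have "0 \<le> (\<bar>a\<bar> - \<delta>)\<^sup>2" by simp
  then have "2 * \<bar>a\<bar> * \<delta> \<le> \<delta>\<^sup>2 + a\<^sup>2" by (simp add: power2_eq_square algebra_simps)
  then show ?thesis using assms by (simp add: field_simps power2_eq_square)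
qed

text \<open>What the limit theorem uses of the graphs: the masses \<open>c n k\<close> of trees of
  size k, the forest mass \<open>v\<close>, the number \<tau> of trees divided by n, and their
  one-step behaviour. The parameter \<open>T\<close> is the time horizon.\<close>

locale coagulation =
  fixes p T :: real
    and K :: "nat \<Rightarrow> 's \<Rightarrow> 's pmf" and x0 :: 's and S :: "nat \<Rightarrow> 's set"
    and c :: "nat \<Rightarrow> nat \<Rightarrow> 's \<Rightarrow> real" and v \<tau> :: "nat \<Rightarrow> 's \<Rightarrow> real"
  assumes p: "0 < p" "p \<le> 1" and T: "0 < T"
    and chain: "2 \<le> n \<Longrightarrow> finite_chain (K n) x0 (S n)"
    and c_nonneg: "0 \<le> c n k x"
    and c_0 [simp]: "c n 0 x = 0"
    and c_large: "2 \<le> n \<Longrightarrow> x \<in> S n \<Longrightarrow> n < k \<Longrightarrow> c n k x = 0"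
    and v_eq: "2 \<le> n \<Longrightarrow> x \<in> S n \<Longrightarrow> v n x = (\<Sum>k\<le>n. c n k x)"
    and \<tau>_eq: "2 \<le> n \<Longrightarrow> x \<in> S n \<Longrightarrow> \<tau> n x = (\<Sum>k\<le>n. c n k x / real k)"
    and c_start: "2 \<le> n \<Longrightarrow> c n k x0 = (if k = 1 then 1 else 0)"
    and v_step: "2 \<le> n \<Longrightarrow> x \<in> S n \<Longrightarrow> y \<in> set_pmf (K n x) \<Longrightarrow> v n y \<le> v n x"
    and c_step: "2 \<le> n \<Longrightarrow> x \<in> S n \<Longrightarrow> y \<in> set_pmf (K n x) \<Longrightarrow> \<bar>c n k y - c n k x\<bar> \<le> 2 * real k / real n"
    and c_drift: "2 \<le> n \<Longrightarrow> x \<in> S n \<Longrightarrow>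
      \<bar>measure_pmf.expectation (K n x) (c n k) - c n k x
        - real k / real n * ((\<Sum>i\<le>k. c n i x * c n (k - i) x) - 2 * c n k x * (v n x + p * (1 - v n x)))\<bar>
      \<le> 8 * (real k)\<^sup>2 / (real n)\<^sup>2"
    and \<tau>_drift: "2 \<le> n \<Longrightarrow> x \<in> S n \<Longrightarrow>
      measure_pmf.expectation (K n x) (\<tau> n)
      \<le> \<tau> n x - ((v n x)\<^sup>2 + 2 * p * v n x * (1 - v n x)) / real n + 1 / (real n)\<^sup>2"
begin

definition N :: "nat \<Rightarrow> nat" where "N n = nat \<lfloor>T * real n\<rfloor>"

abbreviation P :: "nat \<Rightarrow> (nat \<Rightarrow> 's) pmf" where
  "P n \<equiv> path_pmf (K n) x0 (N n)"

abbreviation E :: "nat \<Rightarrow> ((nat \<Rightarrow> 's) \<Rightarrow> real) \<Rightarrow> real" where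
  "E n f \<equiv> measure_pmf.expectation (P n) f"

definition u :: "nat \<Rightarrow> nat \<Rightarrow> 's \<Rightarrow> real" where
  "u n L x = (\<Sum>k\<le>L. c n k x)"

definition w :: "nat \<Rightarrow> 's \<Rightarrow> real" where
  "w n x = v n x + p * (1 - v n x)"

text \<open>Smallness uniform over all steps up to time \<open>T\<close>. It is one-sided, being
  meant for nonnegative errors.\<close>

definition unif_small :: "(nat \<Rightarrow> nat \<Rightarrow> real) \<Rightarrow> bool" where
  "unif_small \<phi> \<longleftrightarrow> (\<forall>\<epsilon>>0. \<forall>\<^sub>F n in sequentially. \<forall>m\<le>N n. \<phi> n m \<le> \<epsilon>)"

lemma N_le: "real (N n) \<le> T * real n"
  using T by (simp add: N_def)

lemma time_le: "m \<le> N n \<Longrightarrow> real m / real n \<le> T"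
proof -
  assume "m \<le> N n"
  then have "real m \<le> T * real n" using N_le [of n] by linarith
  then show ?thesis using T by (cases "n = 0") (auto simp: divide_le_eq)
qed

lemma unif_smallD: "unif_small \<phi> \<Longrightarrow> 0 < \<epsilon> \<Longrightarrow> \<forall>\<^sub>F n in sequentially. \<forall>m\<le>N n. \<phi> n m \<le> \<epsilon>"
  by (simp add: unif_small_def)

lemma unif_small_mono:
  assumes "unif_small \<phi>" "\<And>n m. 2 \<le> n \<Longrightarrow> m \<le> N n \<Longrightarrow> \<psi> n m \<le> \<phi> n m"
  shows "unif_small \<psi>"
  unfolding unif_small_def
proof (intro allI impI)
  fix \<epsilon> :: real assume "0 < \<epsilon>"
  from unif_smallD [OF assms(1) this] eventually_ge_at_top [of 2]
  show "\<forall>\<^sub>F n in sequentially. \<forall>m\<le>N n. \<psi> n m \<le> \<epsilon>"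
    by eventually_elim (meson assms(2) order_trans)
qed

lemma unif_small_add:
  assumes "unif_small \<phi>" "unif_small \<psi>"
  shows "unif_small (\<lambda>n m. \<phi> n m + \<psi> n m)"
  unfolding unif_small_def
proof (intro allI impI)
  fix \<epsilon> :: real assume "0 < \<epsilon>"
  then have "0 < \<epsilon> / 2" by simp
  from unif_smallD [OF assms(1) this] unif_smallD [OF assms(2) this]
  show "\<forall>\<^sub>F n in sequentially. \<forall>m\<le>N n. \<phi> n m + \<psi> n m \<le> \<epsilon>"
    by eventually_elim (metis add_mono field_sum_of_halves)
qed

lemma unif_small_cmult:
  assumes "unif_small \<phi>" "0 \<le> C"
  shows "unif_small (\<lambda>n m. C * \<phi> n m)"
  unfolding unif_small_def
proof (intro allI impI)
  fix \<epsilon> :: real assume "0 < \<epsilon>"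
  then have "0 < \<epsilon> / (C + 1)" using assms by simp
  from unif_smallD [OF assms(1) this]
  show "\<forall>\<^sub>F n in sequentially. \<forall>m\<le>N n. C * \<phi> n m \<le> \<epsilon>"
  proof (eventually_elim, intro allI impI)
    fix n m assume "\<forall>m\<le>N n. \<phi> n m \<le> \<epsilon> / (C + 1)" "m \<le> N n"
    then have "C * \<phi> n m \<le> C * (\<epsilon> / (C + 1))" using assms by (intro mult_left_mono) auto
    also have "\<dots> \<le> \<epsilon>" using assms \<open>0 < \<epsilon>\<close> by (simp add: field_simps)
    finally show "C * \<phi> n m \<le> \<epsilon>" .
  qed
qed

lemma unif_small_zero: "unif_small (\<lambda>n m. 0)"
  by (simp add: unif_small_def)

lemma unif_small_sum:
  "finite I \<Longrightarrow> (\<And>i. i \<in> I \<Longrightarrow> unif_small (\<phi> i)) \<Longrightarrow> unif_small (\<lambda>n m. \<Sum>i\<in>I. \<phi> i n m)"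
  by (induction I rule: finite_induct) (auto intro: unif_small_zero unif_small_add)

lemma unif_small_rate: "unif_small (\<lambda>n m. B / real n)"
  unfolding unif_small_def
proof (intro allI impI)
  fix \<epsilon> :: real assume "0 < \<epsilon>"
  have "(\<lambda>n. B / real n) \<longlonglongrightarrow> 0" by real_asymp
  then have "\<forall>\<^sub>F n in sequentially. B / real n < \<epsilon>" using \<open>0 < \<epsilon>\<close> by (rule order_tendstoD)
  then show "\<forall>\<^sub>F n in sequentially. \<forall>m\<le>N n. B / real n \<le> \<epsilon>" by eventually_elim auto
qed

text \<open>At most T n summands are divided by n, so the average is at most T times the largest
  summand.\<close>

lemma unif_small_average:
  assumes "unif_small \<phi>"
  shows "unif_small (\<lambda>n m. (\<Sum>l<m. \<phi> n l) / real n)"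
  unfolding unif_small_def
proof (intro allI impI)
  fix \<epsilon> :: real assume "0 < \<epsilon>"
  then have "0 < \<epsilon> / T" using T by simp
  from unif_smallD [OF assms(1) this]
  show "\<forall>\<^sub>F n in sequentially. \<forall>m\<le>N n. (\<Sum>l<m. \<phi> n l) / real n \<le> \<epsilon>"
  proof (eventually_elim, intro allI impI)
    fix n m assume *: "\<forall>m\<le>N n. \<phi> n m \<le> \<epsilon> / T" "m \<le> N n"
    have "(\<Sum>l<m. \<phi> n l) \<le> (\<Sum>l<m. \<epsilon> / T)" using * by (intro sum_mono) auto
    then have "(\<Sum>l<m. \<phi> n l) / real n \<le> (real m * (\<epsilon> / T)) / real n" by (intro divide_right_mono) auto
    also have "\<dots> = real m / real n * (\<epsilon> / T)" by simp
    also have "\<dots> \<le> T * (\<epsilon> / T)"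
      using time_le [OF *(2)] T \<open>0 < \<epsilon>\<close> by (intro mult_right_mono) auto
    finally show "(\<Sum>l<m. \<phi> n l) / real n \<le> \<epsilon>" using T by simp
  qed
qed

section \<open>Bounds along every path of positive probability\<close>

context
  fixes n :: nat
  assumes n: "2 \<le> n"
begin

interpretation ch: finite_chain "K n" x0 "S n"
  by (rule chain [OF n])

lemmas E_mono = ch.E_mono [of "N n"]
  and E_cong = ch.E_cong [of "N n"]
  and E_add = ch.E_add [of "N n"]
  and E_diff = ch.E_diff [of "N n"]
  and E_sum = ch.E_sum [of "N n"]
  and E_nonneg = ch.E_nonneg [of "N n"]
  and E_step = ch.E_step [of _ _ "N n"]
  and path_good = ch.path_support(2) [of _ "N n"]
  and path_start = ch.path_support(1) [of _ "N n"]
  and path_step = ch.path_support(3) [of _ "N n"]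
  and approx_martingale = ch.approx_martingale_L2 [of _ "N n"]
  and markov = ch.markov_inequality [of "N n"]

lemma integrable_K: "x \<in> S n \<Longrightarrow> integrable (measure_pmf (K n x)) (f :: 's \<Rightarrow> real)"
  using ch.finite_step by (intro integrable_measure_pmf_finite) auto

lemma E_abs_le_square: "0 < \<delta> \<Longrightarrow> E n (\<lambda>x. \<bar>f x\<bar>) \<le> \<delta> / 2 + E n (\<lambda>x. (f x)\<^sup>2) / (2 * \<delta>)"
proof -
  assume "0 < \<delta>"
  then have "E n (\<lambda>x. \<bar>f x\<bar>) \<le> E n (\<lambda>x. \<delta> / 2 + (f x)\<^sup>2 / (2 * \<delta>))"
    by (intro E_mono abs_le_square_split)
  then show ?thesis by (simp add: E_add)
qed

context
  fixes x :: "nat \<Rightarrow> 's"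
  assumes x: "x \<in> set_pmf (P n)"
begin

lemma v_path_antimono: "l \<le> m \<Longrightarrow> m \<le> N n \<Longrightarrow> v n (x m) \<le> v n (x l)"
proof (induction m rule: dec_induct)
  case (step m)
  then have "v n (x (Suc m)) \<le> v n (x m)"
    by (intro v_step n path_good path_step x) auto
  with step show ?case by simp
qed simp

lemma v_path_start: "v n (x 0) = 1"
proof -
  have "v n (x 0) = (\<Sum>k\<le>n. if k = 1 then 1 else 0)"
    using path_good [OF x, of 0] path_start [OF x] by (simp add: v_eq [OF n] c_start [OF n])
  then show ?thesis using n by (simp add: sum.delta)
qed

lemma v_nonneg: "0 \<le> v n (x m)"
  unfolding v_eq [OF n path_good [OF x]] by (intro sum_nonneg c_nonneg)

lemma v_le_1: "m \<le> N n \<Longrightarrow> v n (x m) \<le> 1"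
  using v_path_antimono [of 0 m] v_path_start by simp

lemma u_nonneg: "0 \<le> u n L (x m)"
  unfolding u_def by (intro sum_nonneg c_nonneg)

lemma u_mono: "L \<le> L' \<Longrightarrow> u n L (x m) \<le> u n L' (x m)"
  unfolding u_def by (intro sum_mono2) (auto intro: c_nonneg)

lemma u_le_v: "u n L (x m) \<le> v n (x m)"
proof -
  have "v n (x m) = (\<Sum>k\<le>max n L. c n k (x m))"
    unfolding v_eq [OF n path_good [OF x]]
    by (intro sum.mono_neutral_left) (auto simp: c_large [OF n path_good [OF x]] not_le)
  then show ?thesis
    using u_mono [of L "max n L" m] by (simp add: u_def)
qed

lemma c_le_u: "k \<le> L \<Longrightarrow> c n k (x m) \<le> u n L (x m)"
  unfolding u_def by (intro member_le_sum) (auto intro: c_nonneg)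

lemma c_le_1: "m \<le> N n \<Longrightarrow> c n k (x m) \<le> 1"
  using c_le_u [of k k m] u_le_v [of k m] v_le_1 [of m] by linarith

lemma w_bounds: "m \<le> N n \<Longrightarrow> 0 \<le> w n (x m)" "m \<le> N n \<Longrightarrow> w n (x m) \<le> 1"
proof -
  assume m: "m \<le> N n"
  have "p * (1 - v n (x m)) \<le> 1 * (1 - v n (x m))" using p v_le_1 [OF m] by (intro mult_right_mono) auto
  then show "w n (x m) \<le> 1" by (simp add: w_def)
  show "0 \<le> w n (x m)" using p v_le_1 [OF m] v_nonneg [of m] by (simp add: w_def)
qed

lemma conv_nonneg: "0 \<le> (\<Sum>i\<le>k. c n i (x m) * c n (k - i) (x m))"
  by (intro sum_nonneg mult_nonneg_nonneg c_nonneg)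

lemma conv_le_1:
  assumes "m \<le> N n"
  shows "(\<Sum>i\<le>k. c n i (x m) * c n (k - i) (x m)) \<le> 1"
proof -
  have "(\<Sum>i\<le>k. c n i (x m) * c n (k - i) (x m)) \<le> (\<Sum>i\<le>k. c n i (x m) * 1)"
    using c_le_1 [OF assms] by (intro sum_mono mult_left_mono c_nonneg)
  also have "\<dots> = u n k (x m)" by (simp add: u_def)
  also have "\<dots> \<le> 1" using u_le_v v_le_1 [OF assms] order_trans by blast
  finally show ?thesis .
qed

text \<open>The square of pairs i, j \<le> L lies in the triangle i + j \<le> 2 L. This inclusion is
  the reason for the two cutoffs L and 2 L in what follows.\<close>

lemma conv_sum_ge: "(u n L (x m))\<^sup>2 \<le> (\<Sum>k\<le>2*L. \<Sum>i\<le>k. c n i (x m) * c n (k - i) (x m))"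
proof -
  let ?f = "\<lambda>(i, j). c n i (x m) * c n j (x m)"
  have "(u n L (x m))\<^sup>2 = (\<Sum>i\<le>L. \<Sum>j\<le>L. c n i (x m) * c n j (x m))"
    by (simp add: u_def power2_eq_square sum_product)
  also have "\<dots> = sum ?f ({..L} \<times> {..L})" by (simp add: sum.cartesian_product)
  also have "\<dots> \<le> sum ?f {(i, j). i + j \<le> 2 * L}"
  proof (rule sum_mono2)
    have "{(i, j). i + j \<le> 2 * L} \<subseteq> {..2*L} \<times> {..2*L}" by auto
    then show "finite {(i, j). i + j \<le> 2 * L}" by (rule finite_subset) auto
  qed (auto intro: mult_nonneg_nonneg c_nonneg)
  also have "\<dots> = (\<Sum>k\<le>2*L. \<Sum>i\<le>k. c n i (x m) * c n (k - i) (x m))"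
    by (rule sum.triangle_reindex_eq)
  finally show ?thesis .
qed

text \<open>The drift of the number of trees larger than \<open>2 * L\<close> is at most minus the square of the
  missing mass, up to the mass between the sizes \<open>L\<close> and \<open>2 * L\<close>.\<close>

lemma large_trees_drift:
  assumes m: "m \<le> N n"
  shows "- ((v n (x m))\<^sup>2 + 2 * p * v n (x m) * (1 - v n (x m)))
    - (\<Sum>k\<le>2*L. (\<Sum>i\<le>k. c n i (x m) * c n (k - i) (x m)) - 2 * c n k (x m) * w n (x m))
    \<le> - (v n (x m) - u n (2*L) (x m))\<^sup>2 + 2 * (u n (2*L) (x m) - u n L (x m))"
proof -
  define V U U' where "V = v n (x m)" and "U = u n (2*L) (x m)" and "U' = u n L (x m)"
  have b: "0 \<le> U'" "U' \<le> U" "U \<le> V" "V \<le> 1"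
    using u_nonneg u_mono [of L "2*L" m] u_le_v v_le_1 [OF m] by (auto simp: V_def U_def U'_def)
  have "(\<Sum>k\<le>2*L. (\<Sum>i\<le>k. c n i (x m) * c n (k - i) (x m)) - 2 * c n k (x m) * w n (x m))
    = (\<Sum>k\<le>2*L. \<Sum>i\<le>k. c n i (x m) * c n (k - i) (x m)) - 2 * U * w n (x m)"
    by (simp add: sum_subtractf U_def u_def sum_distrib_left sum_distrib_right mult.assoc)
  also have "\<dots> \<ge> U'\<^sup>2 - 2 * U * (V + p * (1 - V))"
    using conv_sum_ge [where L = L and m = m] by (simp add: U'_def w_def V_def)
  finally have 1: "U'\<^sup>2 - 2 * U * (V + p * (1 - V))
    \<le> (\<Sum>k\<le>2*L. (\<Sum>i\<le>k. c n i (x m) * c n (k - i) (x m)) - 2 * c n k (x m) * w n (x m))" .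
  \<comment> \<open>The first inequality replaces the square of the mass up to L by that up to 2 L;
    the second discards the nonnegative term 2 p (1 - V) (V - U).\<close>
  have "(U - U') * (U + U') \<le> (U - U') * 2" using b by (intro mult_left_mono) auto
  moreover have "0 \<le> 2 * p * ((1 - V) * (V - U))" using b p by simp
  ultimately have "- (V\<^sup>2 + 2 * p * V * (1 - V)) - (U'\<^sup>2 - 2 * U * (V + p * (1 - V)))
     \<le> - (V - U)\<^sup>2 + 2 * (U - U')"
    by (simp add: power2_eq_square algebra_simps)
  then show ?thesis using 1 unfolding V_def [symmetric] U_def [symmetric] U'_def [symmetric] by linarith
qed

end

text \<open>\<open>\<Theta>\<close> is the number of trees larger than 2 L divided by n. It starts
  at 0, since all initial trees have size 1 \<le> 2 L, and stays nonnegative. So its accumulated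
  drift cannot be negative, which bounds the squares by the mass between the two cutoffs.\<close>

lemma mass_step:
  assumes L: "0 < L"
  shows "(\<Sum>m<N n. E n (\<lambda>x. (v n (x m) - u n (2*L) (x m))\<^sup>2)) / real n
   \<le> 2 * ((\<Sum>m<N n. E n (\<lambda>x. u n (2*L) (x m))) / real n - (\<Sum>m<N n. E n (\<lambda>x. u n L (x m))) / real n)
     + T * (1 + (\<Sum>k\<le>2*L. 8 * real k)) / real n"
proof -
  define B where "B = 1 + (\<Sum>k\<le>2*L. 8 * real k)"
  have B: "0 \<le> B" by (simp add: B_def sum_nonneg add_nonneg_nonneg)
  define \<Theta> where "\<Theta> y = \<tau> n y - (\<Sum>k\<le>2*L. c n k y / real k)" for y
  have \<Theta>_nonneg: "0 \<le> \<Theta> (x m)" if x: "x \<in> set_pmf (P n)" for x m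
  proof -
    have "\<tau> n (x m) = (\<Sum>k\<le>max n (2*L). c n k (x m) / real k)"
      unfolding \<tau>_eq [OF n path_good [OF x]]
      by (intro sum.mono_neutral_left) (auto simp: c_large [OF n path_good [OF x]] not_le)
    also have "\<dots> \<ge> (\<Sum>k\<le>2*L. c n k (x m) / real k)"
      by (intro sum_mono2) (auto intro!: divide_nonneg_nonneg c_nonneg)
    finally show ?thesis by (simp add: \<Theta>_def)
  qed
  have \<Theta>_0: "\<Theta> (x 0) \<le> 0" if x: "x \<in> set_pmf (P n)" for x
  proof -
    have "\<tau> n x0 = 1"
    proof -
      have "x0 \<in> S n" using path_good [OF x, of 0] path_start [OF x] by simp
      then have "\<tau> n x0 = (\<Sum>k\<le>n. c n k x0 / real k)" by (rule \<tau>_eq [OF n])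
      also have "\<dots> = (\<Sum>k\<le>n. if k = 1 then 1 else 0)"
        by (intro sum.cong refl) (simp add: c_start [OF n])
      finally show ?thesis using n by (simp add: sum.delta)
    qed
    moreover have "(\<Sum>k\<le>2*L. c n k x0 / real k) = (\<Sum>k\<le>2*L. if k = 1 then 1 else 0)"
      by (intro sum.cong refl) (simp add: c_start [OF n])
    ultimately show ?thesis using path_start [OF x] L by (auto simp: \<Theta>_def sum.delta)
  qed
  define \<phi> where "\<phi> m x = - (v n (x m) - u n (2*L) (x m))\<^sup>2 + 2 * (u n (2*L) (x m) - u n L (x m))" for m :: nat and x
  have step: "E n (\<lambda>x. \<Theta> (x (Suc m))) \<le> E n (\<lambda>x. \<Theta> (x m)) + E n (\<phi> m) / real n + B / (real n)\<^sup>2" if m: "m < N n" for m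
  proof -
    have "adapted (Suc m) (\<lambda>x. \<Theta> (x (Suc m)))" by (simp add: adapted_def)
    from E_step [OF this] m
    have "E n (\<lambda>x. \<Theta> (x (Suc m))) = E n (\<lambda>x. measure_pmf.expectation (K n (x m)) \<Theta>)" by simp
    also have "\<dots> \<le> E n (\<lambda>x. \<Theta> (x m) + (\<phi> m x / real n + B / (real n)\<^sup>2))"
    proof (rule E_mono)
      fix x assume x: "x \<in> set_pmf (P n)"
      let ?y = "x m"
      note y = path_good [OF x, of m]
      let ?e = "\<lambda>k. (\<Sum>i\<le>k. c n i ?y * c n (k - i) ?y) - 2 * c n k ?y * w n ?y"
      have ck: "c n k ?y / real k + ?e k / real n - 8 * real k / (real n)\<^sup>2
          \<le> measure_pmf.expectation (K n ?y) (\<lambda>z. c n k z / real k)" for k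
      proof (cases "k = 0")
        case False
        have "measure_pmf.expectation (K n ?y) (c n k) \<ge> c n k ?y + real k / real n * ?e k - 8 * (real k)\<^sup>2 / (real n)\<^sup>2"
          using c_drift [OF n y, of k] unfolding w_def abs_le_iff by linarith
        then have "(c n k ?y + real k / real n * ?e k - 8 * (real k)\<^sup>2 / (real n)\<^sup>2) / real k
          \<le> measure_pmf.expectation (K n ?y) (c n k) / real k"
          by (intro divide_right_mono) auto
        then show ?thesis
          using False by (simp add: add_divide_distrib diff_divide_distrib power2_eq_square)
      qed simp
      have "measure_pmf.expectation (K n ?y) \<Theta>
        = measure_pmf.expectation (K n ?y) (\<tau> n) - (\<Sum>k\<le>2*L. measure_pmf.expectation (K n ?y) (\<lambda>z. c n k z / real k))"
        unfolding \<Theta>_def [abs_def] by (simp add: integrable_K [OF y] Bochner_Integration.integral_diff Bochner_Integration.integral_sum)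
      also have "\<dots> \<le> (\<tau> n ?y - ((v n ?y)\<^sup>2 + 2 * p * v n ?y * (1 - v n ?y)) / real n + 1 / (real n)\<^sup>2)
         - (\<Sum>k\<le>2*L. c n k ?y / real k + ?e k / real n - 8 * real k / (real n)\<^sup>2)"
        by (intro diff_mono \<tau>_drift n y sum_mono ck)
      also have "\<dots> = \<Theta> ?y + (- ((v n ?y)\<^sup>2 + 2 * p * v n ?y * (1 - v n ?y)) - (\<Sum>k\<le>2*L. ?e k)) / real n + B / (real n)\<^sup>2"
        by (simp add: \<Theta>_def B_def sum.distrib sum_subtractf sum_divide_distrib [symmetric] add_divide_distrib diff_divide_distrib)
      also have "\<dots> \<le> \<Theta> ?y + \<phi> m x / real n + B / (real n)\<^sup>2"
        unfolding \<phi>_def using large_trees_drift [OF x, of m L] m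
        by (intro add_mono divide_right_mono) auto
      finally show "measure_pmf.expectation (K n ?y) \<Theta> \<le> \<Theta> ?y + (\<phi> m x / real n + B / (real n)\<^sup>2)" by simp
    qed
    finally show ?thesis by (simp add: E_add)
  qed
  have "E n (\<lambda>x. \<Theta> (x m)) \<le> (\<Sum>l<m. E n (\<phi> l)) / real n + real m * (B / (real n)\<^sup>2)" if "m \<le> N n" for m
    using that
  proof (induction m)
    case 0
    have "E n (\<lambda>x. \<Theta> (x 0)) \<le> E n (\<lambda>x. 0)" by (intro E_mono \<Theta>_0)
    then show ?case by simp
  next
    case (Suc m)
    then show ?case using step [of m] by (simp add: add_divide_distrib algebra_simps)
  qed
  from this [of "N n"] have "0 \<le> (\<Sum>l<N n. E n (\<phi> l)) / real n + real (N n) * (B / (real n)\<^sup>2)"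
    using E_nonneg [of "\<lambda>x. \<Theta> (x (N n))"] \<Theta>_nonneg by fastforce
  moreover have "real (N n) * (B / (real n)\<^sup>2) \<le> T * B / real n"
  proof -
    have "real (N n) * (B / (real n)\<^sup>2) \<le> (T * real n) * (B / (real n)\<^sup>2)"
      using N_le B by (intro mult_right_mono) auto
    then show ?thesis using n by (simp add: power2_eq_square)
  qed
  moreover have "E n (\<phi> m) = - E n (\<lambda>x. (v n (x m) - u n (2*L) (x m))\<^sup>2)
      + 2 * (E n (\<lambda>x. u n (2*L) (x m)) - E n (\<lambda>x. u n L (x m)))" for m
  proof -
    have "E n (\<phi> m) = E n (\<lambda>x. 2 * (u n (2*L) (x m) - u n L (x m)) - (v n (x m) - u n (2*L) (x m))\<^sup>2)"
      unfolding \<phi>_def [abs_def] by simp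
    then show ?thesis by (simp add: E_diff)
  qed
  ultimately show ?thesis
    by (simp add: B_def sum.distrib sum_subtractf sum_negf sum_distrib_left [symmetric] add_divide_distrib diff_divide_distrib)
qed

end

text \<open>Summing over dyadic scales: the mass between consecutive scales cannot always be large.\<close>

lemma mass_conservation:
  assumes "0 < \<epsilon>"
  shows "\<exists>L0. \<forall>L\<ge>L0. \<forall>\<^sub>F n in sequentially. (\<Sum>m<N n. E n (\<lambda>x. \<bar>v n (x m) - u n L (x m)\<bar>)) / real n \<le> \<epsilon>"
proof -
  \<comment> \<open>With these values the final split of the absolute value costs
    \<open>T * \<delta> / 2 = \<epsilon> / 2\<close> and
    \<open>\<eta> / (2 * \<delta>) = \<epsilon> / 4\<close>.\<close>
  define \<delta> where "\<delta> = \<epsilon> / T"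
  have \<delta>: "0 < \<delta>" using assms T by (simp add: \<delta>_def)
  define \<eta> where "\<eta> = \<epsilon> * \<delta> / 2"
  have \<eta>: "0 < \<eta>" using assms \<delta> by (simp add: \<eta>_def)
  \<comment> \<open>The number of dyadic scales: the masses between consecutive scales contribute at
    most \<open>2 * T\<close> in all, which is below \<open>J * (\<eta> / 2)\<close>.\<close>
  obtain J :: nat where J: "4 * T / \<eta> < real J" using reals_Archimedean2 by blast
  moreover have "0 < 4 * T / \<eta>" using T \<eta> by simp
  ultimately have J0: "0 < real J" by linarith
  define B where "B = (\<Sum>j<J. T * (1 + (\<Sum>k\<le>2 * 2 ^ j. 8 * real k)))"
  have ev: "\<forall>\<^sub>F n in sequentially. B / real n \<le> J * (\<eta> / 2)"
  proof -
    have "(\<lambda>n. B / real n) \<longlonglongrightarrow> 0" by real_asymp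
    then have "\<forall>\<^sub>F n in sequentially. B / real n < J * (\<eta> / 2)"
      by (rule order_tendstoD) (use J0 \<eta> in simp)
    then show ?thesis by eventually_elim simp
  qed
  show ?thesis
  proof (intro exI [of _ "2 ^ J"] allI impI)
    fix L :: nat assume L: "2 ^ J \<le> L"
    show "\<forall>\<^sub>F n in sequentially. (\<Sum>m<N n. E n (\<lambda>x. \<bar>v n (x m) - u n L (x m)\<bar>)) / real n \<le> \<epsilon>"
      using ev eventually_ge_at_top [of 2]
    proof eventually_elim
      case (elim n)
      then have n: "2 \<le> n" by simp
      define sq where "sq L = (\<Sum>m<N n. E n (\<lambda>x. (v n (x m) - u n L (x m))\<^sup>2)) / real n" for L
      define a where "a L = (\<Sum>m<N n. E n (\<lambda>x. u n L (x m))) / real n" for L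
      have sq_mono: "sq L' \<le> sq L''" if "L'' \<le> L'" for L' L''
        unfolding sq_def
      proof (intro divide_right_mono sum_mono E_mono [OF n] power_mono)
        fix m x assume x: "x \<in> set_pmf (P n)"
        show "v n (x m) - u n L' (x m) \<le> v n (x m) - u n L'' (x m)"
          using u_mono [OF n x that] by simp
        show "0 \<le> v n (x m) - u n L' (x m)" using u_le_v [OF n x] by simp
      qed auto
      have a_bounds: "0 \<le> a L'" "a L' \<le> T" for L'
      proof -
        show "0 \<le> a L'" unfolding a_def
          by (intro divide_nonneg_nonneg sum_nonneg E_nonneg [OF n] u_nonneg [OF n]) auto
        have "(\<Sum>m<N n. E n (\<lambda>x. u n L' (x m))) \<le> (\<Sum>m<N n. E n (\<lambda>x. 1))"
          using u_le_v [OF n] v_le_1 [OF n] by (intro sum_mono E_mono [OF n]) (meson lessThan_iff less_imp_le order_trans)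
        then have "a L' \<le> real (N n) / real n" unfolding a_def by (intro divide_right_mono) auto
        then show "a L' \<le> T" using time_le [of "N n" n] by simp
      qed
      \<comment> \<open>\<open>sq\<close> decreases in the cutoff, so its value at the largest scale
        is at most the mean over all scales, where the bounds telescope.\<close>
      have "real J * sq (2 ^ J) = (\<Sum>j<J. sq (2 ^ J))" by simp
      also have "\<dots> \<le> (\<Sum>j<J. 2 * (a (2 ^ Suc j) - a (2 ^ j)) + T * (1 + (\<Sum>k\<le>2 * 2 ^ j. 8 * real k)) / real n)"
      proof (intro sum_mono)
        fix j assume "j \<in> {..<J}"
        then have "sq (2 ^ J) \<le> sq (2 * 2 ^ j)"
          by (intro sq_mono) (simp flip: power_Suc)
        also have "\<dots> \<le> 2 * (a (2 * 2 ^ j) - a (2 ^ j)) + T * (1 + (\<Sum>k\<le>2 * 2 ^ j. 8 * real k)) / real n"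
          unfolding sq_def a_def by (rule mass_step [OF n]) simp
        finally show "sq (2 ^ J) \<le> 2 * (a (2 ^ Suc j) - a (2 ^ j)) + T * (1 + (\<Sum>k\<le>2 * 2 ^ j. 8 * real k)) / real n"
          by simp
      qed
      also have "\<dots> = 2 * (a (2 ^ J) - a (2 ^ 0)) + B / real n"
        unfolding sum.distrib sum_distrib_left [symmetric] sum_lessThan_telescope [of "\<lambda>j. a (2 ^ j)"]
          sum_divide_distrib [symmetric] B_def ..
      also have "\<dots> \<le> 2 * T + J * (\<eta> / 2)"
      proof -
        have "2 * (y - z) + b \<le> 2 * T + b'" if "y \<le> T" "0 \<le> z" "b \<le> b'" for y z b b' :: real
          using that by (intro add_mono mult_left_mono) auto
        then show ?thesis using a_bounds elim(1) by blast
      qed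
      also have "\<dots> \<le> J * (\<eta> / 2) + J * (\<eta> / 2)"
        using J \<eta> by (simp add: field_simps)
      finally have "real J * sq (2 ^ J) \<le> real J * \<eta>" by (simp add: mult.commute)
      then have "sq (2 ^ J) \<le> \<eta>" using J0 by simp
      with sq_mono [OF L] have sqL: "sq L \<le> \<eta>" by linarith
      have "(\<Sum>m<N n. E n (\<lambda>x. \<bar>v n (x m) - u n L (x m)\<bar>)) / real n
        \<le> (\<Sum>m<N n. \<delta> / 2 + E n (\<lambda>x. (v n (x m) - u n L (x m))\<^sup>2) / (2 * \<delta>)) / real n"
        by (intro divide_right_mono sum_mono E_abs_le_square [OF n] \<delta>) auto
      also have "\<dots> = real (N n) / real n * (\<delta> / 2) + sq L / (2 * \<delta>)"
        by (simp add: sum.distrib sq_def add_divide_distrib sum_divide_distrib [symmetric] mult_ac)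
      also have "\<dots> \<le> T * (\<delta> / 2) + \<eta> / (2 * \<delta>)"
        using sqL \<delta> time_le [of "N n" n] by (intro add_mono mult_right_mono divide_right_mono) auto
      also have "\<dots> \<le> \<epsilon>" using T \<delta> assms by (simp add: \<delta>_def \<eta>_def field_simps)
      finally show ?case .
    qed
  qed
qed

end

section \<open>Convergence of the rescaled tree masses\<close>

text \<open>The increment of G lies between the left and the right Riemann sum of q, which differ by
  their end terms only.\<close>

lemma riemann_sum_monotone:
  fixes G q :: "real \<Rightarrow> real"
  assumes deriv: "\<And>t. (G has_real_derivative q t) (at t)"
    and mono: "\<And>s t. 0 \<le> s \<Longrightarrow> s \<le> t \<Longrightarrow> q s \<le> q t" and n: "0 < n"
  shows "\<bar>G (real m / real n) - G 0 - (\<Sum>l<m. q (real l / real n)) / real n\<bar>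
    \<le> (q (real m / real n) - q 0) / real n"
proof -
  have "(\<Sum>l<m. q (real l / real n)) / real n \<le> G (real m / real n) - G 0 \<and>
     G (real m / real n) - G 0 \<le> (\<Sum>l<m. q (real (Suc l) / real n)) / real n"
  proof (induction m)
    case (Suc m)
    let ?a = "real m / real n" and ?b = "real (Suc m) / real n"
    have ab: "?a < ?b" "?b - ?a = 1 / real n" using n by (auto simp: divide_strict_right_mono add_divide_distrib)
    then obtain z where z: "?a < z" "z < ?b" "G ?b - G ?a = (?b - ?a) * q z"
      using MVT2 [of ?a ?b G q] deriv by auto
    have "q ?a \<le> q z" "q z \<le> q ?b" using z by (auto intro!: mono order_trans [OF _ less_imp_le [OF z(1)]])
    then have "q ?a / real n \<le> G ?b - G ?a" "G ?b - G ?a \<le> q ?b / real n"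
      using n unfolding z(3) ab(2) by (auto simp: divide_right_mono)
    then show ?case using Suc by (simp add: add_divide_distrib)
  qed simp
  moreover have "(\<Sum>l<m. q (real (Suc l) / real n)) = (\<Sum>l<m. q (real l / real n)) + (q (real m / real n) - q 0)"
    using sum_lessThan_telescope [of "\<lambda>l. q (real l / real n)" m] by (simp add: sum_subtractf)
  ultimately show ?thesis by (simp add: add_divide_distrib diff_divide_distrib)
qed

text \<open>The limit of the rescaled masses \<open>d\<close>: the factor of \<open>c_lim\<close>
  that is left when \<open>exp (- k * W_lim)\<close> is removed.\<close>

definition tree_power :: "nat \<Rightarrow> real \<Rightarrow> real" where
  "tree_power k t = tree_coeff k * (2 * t) ^ (k - 1)"

lemma tree_power_0 [simp]: "tree_power 0 t = 0"
  by (simp add: tree_power_def)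

lemma tree_power_nonneg: "0 \<le> t \<Longrightarrow> 0 \<le> tree_power k t"
  by (simp add: tree_power_def tree_coeff_nonneg)

lemma tree_power_mono: "0 \<le> s \<Longrightarrow> s \<le> t \<Longrightarrow> tree_power k s \<le> tree_power k t"
  unfolding tree_power_def by (intro mult_left_mono power_mono tree_coeff_nonneg) auto

lemma tree_power_convolution:
  "(\<Sum>i\<le>k. tree_power i t * tree_power (k - i) t) = 2 * (tree_coeff k - tree_coeff k / real k) * (2 * t) ^ (k - 2)"
proof -
  have "(\<Sum>i\<le>k. tree_power i t * tree_power (k - i) t) = (\<Sum>i\<le>k. tree_coeff i * tree_coeff (k - i) * (2 * t) ^ (k - 2))"
  proof (intro sum.cong refl)
    fix i assume i: "i \<in> {..k}"
    show "tree_power i t * tree_power (k - i) t = tree_coeff i * tree_coeff (k - i) * (2 * t) ^ (k - 2)"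
    proof (cases "i = 0 \<or> i = k")
      case False
      then have "k - 2 = (i - 1) + (k - i - 1)" using i by auto
      then have "(2 * t) ^ (k - 2) = (2 * t) ^ (i - 1) * (2 * t) ^ (k - i - 1)" by (simp only: power_add)
      then show ?thesis by (simp add: tree_power_def)
    qed auto
  qed
  then show ?thesis by (simp add: tree_coeff_convolution flip: sum_distrib_right)
qed

text \<open>These polynomials solve the Smoluchowski equation without loss, (x_k / k)' = \<Sum> x_i
  x_(k-i) with x_1(0) = 1, here as a Riemann sum. The case k = 1 has no gain; for the others the
  integrand is monotone, so the error is at most its value at \<open>T\<close> divided by n.\<close>

lemma tree_power_integral:
  assumes k: "1 \<le> k"
  shows "\<exists>B\<ge>0. \<forall>n m. 1 \<le> n \<longrightarrow> real m / real n \<le> T \<longrightarrow>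
    \<bar>tree_power k (real m / real n) / real k - (if k = 1 then 1 else 0)
      - (\<Sum>l<m. \<Sum>i\<le>k. tree_power i (real l / real n) * tree_power (k - i) (real l / real n)) / real n\<bar> \<le> B / real n"
proof (cases "k = 1")
  case True
  have "(\<Sum>i\<le>k. tree_power i t * tree_power (k - i) t) = 0" for t
    unfolding tree_power_convolution by (simp add: True)
  then show ?thesis by (intro exI [of _ 0]) (simp add: True tree_power_def)
next
  case False
  then obtain j where j: "k = Suc (Suc j)" using k by (metis One_nat_def Suc_le_D not0_implies_Suc)
  define G where "G t = tree_power k t / real k" for t
  define q where "q t = 2 * (tree_coeff k - tree_coeff k / real k) * (2 * t) ^ (k - 2)" for t :: real
  have tc: "tree_coeff k - tree_coeff k / real k = tree_coeff k / real k * real (Suc j)"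
    by (simp add: j field_simps)
  have tc0: "0 \<le> tree_coeff k - tree_coeff k / real k"
    unfolding tc by (intro mult_nonneg_nonneg divide_nonneg_nonneg tree_coeff_nonneg) auto
  have deriv: "(G has_real_derivative q t) (at t)" for t
  proof -
    have "((\<lambda>t. 2 * t) has_real_derivative 2) (at t)"
      by (auto intro!: derivative_eq_intros)
    from DERIV_cmult [OF DERIV_power [OF this, of "Suc j"], of "tree_coeff k / real k"]
    have "((\<lambda>t. tree_coeff k / real k * (2 * t) ^ Suc j) has_real_derivative
        (tree_coeff k / real k * (real (Suc j) * (2 * (2 * t) ^ j)))) (at t)" by simp
    moreover have "G = (\<lambda>t. tree_coeff k / real k * (2 * t) ^ Suc j)"
      by (auto simp: G_def tree_power_def j)
    moreover have "tree_coeff k / real k * (real (Suc j) * (2 * (2 * t) ^ j)) = q t"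
      unfolding q_def tc by (simp add: j)
    ultimately show ?thesis by simp
  qed
  have mono: "q s \<le> q t" if "0 \<le> s" "s \<le> t" for s t
    unfolding q_def using that tc0 by (intro mult_left_mono power_mono) auto
  have q0: "0 \<le> q 0" unfolding q_def using tc0 by simp
  have conv: "(\<Sum>i\<le>k. tree_power i t * tree_power (k - i) t) = q t" for t
    by (simp add: tree_power_convolution q_def)
  show ?thesis
  proof (intro exI [of _ "\<bar>q T\<bar>"] conjI allI impI)
    fix n m :: nat assume nm: "1 \<le> n" "real m / real n \<le> T"
    have "\<bar>G (real m / real n) - G 0 - (\<Sum>l<m. q (real l / real n)) / real n\<bar> \<le> (q (real m / real n) - q 0) / real n"
      using nm by (intro riemann_sum_monotone deriv mono) auto
    also have "\<dots> \<le> \<bar>q T\<bar> / real n"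
      using mono [of "real m / real n" T] nm q0 by (intro divide_right_mono) auto
    finally show "\<bar>tree_power k (real m / real n) / real k - (if k = 1 then 1 else 0)
      - (\<Sum>l<m. \<Sum>i\<le>k. tree_power i (real l / real n) * tree_power (k - i) (real l / real n)) / real n\<bar> \<le> \<bar>q T\<bar> / real n"
      using False by (simp add: conv G_def) (simp add: tree_power_def j)
  qed simp
qed

lemma exp_minus_one_le: "exp y - 1 \<le> y * exp y" for y :: real
proof -
  have "1 - y \<le> exp (- y)" using exp_ge_add_one_self [of "- y"] by simp
  then have "(1 - y) * exp y \<le> exp (- y) * exp y" by (intro mult_right_mono) auto
  then show ?thesis by (simp add: algebra_simps flip: exp_add)
qed

context coagulation
begin

definition W :: "nat \<Rightarrow> nat \<Rightarrow> (nat \<Rightarrow> 's) \<Rightarrow> real" where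
  "W n m x = 2 / real n * (\<Sum>l<m. w n (x l))"

text \<open>The integrating factor \<open>exp (k W)\<close> removes the loss terms from the Smoluchowski equations, so
  that the limits of the quantities \<open>d\<close> are polynomials which do not depend on the mass \<open>v\<close>.\<close>

definition d :: "nat \<Rightarrow> nat \<Rightarrow> nat \<Rightarrow> (nat \<Rightarrow> 's) \<Rightarrow> real" where
  "d n k m x = c n k (x m) * exp (real k * W n m x)"

lemma W_0 [simp]: "W n 0 x = 0"
  by (simp add: W_def)

lemma W_Suc: "W n (Suc m) x = W n m x + 2 * w n (x m) / real n"
  by (simp add: W_def distrib_left)

lemma d_0 [simp]: "d n 0 m x = 0"
  by (simp add: d_def)

text \<open>\<open>W n (Suc m)\<close> uses rates up to step \<open>m\<close> only, so the factor
  exp (k W) of the next step is already known and comes out of the conditional expectation.\<close>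

lemma W_adapted: "adapted m (W n (Suc m))"
  unfolding adapted_def W_def by (auto intro!: sum.cong)

lemma W_upd: "W n m (x(m := y)) = W n m x"
  unfolding W_def by (auto intro!: sum.cong)

lemma d_adapted: "adapted m (d n k m)"
proof (cases m)
  case 0
  then show ?thesis by (simp add: adapted_def d_def)
next
  case (Suc l)
  have "adapted m (W n m)" using adapted_mono [OF W_adapted [of l n]] Suc by simp
  then show ?thesis unfolding adapted_def d_def by (metis order_refl)
qed

context
  fixes n :: nat and x :: "nat \<Rightarrow> 's"
  assumes n: "2 \<le> n" and x: "x \<in> set_pmf (P n)"
begin

lemma W_nonneg: "m \<le> N n \<Longrightarrow> 0 \<le> W n m x"
  unfolding W_def using w_bounds(1) [OF n x] by (intro mult_nonneg_nonneg sum_nonneg) auto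

lemma W_le: "m \<le> N n \<Longrightarrow> W n m x \<le> 2 * T"
proof -
  assume m: "m \<le> N n"
  have "(\<Sum>l<m. w n (x l)) \<le> (\<Sum>l<m. 1)"
    using w_bounds(2) [OF n x] m by (intro sum_mono) auto
  then have "W n m x \<le> 2 / real n * real m" unfolding W_def by (intro mult_left_mono) auto
  also have "\<dots> = 2 * (real m / real n)" by simp
  also have "\<dots> \<le> 2 * T" using time_le [OF m] by (intro mult_left_mono) auto
  finally show ?thesis .
qed

lemma exp_W_le: "m \<le> N n \<Longrightarrow> exp (real k * W n m x) \<le> exp (2 * real k * T)"
  using mult_left_mono [OF W_le [of m], of "real k"] by (simp add: mult_ac)

lemma d_nonneg: "0 \<le> d n k m x"
  unfolding d_def by (intro mult_nonneg_nonneg c_nonneg) auto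

lemma d_le: "m \<le> N n \<Longrightarrow> d n k m x \<le> exp (2 * real k * T)"
  using mult_mono [OF c_le_1 [OF n x, of m k] exp_W_le [of m k]] by (simp add: d_def)

text \<open>Going back from \<open>d\<close> to \<open>c\<close> multiplies by exp (- k W) \<le> 1,
  which only shrinks errors.\<close>

lemma c_minus_limit:
  assumes "m \<le> N n"
  shows "\<bar>c n k (x m) - tree_power k t * exp (- real k * W n m x)\<bar> \<le> \<bar>d n k m x - tree_power k t\<bar>"
proof -
  have "c n k (x m) - tree_power k t * exp (- real k * W n m x) = (d n k m x - tree_power k t) * exp (- (real k * W n m x))"
    by (simp add: d_def left_diff_distrib mult.assoc flip: exp_add)
  also have "\<bar>\<dots>\<bar> \<le> \<bar>d n k m x - tree_power k t\<bar> * 1"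
    unfolding abs_mult using W_nonneg [OF assms] by (intro mult_left_mono) auto
  finally show ?thesis by simp
qed

end

text \<open>Defect in the integrated Smoluchowski equation for \<open>d\<close>: current value minus
  initial value minus accumulated gain. It is a martingale up to small drift.\<close>

definition Z :: "nat \<Rightarrow> nat \<Rightarrow> nat \<Rightarrow> (nat \<Rightarrow> 's) \<Rightarrow> real" where
  "Z n k m x = d n k m x / real k - (if k = 1 then 1 else 0)
     - (\<Sum>l<m. \<Sum>i\<le>k. d n i l x * d n (k - i) l x) / real n"

lemma Z_adapted: "adapted m (Z n k m)"
proof -
  have eq: "d n i l x = d n i l y" if "l \<le> m" "\<forall>j\<le>m. x j = y j" for i l x y
    by (rule adaptedD [OF d_adapted]) (use that in auto)
  show ?thesis
    unfolding adapted_def Z_def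
  proof (intro allI impI)
    fix x y :: "nat \<Rightarrow> 's" assume xy: "\<forall>j\<le>m. x j = y j"
    have "(\<Sum>l<m. \<Sum>i\<le>k. d n i l x * d n (k - i) l x) = (\<Sum>l<m. \<Sum>i\<le>k. d n i l y * d n (k - i) l y)"
      by (intro sum.cong refl arg_cong2 [of _ _ _ _ "(*)"] eq xy) auto
    moreover have "d n k m x = d n k m y" by (rule eq) (use xy in auto)
    ultimately show "d n k m x / real k - (if k = 1 then 1 else 0) - (\<Sum>l<m. \<Sum>i\<le>k. d n i l x * d n (k - i) l x) / real n
      = d n k m y / real k - (if k = 1 then 1 else 0) - (\<Sum>l<m. \<Sum>i\<le>k. d n i l y * d n (k - i) l y) / real n"
      by simp
  qed
qed

lemma d_convolution:
  "(\<Sum>i\<le>k. d n i m x * d n (k - i) m x) = (\<Sum>i\<le>k. c n i (x m) * c n (k - i) (x m)) * exp (real k * W n m x)"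
  unfolding sum_distrib_right
proof (intro sum.cong refl)
  fix i assume "i \<in> {..k}"
  then have "exp (real k * W n m x) = exp (real i * W n m x) * exp (real (k - i) * W n m x)"
    by (simp add: of_nat_diff algebra_simps flip: exp_add)
  then show "d n i m x * d n (k - i) m x = c n i (x m) * c n (k - i) (x m) * exp (real k * W n m x)"
    by (simp add: d_def)
qed

text \<open>Over one step the integrating factor grows by exp \<theta>, while the loss multiplies
  the mass by 1 - \<theta> on average; the product is 1 up to order \<open>\<theta>\<^sup>2\<close>.
  The constants are sums over three error terms, 2 + 2 + 1 and 4 + 2 + 8.\<close>

lemma Z_step:
  assumes n: "2 \<le> n" and x: "x \<in> set_pmf (P n)" and m: "m < N n" and k: "1 \<le> k"
  shows "\<bar>Z n k (Suc m) x - Z n k m x\<bar> \<le> 5 * exp (2 * real k * T) / real n"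
    and "\<bar>measure_pmf.expectation (K n (x m)) (\<lambda>y. Z n k (Suc m) (x(Suc m := y))) - Z n k m x\<bar>
       \<le> 14 * real k * exp (2 * real k * T) / (real n)\<^sup>2"
proof -
  have abs3_minus: "\<bar>a + b - z\<bar> \<le> \<bar>a\<bar> + \<bar>b\<bar> + \<bar>z\<bar>" and abs3_plus: "\<bar>a + b + z\<bar> \<le> \<bar>a\<bar> + \<bar>b\<bar> + \<bar>z\<bar>"
    for a b z :: real by linarith+
  define M where "M = exp (2 * real k * T)"
  define e where "e = exp (real k * W n m x)"
  define \<theta> where "\<theta> = 2 * real k * w n (x m) / real n"
  define C where "C = (\<Sum>i\<le>k. c n i (x m) * c n (k - i) (x m))"
  have M: "0 < M" by (simp add: M_def)
  have w: "0 \<le> w n (x m)" "w n (x m) \<le> 1" using w_bounds [OF n x] m by auto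
  have C: "0 \<le> C" "C \<le> 1" using conv_nonneg [OF n x] conv_le_1 [OF n x] m by (auto simp: C_def)
  have e': "exp (real k * W n (Suc m) x) = e * exp \<theta>"
    by (simp add: W_Suc e_def \<theta>_def algebra_simps flip: exp_add)
  have eM: "e \<le> M" "e * exp \<theta> \<le> M" "0 < e"
  proof -
    show "e \<le> M" unfolding e_def M_def by (rule exp_W_le [OF n x]) (use m in simp)
    show "e * exp \<theta> \<le> M" unfolding e' [symmetric] M_def by (rule exp_W_le [OF n x]) (use m in simp)
    show "0 < e" by (simp add: e_def)
  qed
  have \<theta>: "0 \<le> \<theta>" "\<theta> \<le> 2 * real k / real n"
    unfolding \<theta>_def using w n mult_left_mono [OF w(2), of "real k"] by (auto intro!: divide_right_mono)
  have e\<theta>: "e * (exp \<theta> - 1) \<le> M * \<theta>"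
  proof -
    have "e * (exp \<theta> - 1) \<le> e * (\<theta> * exp \<theta>)"
      using eM by (intro mult_left_mono exp_minus_one_le) auto
    also have "\<dots> = (e * exp \<theta>) * \<theta>" by simp
    also have "\<dots> \<le> M * \<theta>" using eM \<theta> by (intro mult_right_mono) auto
    finally show ?thesis .
  qed
  have e\<theta>': "e * (exp \<theta> - 1) \<le> M * (2 * real k / real n)"
    using e\<theta> mult_left_mono [OF \<theta>(2), of M] M by linarith
  have e1: "0 \<le> e * (exp \<theta> - 1)" using eM \<theta> by simp
  have ck: "0 \<le> c n k (x m)" "c n k (x m) \<le> 1" using c_nonneg c_le_1 [OF n x] m by auto
  have upd: "d n i l (x(Suc m := y)) = d n i l x" if "l \<le> m" for i l y
    by (rule adaptedD [OF d_adapted]) (use that in auto)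
  have Zy: "Z n k (Suc m) (x(Suc m := y)) - Z n k m x
     = (c n k y * (e * exp \<theta>) - c n k (x m) * e) / real k - C * e / real n" for y
  proof -
    have "d n k (Suc m) (x(Suc m := y)) = c n k y * (e * exp \<theta>)"
      by (simp add: d_def W_upd e')
    moreover have "(\<Sum>l<Suc m. \<Sum>i\<le>k. d n i l (x(Suc m := y)) * d n (k - i) l (x(Suc m := y)))
       = (\<Sum>l<m. \<Sum>i\<le>k. d n i l x * d n (k - i) l x) + C * e"
      by (simp add: upd) (simp add: d_convolution C_def e_def)
    moreover have "d n k m x = c n k (x m) * e" by (simp add: d_def e_def)
    ultimately show ?thesis
      unfolding Z_def by (simp add: add_divide_distrib diff_divide_distrib)
  qed
  have "Z n k (Suc m) x - Z n k m x = (c n k (x (Suc m)) * (e * exp \<theta>) - c n k (x m) * e) / real k - C * e / real n"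
    using Zy [of "x (Suc m)"] by simp
  also have "\<dots> = (c n k (x (Suc m)) - c n k (x m)) * (e * exp \<theta>) / real k
      + c n k (x m) * (e * (exp \<theta> - 1)) / real k - C * e / real n"
    by (simp add: add_divide_distrib [symmetric] algebra_simps)
  also have "\<bar>\<dots>\<bar> \<le> \<bar>(c n k (x (Suc m)) - c n k (x m)) * (e * exp \<theta>) / real k\<bar>
      + \<bar>c n k (x m) * (e * (exp \<theta> - 1)) / real k\<bar> + \<bar>C * e / real n\<bar>" by (rule abs3_minus)
  also have "\<dots> \<le> 2 * M / real n + 2 * M / real n + M / real n"
  proof (intro add_mono)
    have "\<bar>c n k (x (Suc m)) - c n k (x m)\<bar> * (e * exp \<theta>) \<le> (2 * real k / real n) * M"
      using c_step [OF n path_good [OF n x] path_step [OF n x m]] eM by (intro mult_mono) auto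
    then have "\<bar>c n k (x (Suc m)) - c n k (x m)\<bar> * (e * exp \<theta>) / real k \<le> (2 * real k / real n) * M / real k"
      by (intro divide_right_mono) auto
    moreover have "\<bar>(c n k (x (Suc m)) - c n k (x m)) * (e * exp \<theta>) / real k\<bar>
        = \<bar>c n k (x (Suc m)) - c n k (x m)\<bar> * (e * exp \<theta>) / real k"
      using eM(3) by (simp add: abs_mult)
    moreover have "(2 * real k / real n) * M / real k = 2 * M / real n" using k by simp
    ultimately show "\<bar>(c n k (x (Suc m)) - c n k (x m)) * (e * exp \<theta>) / real k\<bar> \<le> 2 * M / real n"
      by (simp only:)
    have "c n k (x m) * (e * (exp \<theta> - 1)) \<le> 1 * (M * (2 * real k / real n))"
      by (intro mult_mono e\<theta>') (use ck e1 in auto)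
    then have "c n k (x m) * (e * (exp \<theta> - 1)) / real k \<le> 1 * (M * (2 * real k / real n)) / real k"
      by (intro divide_right_mono) auto
    moreover have "\<bar>c n k (x m) * (e * (exp \<theta> - 1)) / real k\<bar> = c n k (x m) * (e * (exp \<theta> - 1)) / real k"
      using mult_nonneg_nonneg [OF ck(1) e1] by (intro abs_of_nonneg divide_nonneg_nonneg) auto
    moreover have "1 * (M * (2 * real k / real n)) / real k = 2 * M / real n" using k by simp
    ultimately show "\<bar>c n k (x m) * (e * (exp \<theta> - 1)) / real k\<bar> \<le> 2 * M / real n"
      by (simp only:)
    have "C * e \<le> 1 * M" using C eM by (intro mult_mono) auto
    then show "\<bar>C * e / real n\<bar> \<le> M / real n" using C eM by (simp add: divide_right_mono)
  qed
  finally show "\<bar>Z n k (Suc m) x - Z n k m x\<bar> \<le> 5 * exp (2 * real k * T) / real n"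
    by (simp add: M_def)
  define c' where "c' = measure_pmf.expectation (K n (x m)) (c n k)"
  define r where "r = c' - c n k (x m) - real k / real n * (C - 2 * c n k (x m) * w n (x m))"
  have r: "\<bar>r\<bar> \<le> 8 * (real k)\<^sup>2 / (real n)\<^sup>2"
    using c_drift [OF n path_good [OF n x], of m k] by (simp add: r_def c'_def C_def w_def)
  note int = integrable_K [OF n path_good [OF n x, of m]]
  have "measure_pmf.expectation (K n (x m)) (\<lambda>y. Z n k (Suc m) (x(Suc m := y))) - Z n k m x
    = measure_pmf.expectation (K n (x m)) (\<lambda>y. Z n k (Suc m) (x(Suc m := y)) - Z n k m x)"
    by (simp add: Bochner_Integration.integral_diff int)
  also have "\<dots> = (c' * (e * exp \<theta>) - c n k (x m) * e) / real k - C * e / real n"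
    unfolding Zy c'_def by (simp add: Bochner_Integration.integral_diff int)
  \<comment> \<open>Inserting \<open>c' = c (1 - \<theta>) + k C / n + r\<close> separates the
    imperfect cancellation of the loss, the growth of the factor on the gain, and the remainder of
    the drift.\<close>
  also have "\<dots> = c n k (x m) / real k * (e * (exp \<theta> * (1 - \<theta>) - 1)) + C / real n * (e * (exp \<theta> - 1)) + (e * exp \<theta>) * r / real k"
  proof -
    have c': "c' = c n k (x m) * (1 - \<theta>) + real k / real n * C + r"
      by (simp add: r_def \<theta>_def algebra_simps)
    show ?thesis unfolding c' using k n by (simp add: add_divide_distrib diff_divide_distrib algebra_simps)
  qed
  also have "\<bar>\<dots>\<bar> \<le> \<bar>c n k (x m) / real k * (e * (exp \<theta> * (1 - \<theta>) - 1))\<bar> + \<bar>C / real n * (e * (exp \<theta> - 1))\<bar>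
      + \<bar>(e * exp \<theta>) * r / real k\<bar>" by (rule abs3_plus)
  also have "\<dots> \<le> 4 * real k * M / (real n)\<^sup>2 + 2 * real k * M / (real n)\<^sup>2 + 8 * real k * M / (real n)\<^sup>2"
  proof (intro add_mono)
    have le1: "exp \<theta> * (1 - \<theta>) \<le> 1"
      using exp_minus_one_le [of \<theta>] by (simp add: algebra_simps)
    \<comment> \<open>The polynomial 1 - \<theta> + \<open>\<theta>\<^sup>2\<close> is positive
      everywhere, so this derivation covers every \<theta> \<ge> 0, also those above 1 that occur
      when n is small compared with k.\<close>
    have "(1 + \<theta>) * (1 - \<theta>) \<le> exp \<theta> * (1 - \<theta>) + \<theta>\<^sup>2 * (exp \<theta> - 1)"
    proof -
      have "0 \<le> (exp \<theta> - 1 - \<theta>) * (1 - \<theta> + \<theta>\<^sup>2)"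
      proof (intro mult_nonneg_nonneg)
        show "0 \<le> exp \<theta> - 1 - \<theta>" using exp_ge_add_one_self [of \<theta>] by linarith
        have "0 \<le> (\<theta> - 1/2)\<^sup>2" by simp
        then show "0 \<le> 1 - \<theta> + \<theta>\<^sup>2" by (simp add: power2_eq_square algebra_simps)
      qed
      moreover have "0 \<le> \<theta>\<^sup>2 * \<theta>" using \<theta> by simp
      ultimately show ?thesis by (simp add: power2_eq_square algebra_simps)
    qed
    then have "1 - exp \<theta> * (1 - \<theta>) \<le> \<theta>\<^sup>2 * exp \<theta>" by (simp add: power2_eq_square algebra_simps)
    then have "e * (1 - exp \<theta> * (1 - \<theta>)) \<le> e * (\<theta>\<^sup>2 * exp \<theta>)" using eM by (intro mult_left_mono) auto
    also have "\<dots> = (e * exp \<theta>) * \<theta>\<^sup>2" by simp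
    also have "\<dots> \<le> M * (2 * real k / real n)\<^sup>2"
      using eM \<theta> by (intro mult_mono power_mono) auto
    finally have "e * (1 - exp \<theta> * (1 - \<theta>)) \<le> M * (2 * real k / real n)\<^sup>2" .
    moreover have "\<bar>e * (exp \<theta> * (1 - \<theta>) - 1)\<bar> = e * (1 - exp \<theta> * (1 - \<theta>))"
      using le1 eM by (simp add: abs_mult)
    moreover have "\<bar>c n k (x m) / real k\<bar> \<le> 1 / real k" using ck by (simp add: divide_right_mono)
    ultimately have "\<bar>c n k (x m) / real k\<bar> * \<bar>e * (exp \<theta> * (1 - \<theta>) - 1)\<bar> \<le> 1 / real k * (M * (2 * real k / real n)\<^sup>2)"
      by (intro mult_mono) auto
    also have "\<dots> = 4 * real k * M / (real n)\<^sup>2" using k by (simp add: power2_eq_square)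
    finally show "\<bar>c n k (x m) / real k * (e * (exp \<theta> * (1 - \<theta>) - 1))\<bar> \<le> 4 * real k * M / (real n)\<^sup>2"
      by (simp only: abs_mult)
    have "C / real n * (e * (exp \<theta> - 1)) \<le> 1 / real n * (M * (2 * real k / real n))"
      by (intro mult_mono e\<theta>') (use C e1 in \<open>auto intro!: divide_right_mono\<close>)
    moreover have "\<bar>C / real n * (e * (exp \<theta> - 1))\<bar> = C / real n * (e * (exp \<theta> - 1))"
      by (intro abs_of_nonneg mult_nonneg_nonneg [OF divide_nonneg_nonneg [OF C(1)] e1]) simp
    moreover have "1 / real n * (M * (2 * real k / real n)) = 2 * real k * M / (real n)\<^sup>2"
      by (simp add: power2_eq_square)
    ultimately show "\<bar>C / real n * (e * (exp \<theta> - 1))\<bar> \<le> 2 * real k * M / (real n)\<^sup>2"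
      by (simp only:)
    have "(e * exp \<theta>) * \<bar>r\<bar> \<le> M * (8 * (real k)\<^sup>2 / (real n)\<^sup>2)"
      using eM r M by (intro mult_mono) auto
    then have "(e * exp \<theta>) * \<bar>r\<bar> / real k \<le> M * (8 * (real k)\<^sup>2 / (real n)\<^sup>2) / real k"
      by (intro divide_right_mono) auto
    also have "\<dots> = 8 * real k * M / (real n)\<^sup>2" using k by (simp add: power2_eq_square)
    finally show "\<bar>(e * exp \<theta>) * r / real k\<bar> \<le> 8 * real k * M / (real n)\<^sup>2"
      using eM by (simp add: abs_mult)
  qed
  finally show "\<bar>measure_pmf.expectation (K n (x m)) (\<lambda>y. Z n k (Suc m) (x(Suc m := y))) - Z n k m x\<bar>
       \<le> 14 * real k * exp (2 * real k * T) / (real n)\<^sup>2"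
    by (simp add: M_def add_divide_distrib [symmetric])
qed

lemma unif_small_Z:
  assumes k: "1 \<le> k"
  shows "unif_small (\<lambda>n m. E n (\<lambda>x. \<bar>Z n k m x\<bar>))"
  unfolding unif_small_def
proof (intro allI impI)
  fix \<epsilon> :: real assume \<epsilon>: "0 < \<epsilon>"
  define M where "M = exp (2 * real k * T)"
  define B where "B = T * ((5 * M)\<^sup>2 + 2 * T * (5 * M) * (14 * real k * M))"
  have "(\<lambda>n. B / real n) \<longlonglongrightarrow> 0" by real_asymp
  then have "\<forall>\<^sub>F n in sequentially. B / real n < \<epsilon>\<^sup>2"
    by (rule order_tendstoD) (use \<epsilon> in simp)
  then show "\<forall>\<^sub>F n in sequentially. \<forall>m\<le>N n. E n (\<lambda>x. \<bar>Z n k m x\<bar>) \<le> \<epsilon>"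
    using eventually_ge_at_top [of 2]
  proof (eventually_elim, intro allI impI)
    fix n m assume Bn: "B / real n < \<epsilon>\<^sup>2" and n: "2 \<le> n" and m: "m \<le> N n"
    define a b where "a = 5 * M / real n" and "b = 14 * real k * M / (real n)\<^sup>2"
    have ab: "0 \<le> a" "0 \<le> b" by (auto simp: a_def b_def M_def)
    have "E n (\<lambda>x. (Z n k m x)\<^sup>2) \<le> real m * (a\<^sup>2 + 2 * real (N n) * a * b)"
    proof (rule approx_martingale [OF n])
      show "Z n k 0 x = 0" if "x \<in> set_pmf (P n)" for x
        using path_start [OF n that] by (auto simp: Z_def d_def c_start [OF n])
      show "\<bar>Z n k (Suc m) x - Z n k m x\<bar> \<le> a" if "x \<in> set_pmf (P n)" "m < N n" for x m
        unfolding a_def M_def by (rule Z_step(1) [OF n that k])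
      show "\<bar>measure_pmf.expectation (K n (x m)) (\<lambda>y. Z n k (Suc m) (x(Suc m := y))) - Z n k m x\<bar> \<le> b"
        if "x \<in> set_pmf (P n)" "m < N n" for x m
        unfolding b_def M_def by (rule Z_step(2) [OF n that k])
    qed (fact Z_adapted ab m)+
    also have "\<dots> \<le> (T * real n) * (a\<^sup>2 + 2 * (T * real n) * a * b)"
      using m N_le [of n] ab T by (intro mult_mono add_mono mult_right_mono mult_left_mono) auto
    also have "\<dots> = B / real n"
      using n by (simp add: a_def b_def B_def power2_eq_square field_simps)
    finally have "E n (\<lambda>x. (Z n k m x)\<^sup>2) \<le> \<epsilon>\<^sup>2" using Bn by simp
    then have "E n (\<lambda>x. (Z n k m x)\<^sup>2) / (2 * \<epsilon>) \<le> \<epsilon>\<^sup>2 / (2 * \<epsilon>)"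
      using \<epsilon> by (intro divide_right_mono) auto
    then show "E n (\<lambda>x. \<bar>Z n k m x\<bar>) \<le> \<epsilon>"
      using E_abs_le_square [OF n \<epsilon>, of "Z n k m"] \<epsilon> by (simp add: power2_eq_square)
  qed
qed

text \<open>Strong induction on k: since the masses of size 0 vanish, the convolution for size k
  involves smaller sizes only. No information on v or W enters apart from the bound on W.\<close>

lemma unif_small_d:
  "unif_small (\<lambda>n m. E n (\<lambda>x. \<bar>d n k m x - tree_power k (real m / real n)\<bar>))"
proof (induction k rule: less_induct)
  case (less k)
  show ?case
  proof (cases "k = 0")
    case True
    then show ?thesis by (simp add: unif_small_zero)
  next
    case False
    then have k: "1 \<le> k" by simp
    define \<delta> where "\<delta> i n m = E n (\<lambda>x. \<bar>d n i m x - tree_power i (real m / real n)\<bar>)" for i n m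
    obtain B where B: "0 \<le> B" "\<And>n m. 1 \<le> n \<Longrightarrow> real m / real n \<le> T \<Longrightarrow>
       \<bar>tree_power k (real m / real n) / real k - (if k = 1 then 1 else 0)
        - (\<Sum>l<m. \<Sum>i\<le>k. tree_power i (real l / real n) * tree_power (k - i) (real l / real n)) / real n\<bar> \<le> B / real n"
      using tree_power_integral [OF k, of T] by blast
    \<comment> \<open>Bounds the error of the product of sizes i and k - i; for i = 0 and i = k both
      products are 0.\<close>
    define H where "H i n m = (if 0 < i \<and> i < k
      then exp (2 * real (k - i) * T) * \<delta> i n m + tree_power i T * \<delta> (k - i) n m else 0)" for i n m
    have "unif_small (\<lambda>n m. real k * ((\<Sum>l<m. \<Sum>i\<le>k. H i n l) / real n + E n (\<lambda>x. \<bar>Z n k m x\<bar>) + B / real n))"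
    proof (intro unif_small_cmult unif_small_add unif_small_average unif_small_sum unif_small_Z [OF k] unif_small_rate)
      fix i assume "i \<in> {..k}"
      show "unif_small (H i)"
      proof (cases "0 < i \<and> i < k")
        case True
        then have "unif_small (\<delta> i)" "unif_small (\<delta> (k - i))"
          unfolding \<delta>_def using less [of i] less [of "k - i"] by auto
        moreover have "H i = (\<lambda>n m. exp (2 * real (k - i) * T) * \<delta> i n m + tree_power i T * \<delta> (k - i) n m)"
          using True by (auto simp: H_def fun_eq_iff)
        ultimately show ?thesis
          using T by (auto intro!: unif_small_add unif_small_cmult tree_power_nonneg)
      next
        case False
        then have "H i = (\<lambda>n m. 0)" by (auto simp: H_def fun_eq_iff)
        then show ?thesis by (simp add: unif_small_zero)
      qed
    qed auto
    then show ?thesis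
    proof (rule unif_small_mono)
      fix n m assume n: "2 \<le> n" and m: "m \<le> N n"
      define t where "t l = real l / real n" for l
      have tl: "0 \<le> t l" for l by (simp add: t_def)
      have pointwise: "\<bar>d n k m x - tree_power k (t m)\<bar>
         \<le> real k * ((\<Sum>l<m. \<Sum>i\<le>k. \<bar>d n i l x * d n (k - i) l x - tree_power i (t l) * tree_power (k - i) (t l)\<bar>) / real n
            + \<bar>Z n k m x\<bar> + B / real n)" for x
      proof -
        define s1 s2 where "s1 = (\<Sum>l<m. \<Sum>i\<le>k. d n i l x * d n (k - i) l x)"
          and "s2 = (\<Sum>l<m. \<Sum>i\<le>k. tree_power i (t l) * tree_power (k - i) (t l))"
        have b: "\<bar>tree_power k (t m) / real k - (if k = 1 then 1 else 0) - s2 / real n\<bar> \<le> B / real n"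
          unfolding s2_def t_def using n time_le [OF m] by (intro B(2)) auto
        have z: "d n k m x / real k = Z n k m x + (if k = 1 then 1 else 0) + s1 / real n"
          by (simp add: Z_def s1_def)
        have "\<bar>s1 / real n - s2 / real n\<bar> = \<bar>\<Sum>l<m. \<Sum>i\<le>k. d n i l x * d n (k - i) l x - tree_power i (t l) * tree_power (k - i) (t l)\<bar> / real n"
          by (simp add: s1_def s2_def sum_subtractf flip: diff_divide_distrib)
        also have "\<dots> \<le> (\<Sum>l<m. \<Sum>i\<le>k. \<bar>d n i l x * d n (k - i) l x - tree_power i (t l) * tree_power (k - i) (t l)\<bar>) / real n"
          by (intro divide_right_mono order_trans [OF sum_abs] sum_mono sum_abs) auto
        finally have "\<bar>d n k m x / real k - tree_power k (t m) / real k\<bar>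
          \<le> (\<Sum>l<m. \<Sum>i\<le>k. \<bar>d n i l x * d n (k - i) l x - tree_power i (t l) * tree_power (k - i) (t l)\<bar>) / real n
            + \<bar>Z n k m x\<bar> + B / real n"
          using b unfolding z by linarith
        from mult_left_mono [OF this, of "real k"] show ?thesis
          using k by (simp add: abs_mult [symmetric] diff_divide_distrib [symmetric])
      qed
      have prod: "E n (\<lambda>x. \<bar>d n i l x * d n (k - i) l x - tree_power i (t l) * tree_power (k - i) (t l)\<bar>) \<le> H i n l"
        if l: "l \<le> N n" and i: "i \<le> k" for i l
      proof (cases "0 < i \<and> i < k")
        case True
        have "E n (\<lambda>x. \<bar>d n i l x * d n (k - i) l x - tree_power i (t l) * tree_power (k - i) (t l)\<bar>)
          \<le> E n (\<lambda>x. exp (2 * real (k - i) * T) * \<bar>d n i l x - tree_power i (t l)\<bar>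
             + tree_power i T * \<bar>d n (k - i) l x - tree_power (k - i) (t l)\<bar>)"
        proof (rule E_mono [OF n])
          fix x assume x: "x \<in> set_pmf (P n)"
          have "d n i l x * d n (k - i) l x - tree_power i (t l) * tree_power (k - i) (t l)
            = d n (k - i) l x * (d n i l x - tree_power i (t l)) + tree_power i (t l) * (d n (k - i) l x - tree_power (k - i) (t l))"
            by (simp add: algebra_simps)
          also have "\<bar>\<dots>\<bar> \<le> \<bar>d n (k - i) l x\<bar> * \<bar>d n i l x - tree_power i (t l)\<bar>
             + \<bar>tree_power i (t l)\<bar> * \<bar>d n (k - i) l x - tree_power (k - i) (t l)\<bar>"
            unfolding abs_mult [symmetric] by (rule abs_triangle_ineq)
          also have "\<dots> \<le> exp (2 * real (k - i) * T) * \<bar>d n i l x - tree_power i (t l)\<bar>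
             + tree_power i T * \<bar>d n (k - i) l x - tree_power (k - i) (t l)\<bar>"
            using d_nonneg [OF n x] d_le [OF n x l, of "k - i"] tree_power_nonneg [OF tl]
              tree_power_mono [OF tl, of l T i] time_le [OF l]
            by (intro add_mono mult_right_mono) (auto simp: t_def)
          finally show "\<bar>d n i l x * d n (k - i) l x - tree_power i (t l) * tree_power (k - i) (t l)\<bar>
            \<le> exp (2 * real (k - i) * T) * \<bar>d n i l x - tree_power i (t l)\<bar>
             + tree_power i T * \<bar>d n (k - i) l x - tree_power (k - i) (t l)\<bar>" .
        qed
        also have "\<dots> = H i n l" using True by (simp add: H_def \<delta>_def E_add [OF n] t_def)
        finally show ?thesis .
      next
        case False
        then have "i = 0 \<or> i = k" using i by auto
        then show ?thesis by (auto simp: H_def)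
      qed
      have "E n (\<lambda>x. \<bar>d n k m x - tree_power k (t m)\<bar>) \<le> E n (\<lambda>x. real k *
         ((\<Sum>l<m. \<Sum>i\<le>k. \<bar>d n i l x * d n (k - i) l x - tree_power i (t l) * tree_power (k - i) (t l)\<bar>) / real n
            + \<bar>Z n k m x\<bar> + B / real n))"
        by (rule E_mono [OF n]) (rule pointwise)
      also have "\<dots> = real k *
         ((\<Sum>l<m. \<Sum>i\<le>k. E n (\<lambda>x. \<bar>d n i l x * d n (k - i) l x - tree_power i (t l) * tree_power (k - i) (t l)\<bar>)) / real n
            + E n (\<lambda>x. \<bar>Z n k m x\<bar>) + B / real n)"
        by (simp add: E_add [OF n] E_sum [OF n])
      also have "\<dots> \<le> real k * ((\<Sum>l<m. \<Sum>i\<le>k. H i n l) / real n + E n (\<lambda>x. \<bar>Z n k m x\<bar>) + B / real n)"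
        using m by (intro mult_left_mono add_mono divide_right_mono sum_mono prod) auto
      finally show "E n (\<lambda>x. \<bar>d n k m x - tree_power k (real m / real n)\<bar>)
        \<le> real k * ((\<Sum>l<m. \<Sum>i\<le>k. H i n l) / real n + E n (\<lambda>x. \<bar>Z n k m x\<bar>) + B / real n)"
        by (simp only: t_def)
    qed
  qed
qed

end

section \<open>Convergence of the integrated rate\<close>

context
  fixes p :: real
  assumes p: "0 < p" "p \<le> 1"
begin

lemma W_lim_bounds:
  assumes "0 \<le> t"
  shows "0 \<le> W_lim p t" "W_lim p t \<le> 2 * t"
proof -
  have "0 \<le> (1 - p) * v_lim p t" using p v_lim_bounds(1) [OF p, of t] by simp
  then have "0 \<le> 2 * t * (p + (1 - p) * v_lim p t)" using p assms by simp
  then show "0 \<le> W_lim p t" using W_lim_increment(1) [OF p assms] by (simp add: W_lim_0 [OF p])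
  show "W_lim p t \<le> 2 * t"
    using W_lim_increment(2) [OF p assms] by (simp add: W_lim_0 [OF p] v_lim_le_half [OF p])
qed

lemma c_lim_tree_power: "c_lim p k t = tree_power k t * exp (- real k * W_lim p t)"
  by (simp add: c_lim_eq [OF p] tree_power_def)

lemma c_lim_partial_sum_le:
  assumes "0 \<le> t"
  shows "(\<Sum>k\<le>L. c_lim p k t) \<le> v_lim p t"
proof -
  have "(\<Sum>k\<le>L. c_lim p k t) \<le> (\<Sum>k. c_lim p k t)"
    using c_lim_sums(1) [OF p assms] c_lim_nonneg [OF p assms] by (intro sum_le_suminf) (auto simp: sums_iff)
  then show ?thesis using c_lim_sums(1) [OF p assms] by (simp add: sums_iff)
qed

lemma c_lim_uniform_tail:
  assumes "0 < \<eta>"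
  shows "\<exists>L0. \<forall>L\<ge>L0. \<forall>t\<ge>0. v_lim p t - (\<Sum>k\<le>L. c_lim p k t) \<le> \<eta>"
proof -
  obtain L0 where L0: "\<And>t. 0 \<le> t \<Longrightarrow> v_lim p t - (\<Sum>k\<le>L0. c_lim p k t) \<le> \<eta>"
    using c_lim_tail [OF p assms] by blast
  show ?thesis
  proof (intro exI [of _ L0] allI impI)
    fix L t assume "L0 \<le> L" "0 \<le> (t::real)"
    then have "(\<Sum>k\<le>L0. c_lim p k t) \<le> (\<Sum>k\<le>L. c_lim p k t)"
      by (intro sum_mono2 c_lim_nonneg [OF p]) auto
    then show "v_lim p t - (\<Sum>k\<le>L. c_lim p k t) \<le> \<eta>" using L0 [OF \<open>0 \<le> t\<close>] by linarith
  qed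
qed

end

lemma exp_minus_lipschitz:
  fixes a b :: real
  assumes "0 \<le> a" "0 \<le> b"
  shows "\<bar>exp (- a) - exp (- b)\<bar> \<le> \<bar>a - b\<bar>"
proof -
  have "exp (- a) - exp (- b) \<le> b - a" if "0 \<le> a" "a \<le> b" for a b :: real
  proof -
    have "1 - (b - a) \<le> exp (- (b - a))" using exp_ge_add_one_self [of "- (b - a)"] by linarith
    then have "(1 - exp (- (b - a))) * exp (- a) \<le> (b - a) * 1"
      using that by (intro mult_mono) auto
    then show ?thesis by (simp add: left_diff_distrib flip: exp_add)
  qed
  from this [of a b] this [of b a] assms show ?thesis
    by (cases "a \<le> b") (auto simp: abs_le_iff)
qed

lemma uniformly_continuous_window:
  fixes f :: "real \<Rightarrow> real" and T :: real
  assumes "continuous_on {0..T} f" "0 < \<epsilon>"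
  obtains \<delta> where "0 < \<delta>" "\<And>s t. 0 \<le> s \<Longrightarrow> s \<le> T \<Longrightarrow> 0 \<le> t \<Longrightarrow> t \<le> T \<Longrightarrow> \<bar>s - t\<bar> \<le> \<delta> \<Longrightarrow> \<bar>f s - f t\<bar> < \<epsilon>"
proof -
  have "uniformly_continuous_on {0..T} f"
    by (rule compact_uniformly_continuous [OF assms(1)]) simp
  then obtain \<delta> where "0 < \<delta>" "\<And>s t. s \<in> {0..T} \<Longrightarrow> t \<in> {0..T} \<Longrightarrow> dist s t < \<delta> \<Longrightarrow> dist (f s) (f t) < \<epsilon>"
    using assms(2) unfolding uniformly_continuous_on_def by metis
  then show ?thesis by (intro that [of "\<delta> / 2"]) (auto simp: dist_real_def)
qed

lemma time_diff:
  assumes "l \<le> m" shows "\<bar>real m / real n - real l / real n\<bar> = real (m - l) / real n"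
  using assms by (simp add: of_nat_diff divide_right_mono flip: diff_divide_distrib)

lemma prob_mono_support:
  assumes "\<And>x. x \<in> set_pmf M \<Longrightarrow> x \<in> C \<Longrightarrow> x \<in> A"
  shows "measure_pmf.prob M C \<le> measure_pmf.prob M A"
proof -
  have "measure_pmf.prob M C = measure_pmf.prob M (C \<inter> set_pmf M)"
    by (simp add: measure_Int_set_pmf)
  also have "\<dots> \<le> measure_pmf.prob M A"
    using assms by (intro measure_pmf.finite_measure_mono) auto
  finally show ?thesis .
qed

lemma prob_le_union_bound:
  assumes "finite I" "\<And>x. x \<in> set_pmf M \<Longrightarrow> x \<in> C \<Longrightarrow> x \<in> A \<or> (\<exists>i\<in>I. x \<in> B i)"
  shows "measure_pmf.prob M C \<le> measure_pmf.prob M A + (\<Sum>i\<in>I. measure_pmf.prob M (B i))"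
proof -
  have "measure_pmf.prob M C \<le> measure_pmf.prob M (A \<union> (\<Union>i\<in>I. B i))"
    using assms(2) by (intro prob_mono_support) auto
  also have "\<dots> \<le> measure_pmf.prob M A + measure_pmf.prob M (\<Union>i\<in>I. B i)"
    by (intro measure_Un_le) auto
  also have "measure_pmf.prob M (\<Union>i\<in>I. B i) \<le> (\<Sum>i\<in>I. measure_pmf.prob M (B i))"
    using assms(1) by (intro measure_UNION_le) auto
  finally show ?thesis by simp
qed

context coagulation
begin

text \<open>Error of the integrated rate, the quantity for which a closed estimate is
  proved.\<close>

definition D :: "nat \<Rightarrow> nat \<Rightarrow> (nat \<Rightarrow> 's) \<Rightarrow> real" where
  "D n m x = W n m x - W_lim p (real m / real n)"

context
  fixes n :: nat and x :: "nat \<Rightarrow> 's"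
  assumes n: "2 \<le> n" and x: "x \<in> set_pmf (P n)"
begin

lemma D_bound: "m \<le> N n \<Longrightarrow> \<bar>D n m x\<bar> \<le> 2 * T"
  using W_nonneg [OF n x, of m] W_le [OF n x, of m] W_lim_bounds [OF p, of "real m / real n"] time_le [of m n]
  by (simp add: D_def abs_le_iff)

lemma v_minus_limit:
  assumes m: "m \<le> N n" and tail: "v_lim p t - (\<Sum>k\<le>L. c_lim p k t) \<le> \<eta>" and t: "0 \<le> t"
  shows "\<bar>v n (x m) - v_lim p t\<bar> \<le> \<bar>v n (x m) - u n L (x m)\<bar> + (\<Sum>k\<le>L. \<bar>c n k (x m) - c_lim p k t\<bar>) + \<eta>"
proof -
  have "u n L (x m) - (\<Sum>k\<le>L. c_lim p k t) = (\<Sum>k\<le>L. c n k (x m) - c_lim p k t)"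
    by (simp add: u_def sum_subtractf)
  then have "\<bar>u n L (x m) - (\<Sum>k\<le>L. c_lim p k t)\<bar> \<le> (\<Sum>k\<le>L. \<bar>c n k (x m) - c_lim p k t\<bar>)"
    by (simp only: sum_abs)
  then show ?thesis using tail c_lim_partial_sum_le [OF p t, of L] by linarith
qed

text \<open>Since \<open>exp (- k W)\<close> is decreasing in \<open>W\<close>, the equation for the difference \<open>D\<close> of the
  integrated rates is dissipative, which makes up for the lack of a Lipschitz bound after the critical time.\<close>

lemma D_dissipative:
  assumes m: "m \<le> N n" and tail: "\<And>t. 0 \<le> t \<Longrightarrow> v_lim p t - (\<Sum>k\<le>L. c_lim p k t) \<le> \<eta>"
  defines "t \<equiv> real m / real n"
  shows "D n m x * (v n (x m) - v_lim p t)
    \<le> 2 * T * (\<bar>v n (x m) - u n L (x m)\<bar> + (\<Sum>k\<le>L. \<bar>d n k m x - tree_power k t\<bar>) + \<eta>)"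
proof -
  have t: "0 \<le> t" by (simp add: t_def)
  \<comment> \<open>The limit polynomials evaluated at the random \<open>W\<close>. Comparing with
    \<open>s'\<close>, at the true \<open>W_lim\<close>, isolates the part of the deviation whose
    sign is opposite to that of \<open>D\<close>.\<close>
  define s where "s = (\<Sum>k\<le>L. tree_power k t * exp (- real k * W n m x))"
  define s' where "s' = (\<Sum>k\<le>L. c_lim p k t)"
  have us: "\<bar>u n L (x m) - s\<bar> \<le> (\<Sum>k\<le>L. \<bar>d n k m x - tree_power k t\<bar>)"
  proof -
    have "u n L (x m) - s = (\<Sum>k\<le>L. c n k (x m) - tree_power k t * exp (- real k * W n m x))"
      by (simp add: u_def s_def sum_subtractf)
    also have "\<bar>\<dots>\<bar> \<le> (\<Sum>k\<le>L. \<bar>d n k m x - tree_power k t\<bar>)"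
      by (intro order_trans [OF sum_abs] sum_mono c_minus_limit [OF n x m])
    finally show ?thesis .
  qed
  have "D n m x * (s - s') = (\<Sum>k\<le>L. tree_power k t * (D n m x * (exp (- real k * W n m x) - exp (- real k * W_lim p t))))"
    unfolding s_def s'_def c_lim_tree_power [OF p] by (simp add: sum_subtractf [symmetric] sum_distrib_left algebra_simps)
  also have "\<dots> \<le> 0"
  proof (intro sum_nonpos mult_nonneg_nonpos [OF tree_power_nonneg [OF t]])
    fix k
    show "D n m x * (exp (- real k * W n m x) - exp (- real k * W_lim p t)) \<le> 0"
    proof (cases "W n m x \<le> W_lim p t")
      case True
      then have "D n m x \<le> 0" by (simp add: D_def t_def)
      moreover have "exp (- real k * W_lim p t) \<le> exp (- real k * W n m x)"
        using mult_left_mono [OF True, of "real k"] by simp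
      ultimately show ?thesis by (intro mult_nonpos_nonneg) auto
    next
      case False
      then have "D n m x \<ge> 0" by (simp add: D_def t_def)
      moreover have "exp (- real k * W_lim p t) \<ge> exp (- real k * W n m x)"
        using mult_left_mono [of "W_lim p t" "W n m x" "real k"] False by simp
      ultimately show ?thesis by (intro mult_nonneg_nonpos) auto
    qed
  qed
  finally have D0: "D n m x * (s - s') \<le> 0" .
  have vs: "\<bar>s' - v_lim p t\<bar> \<le> \<eta>"
    using tail [OF t] c_lim_partial_sum_le [OF p t, of L] by (simp add: s'_def)
  have "D n m x * (v n (x m) - v_lim p t)
    = D n m x * ((v n (x m) - u n L (x m)) + (u n L (x m) - s) + (s' - v_lim p t)) + D n m x * (s - s')"
    by (simp add: algebra_simps)
  also have "\<dots> \<le> \<bar>D n m x\<bar> * \<bar>(v n (x m) - u n L (x m)) + (u n L (x m) - s) + (s' - v_lim p t)\<bar>"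
    using D0 abs_ge_self [of "D n m x * ((v n (x m) - u n L (x m)) + (u n L (x m) - s) + (s' - v_lim p t))"]
    unfolding abs_mult by linarith
  also have "\<dots> \<le> 2 * T * (\<bar>v n (x m) - u n L (x m)\<bar> + (\<Sum>k\<le>L. \<bar>d n k m x - tree_power k t\<bar>) + \<eta>)"
    using us vs T by (intro mult_mono D_bound m) auto
  finally show ?thesis .
qed

text \<open>Energy estimate: in the increment of the square of \<open>D\<close>, the term with v -
  v_lim is controlled by dissipativity, the discretisation of the limit equation by monotonicity of
  v_lim, and the squared increments sum to O(1 / n). So no Gronwall argument is involved.\<close>

lemma D_square_le:
  assumes m: "m \<le> N n" and tail: "\<And>t. 0 \<le> t \<Longrightarrow> v_lim p t - (\<Sum>k\<le>L. c_lim p k t) \<le> \<eta>"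
  shows "(D n m x)\<^sup>2 \<le> 8 * T * ((\<Sum>l<m. \<bar>v n (x l) - u n L (x l)\<bar>
      + (\<Sum>k\<le>L. \<bar>d n k l x - tree_power k (real l / real n)\<bar>) + \<eta>) / real n) + 12 * T / real n"
proof -
  define X where "X l = \<bar>v n (x l) - u n L (x l)\<bar>
      + (\<Sum>k\<le>L. \<bar>d n k l x - tree_power k (real l / real n)\<bar>) + \<eta>" for l
  define vh where "vh l = v_lim p (real l / real n)" for l
  \<comment> \<open>The middle term absorbs the discretisation errors, which telescope along the
    decreasing values \<open>vh\<close>.\<close>
  have "(D n m x)\<^sup>2 \<le> 8 * T / real n * (\<Sum>l<m. X l) + 8 * T / real n * (1 - vh m) + real m * (4 / (real n)\<^sup>2)"
    using m
  proof (induction m)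
    case 0
    then show ?case by (simp add: D_def W_lim_0 [OF p] vh_def v_lim_le_half [OF p])
  next
    case (Suc l)
    define a b where "a = real l / real n" and "b = real (Suc l) / real n"
    have l: "l \<le> N n" and ab: "a \<le> b" "b - a = 1 / real n"
      using Suc n by (auto simp: a_def b_def divide_right_mono add_divide_distrib)
    have vb: "vh (Suc l) \<le> vh l" "0 \<le> vh (Suc l)" "vh l \<le> 1"
      using v_lim_antimono [OF p ab(1)] v_lim_bounds [OF p] by (auto simp: vh_def a_def b_def less_imp_le)
    define \<Delta> where "\<Delta> = D n (Suc l) x - D n l x"
    \<comment> \<open>Error of the left Riemann sum for the increment of \<open>W_lim\<close> over
      one step, at most the decrease of the rate over that step.\<close>
    define e where "e = 2 / real n * (p + (1 - p) * vh l) - (W_lim p b - W_lim p a)"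
    have W: "2 / real n * (p + (1 - p) * vh (Suc l)) \<le> W_lim p b - W_lim p a"
        "W_lim p b - W_lim p a \<le> 2 / real n * (p + (1 - p) * vh l)"
      using W_lim_increment [OF p ab(1)] unfolding ab(2) by (auto simp: vh_def a_def b_def)
    have e: "0 \<le> e" "e \<le> 2 / real n * (vh l - vh (Suc l))"
    proof -
      show "0 \<le> e" using W(2) by (simp add: e_def)
      have "e \<le> 2 / real n * (p + (1 - p) * vh l) - 2 / real n * (p + (1 - p) * vh (Suc l))"
        using W(1) by (simp add: e_def)
      also have "\<dots> = 2 / real n * ((1 - p) * (vh l - vh (Suc l)))" by (simp add: algebra_simps add_divide_distrib)
      also have "\<dots> \<le> 2 / real n * (1 * (vh l - vh (Suc l)))"
        using p vb by (intro mult_left_mono mult_right_mono) auto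
      finally show "e \<le> 2 / real n * (vh l - vh (Suc l))" by simp
    qed
    have \<Delta>: "\<Delta> = 2 / real n * ((1 - p) * (v n (x l) - vh l)) + e"
      by (simp add: \<Delta>_def D_def W_Suc e_def w_def a_def b_def algebra_simps add_divide_distrib diff_divide_distrib)
    have "\<bar>\<Delta>\<bar> \<le> 2 / real n"
    proof -
      have 1: "0 \<le> 2 * w n (x l) / real n" "2 * w n (x l) / real n \<le> 2 / real n"
        using w_bounds [OF n x l] by (auto intro!: divide_right_mono)
      have "0 \<le> 2 / real n * (p + (1 - p) * vh (Suc l))" using p vb by simp
      moreover have "(1 - p) * vh l \<le> (1 - p) * 1" using p vb by (intro mult_left_mono) auto
      then have "2 / real n * (p + (1 - p) * vh l) \<le> 2 / real n * 1" by (intro mult_left_mono) auto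
      moreover have "\<Delta> = 2 * w n (x l) / real n - (W_lim p b - W_lim p a)"
        by (simp add: \<Delta>_def D_def W_Suc a_def b_def)
      ultimately show ?thesis using 1 W by (simp add: abs_le_iff)
    qed
    then have \<Delta>2: "\<Delta>\<^sup>2 \<le> 4 / (real n)\<^sup>2"
      using power_mono [of "\<bar>\<Delta>\<bar>" "2 / real n" 2] by (simp add: power_divide)
    have X: "D n l x * (v n (x l) - vh l) \<le> 2 * T * X l" "0 \<le> 2 * T * X l"
    proof -
      show "D n l x * (v n (x l) - vh l) \<le> 2 * T * X l"
        unfolding X_def vh_def by (rule D_dissipative [OF l tail])
      have "0 \<le> \<eta>" using tail [of 0] c_lim_partial_sum_le [OF p, of 0 L] by simp
      then show "0 \<le> 2 * T * X l" using T by (simp add: X_def sum_nonneg)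
    qed
    have X': "(1 - p) * (D n l x * (v n (x l) - vh l)) \<le> 2 * T * X l"
    proof -
      have "(1 - p) * (D n l x * (v n (x l) - vh l)) \<le> (1 - p) * (2 * T * X l)"
        using X p by (intro mult_left_mono) auto
      also have "\<dots> \<le> 1 * (2 * T * X l)" using X p by (intro mult_right_mono) auto
      finally show ?thesis by simp
    qed
    have De: "D n l x * e \<le> 2 * T * (2 / real n * (vh l - vh (Suc l)))"
    proof -
      have "D n l x * e \<le> \<bar>D n l x\<bar> * e" using e by (intro mult_right_mono) auto
      also have "\<dots> \<le> 2 * T * (2 / real n * (vh l - vh (Suc l)))"
        using e T D_bound [OF l] by (intro mult_mono) auto
      finally show ?thesis .
    qed
    have "(D n (Suc l) x)\<^sup>2 = (D n l x)\<^sup>2 + 2 * (D n l x * \<Delta>) + \<Delta>\<^sup>2"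
      by (simp add: \<Delta>_def power2_eq_square algebra_simps)
    also have "D n l x * \<Delta> = 2 / real n * ((1 - p) * (D n l x * (v n (x l) - vh l))) + D n l x * e"
      unfolding \<Delta> by (simp add: algebra_simps)
    also have "(D n l x)\<^sup>2 + 2 * (2 / real n * ((1 - p) * (D n l x * (v n (x l) - vh l))) + D n l x * e) + \<Delta>\<^sup>2
      \<le> (8 * T / real n * (\<Sum>l<l. X l) + 8 * T / real n * (1 - vh l) + real l * (4 / (real n)\<^sup>2))
        + 2 * (2 / real n * (2 * T * X l) + 2 * T * (2 / real n * (vh l - vh (Suc l)))) + 4 / (real n)\<^sup>2"
      using Suc.IH l X' by (intro add_mono mult_left_mono De \<Delta>2) auto
    also have "\<dots> = 8 * T / real n * (\<Sum>l<Suc l. X l) + 8 * T / real n * (1 - vh (Suc l)) + real (Suc l) * (4 / (real n)\<^sup>2)"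
      by (simp add: algebra_simps add_divide_distrib diff_divide_distrib)
    finally show ?case .
  qed
  also have "\<dots> \<le> 8 * T / real n * (\<Sum>l<m. X l) + 8 * T / real n * 1 + 4 * T / real n"
  proof (intro add_mono mult_left_mono)
    show "1 - vh m \<le> 1" using v_lim_bounds(1) [OF p] by (simp add: vh_def less_imp_le)
    have "real m * (4 / (real n)\<^sup>2) = real m / real n * (4 / real n)" by (simp add: power2_eq_square)
    also have "\<dots> \<le> T * (4 / real n)" using time_le [OF m] by (intro mult_right_mono) auto
    finally show "real m * (4 / (real n)\<^sup>2) \<le> 4 * T / real n" by (simp add: mult.commute)
  qed (use T in auto)
  also have "\<dots> = 8 * T * ((\<Sum>l<m. X l) / real n) + 12 * T / real n"
    by (simp add: add_divide_distrib [symmetric])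
  finally show ?thesis unfolding X_def .
qed

end

lemma unif_small_D_square: "unif_small (\<lambda>n m. E n (\<lambda>x. (D n m x)\<^sup>2))"
  unfolding unif_small_def
proof (intro allI impI)
  fix \<epsilon> :: real assume \<epsilon>: "0 < \<epsilon>"
  \<comment> \<open>Three contributions of \<epsilon> / 4 each: the tail of the limit masses through
    \<eta>, the missing mass through \<mu> below, and the remainder \<open>R\<close>.\<close>
  define \<eta> where "\<eta> = \<epsilon> / (32 * T\<^sup>2)"
  have \<eta>: "0 < \<eta>" "\<eta> * (8 * T * T) = \<epsilon> / 4" using \<epsilon> T by (auto simp: \<eta>_def power2_eq_square)
  define \<mu> where "\<mu> = \<epsilon> / (32 * T)"
  have \<mu>: "0 < \<mu>" "8 * T * \<mu> = \<epsilon> / 4" using \<epsilon> T by (auto simp: \<mu>_def)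
  obtain L1 where L1: "\<And>L t. L1 \<le> L \<Longrightarrow> 0 \<le> t \<Longrightarrow> v_lim p t - (\<Sum>k\<le>L. c_lim p k t) \<le> \<eta>"
    using c_lim_uniform_tail [OF p \<eta>(1)] by blast
  obtain L2 where L2: "\<And>L. L2 \<le> L \<Longrightarrow>
      \<forall>\<^sub>F n in sequentially. (\<Sum>m<N n. E n (\<lambda>x. \<bar>v n (x m) - u n L (x m)\<bar>)) / real n \<le> \<mu>"
    using mass_conservation [OF \<mu>(1)] by blast
  define L where "L = max L1 L2"
  have tail: "v_lim p t - (\<Sum>k\<le>L. c_lim p k t) \<le> \<eta>" if "0 \<le> t" for t
    using L1 [of L t] that by (simp add: L_def)
  define R where "R n m = 8 * T * (\<Sum>k\<le>L. (\<Sum>l<m. E n (\<lambda>x. \<bar>d n k l x - tree_power k (real l / real n)\<bar>)) / real n) + 12 * T / real n" for n m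
  have "unif_small R"
    unfolding R_def [abs_def] using T
    by (intro unif_small_add unif_small_cmult unif_small_sum unif_small_average unif_small_d unif_small_rate) auto
  from unif_smallD [OF this, of "\<epsilon> / 4"] \<epsilon>
  have "\<forall>\<^sub>F n in sequentially. \<forall>m\<le>N n. R n m \<le> \<epsilon> / 4" by simp
  moreover have "\<forall>\<^sub>F n in sequentially. (\<Sum>m<N n. E n (\<lambda>x. \<bar>v n (x m) - u n L (x m)\<bar>)) / real n \<le> \<mu>"
    by (rule L2) (simp add: L_def)
  ultimately show "\<forall>\<^sub>F n in sequentially. \<forall>m\<le>N n. E n (\<lambda>x. (D n m x)\<^sup>2) \<le> \<epsilon>"
    using eventually_ge_at_top [of 2]
  proof (eventually_elim, intro allI impI)
    fix n m assume R: "\<forall>m\<le>N n. R n m \<le> \<epsilon> / 4" and n: "2 \<le> n" and m: "m \<le> N n"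
      and mass: "(\<Sum>m<N n. E n (\<lambda>x. \<bar>v n (x m) - u n L (x m)\<bar>)) / real n \<le> \<mu>"
    have "E n (\<lambda>x. (D n m x)\<^sup>2) \<le> E n (\<lambda>x. 8 * T * ((\<Sum>l<m. \<bar>v n (x l) - u n L (x l)\<bar>
      + (\<Sum>k\<le>L. \<bar>d n k l x - tree_power k (real l / real n)\<bar>) + \<eta>) / real n) + 12 * T / real n)"
      by (intro E_mono [OF n] D_square_le n m tail)
    also have "\<dots> = 8 * T * ((\<Sum>l<m. E n (\<lambda>x. \<bar>v n (x l) - u n L (x l)\<bar>)
      + (\<Sum>k\<le>L. E n (\<lambda>x. \<bar>d n k l x - tree_power k (real l / real n)\<bar>)) + \<eta>) / real n) + 12 * T / real n"
      by (simp add: E_add [OF n] E_sum [OF n])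
    also have "\<dots> = 8 * T * ((\<Sum>l<m. E n (\<lambda>x. \<bar>v n (x l) - u n L (x l)\<bar>)) / real n)
        + 8 * T * (real m / real n * \<eta>) + R n m"
    proof -
      have "(\<Sum>l<m. \<Sum>k\<le>L. E n (\<lambda>x. \<bar>d n k l x - tree_power k (real l / real n)\<bar>)) / real n
        = (\<Sum>k\<le>L. (\<Sum>l<m. E n (\<lambda>x. \<bar>d n k l x - tree_power k (real l / real n)\<bar>)) / real n)"
        by (subst sum.swap) (simp add: sum_divide_distrib)
      then show ?thesis
        by (simp add: R_def sum.distrib add_divide_distrib distrib_left)
    qed
    also have "\<dots> \<le> 8 * T * \<mu> + 8 * T * (T * \<eta>) + \<epsilon> / 4"
    proof (intro add_mono mult_left_mono mult_right_mono)
      have "(\<Sum>l<m. E n (\<lambda>x. \<bar>v n (x l) - u n L (x l)\<bar>)) \<le> (\<Sum>l<N n. E n (\<lambda>x. \<bar>v n (x l) - u n L (x l)\<bar>))"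
        using m by (intro sum_mono2) auto
      then show "(\<Sum>l<m. E n (\<lambda>x. \<bar>v n (x l) - u n L (x l)\<bar>)) / real n \<le> \<mu>"
        using mass by (meson divide_right_mono of_nat_0_le_iff order_trans)
    qed (use time_le [OF m] \<eta> T R m in auto)
    also have "\<dots> \<le> \<epsilon>" using \<mu> \<eta> \<epsilon> by (simp add: mult_ac)
    finally show "E n (\<lambda>x. (D n m x)\<^sup>2) \<le> \<epsilon>" .
  qed
qed

lemma unif_small_D: "unif_small (\<lambda>n m. E n (\<lambda>x. \<bar>D n m x\<bar>))"
  unfolding unif_small_def
proof (intro allI impI)
  fix \<epsilon> :: real assume \<epsilon>: "0 < \<epsilon>"
  then have "0 < \<epsilon>\<^sup>2" by simp
  from unif_smallD [OF unif_small_D_square this] eventually_ge_at_top [of 2]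
  show "\<forall>\<^sub>F n in sequentially. \<forall>m\<le>N n. E n (\<lambda>x. \<bar>D n m x\<bar>) \<le> \<epsilon>"
  proof (eventually_elim, intro allI impI)
    fix n m assume sq: "\<forall>m\<le>N n. E n (\<lambda>x. (D n m x)\<^sup>2) \<le> \<epsilon>\<^sup>2" and n: "2 \<le> n" and m: "m \<le> N n"
    have "E n (\<lambda>x. (D n m x)\<^sup>2) / (2 * \<epsilon>) \<le> \<epsilon>\<^sup>2 / (2 * \<epsilon>)"
      using \<epsilon> sq m by (intro divide_right_mono) auto
    then show "E n (\<lambda>x. \<bar>D n m x\<bar>) \<le> \<epsilon>"
      using E_abs_le_square [OF n \<epsilon>, of "D n m"] \<epsilon> by (simp add: power2_eq_square)
  qed
qed

lemma unif_small_c: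
  "unif_small (\<lambda>n m. E n (\<lambda>x. \<bar>c n k (x m) - c_lim p k (real m / real n)\<bar>))"
proof (rule unif_small_mono)
  show "unif_small (\<lambda>n m. E n (\<lambda>x. \<bar>d n k m x - tree_power k (real m / real n)\<bar>)
      + tree_power k T * real k * E n (\<lambda>x. \<bar>D n m x\<bar>))"
    using T by (intro unif_small_add unif_small_cmult unif_small_d unif_small_D mult_nonneg_nonneg tree_power_nonneg) auto
  fix n m assume n: "2 \<le> n" and m: "m \<le> N n"
  define t where "t = real m / real n"
  have t: "0 \<le> t" "t \<le> T" using time_le [OF m] by (auto simp: t_def)
  have "E n (\<lambda>x. \<bar>c n k (x m) - c_lim p k t\<bar>)
    \<le> E n (\<lambda>x. \<bar>d n k m x - tree_power k t\<bar> + tree_power k T * real k * \<bar>D n m x\<bar>)"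
  proof (rule E_mono [OF n])
    fix x assume x: "x \<in> set_pmf (P n)"
    have "\<bar>tree_power k t * exp (- real k * W n m x) - c_lim p k t\<bar>
      = tree_power k t * \<bar>exp (- (real k * W n m x)) - exp (- (real k * W_lim p t))\<bar>"
      using tree_power_nonneg [OF t(1), of k]
      by (simp add: c_lim_tree_power [OF p] abs_mult flip: right_diff_distrib)
    also have "\<dots> \<le> tree_power k T * \<bar>real k * W n m x - real k * W_lim p t\<bar>"
      using W_nonneg [OF n x m] W_lim_bounds(1) [OF p t(1)] tree_power_nonneg [of T k] T
      by (intro mult_mono exp_minus_lipschitz tree_power_mono t) auto
    also have "\<dots> = tree_power k T * real k * \<bar>D n m x\<bar>"
      by (simp add: D_def t_def abs_mult flip: right_diff_distrib)
    finally show "\<bar>c n k (x m) - c_lim p k t\<bar> \<le> \<bar>d n k m x - tree_power k t\<bar> + tree_power k T * real k * \<bar>D n m x\<bar>"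
      using c_minus_limit [OF n x m, of k t] by linarith
  qed
  then show "E n (\<lambda>x. \<bar>c n k (x m) - c_lim p k (real m / real n)\<bar>)
    \<le> E n (\<lambda>x. \<bar>d n k m x - tree_power k (real m / real n)\<bar>) + tree_power k T * real k * E n (\<lambda>x. \<bar>D n m x\<bar>)"
    by (simp add: E_add [OF n] t_def)
qed

text \<open>The loss of mass to large trees is controlled only in time average, hence so is v at
  this stage.\<close>

lemma average_v_small:
  assumes \<epsilon>: "0 < \<epsilon>"
  shows "\<forall>\<^sub>F n in sequentially. (\<Sum>m<N n. E n (\<lambda>x. \<bar>v n (x m) - v_lim p (real m / real n)\<bar>)) / real n \<le> \<epsilon>"
proof -
  define \<eta> where "\<eta> = \<epsilon> / (3 * T)"
  have \<eta>: "0 < \<eta>" "T * \<eta> = \<epsilon> / 3" using \<epsilon> T by (auto simp: \<eta>_def)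
  obtain L1 where L1: "\<And>L t. L1 \<le> L \<Longrightarrow> 0 \<le> t \<Longrightarrow> v_lim p t - (\<Sum>k\<le>L. c_lim p k t) \<le> \<eta>"
    using c_lim_uniform_tail [OF p \<eta>(1)] by blast
  obtain L2 where L2: "\<And>L. L2 \<le> L \<Longrightarrow>
      \<forall>\<^sub>F n in sequentially. (\<Sum>m<N n. E n (\<lambda>x. \<bar>v n (x m) - u n L (x m)\<bar>)) / real n \<le> \<epsilon> / 3"
    using mass_conservation [of "\<epsilon> / 3"] \<epsilon> by auto
  define L where "L = max L1 L2"
  have tail: "v_lim p t - (\<Sum>k\<le>L. c_lim p k t) \<le> \<eta>" if "0 \<le> t" for t
    using L1 [of L t] that by (simp add: L_def)
  have "unif_small (\<lambda>n m. (\<Sum>l<m. \<Sum>k\<le>L. E n (\<lambda>x. \<bar>c n k (x l) - c_lim p k (real l / real n)\<bar>)) / real n)"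
    by (intro unif_small_average unif_small_sum unif_small_c) auto
  from unif_smallD [OF this, of "\<epsilon> / 3"] \<epsilon>
  have "\<forall>\<^sub>F n in sequentially. \<forall>m\<le>N n.
    (\<Sum>l<m. \<Sum>k\<le>L. E n (\<lambda>x. \<bar>c n k (x l) - c_lim p k (real l / real n)\<bar>)) / real n \<le> \<epsilon> / 3" by simp
  moreover have "\<forall>\<^sub>F n in sequentially. (\<Sum>m<N n. E n (\<lambda>x. \<bar>v n (x m) - u n L (x m)\<bar>)) / real n \<le> \<epsilon> / 3"
    by (rule L2) (simp add: L_def)
  ultimately show ?thesis
    using eventually_ge_at_top [of 2]
  proof eventually_elim
    case (elim n)
    then have n: "2 \<le> n" by simp
    have "(\<Sum>m<N n. E n (\<lambda>x. \<bar>v n (x m) - v_lim p (real m / real n)\<bar>))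
      \<le> (\<Sum>m<N n. E n (\<lambda>x. \<bar>v n (x m) - u n L (x m)\<bar>
           + (\<Sum>k\<le>L. \<bar>c n k (x m) - c_lim p k (real m / real n)\<bar>) + \<eta>))"
      by (intro sum_mono E_mono [OF n] v_minus_limit n tail) auto
    also have "\<dots> = (\<Sum>m<N n. E n (\<lambda>x. \<bar>v n (x m) - u n L (x m)\<bar>)
           + (\<Sum>k\<le>L. E n (\<lambda>x. \<bar>c n k (x m) - c_lim p k (real m / real n)\<bar>)) + \<eta>)"
      by (simp add: E_add [OF n] E_sum [OF n])
    finally have "(\<Sum>m<N n. E n (\<lambda>x. \<bar>v n (x m) - v_lim p (real m / real n)\<bar>)) / real n
      \<le> (\<Sum>m<N n. E n (\<lambda>x. \<bar>v n (x m) - u n L (x m)\<bar>)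
           + (\<Sum>k\<le>L. E n (\<lambda>x. \<bar>c n k (x m) - c_lim p k (real m / real n)\<bar>)) + \<eta>) / real n"
      by (intro divide_right_mono) auto
    also have "\<dots> = (\<Sum>m<N n. E n (\<lambda>x. \<bar>v n (x m) - u n L (x m)\<bar>)) / real n
           + (\<Sum>m<N n. \<Sum>k\<le>L. E n (\<lambda>x. \<bar>c n k (x m) - c_lim p k (real m / real n)\<bar>)) / real n
           + real (N n) / real n * \<eta>"
      by (simp add: sum.distrib add_divide_distrib)
    also have "\<dots> \<le> \<epsilon> / 3 + \<epsilon> / 3 + T * \<eta>"
      using elim time_le [of "N n" n] \<eta> by (intro add_mono mult_right_mono) auto
    finally show ?case using \<eta> by simp
  qed
qed

text \<open>A deviation at one time persists over a whole macroscopic time window, so that smallness of the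
  time average suffices for uniform convergence.\<close>

lemma window_prob:
  fixes \<Phi> :: "nat \<Rightarrow> nat \<Rightarrow> (nat \<Rightarrow> 's) \<Rightarrow> real"
  assumes \<epsilon>: "0 < \<epsilon>" and \<delta>: "0 < \<delta>"
    and nonneg: "\<And>n m x. 0 \<le> \<Phi> n m x"
    and start: "\<And>n x. 2 \<le> n \<Longrightarrow> x \<in> set_pmf (P n) \<Longrightarrow> \<Phi> n 0 x = 0"
    and window: "\<And>n x m l. 2 \<le> n \<Longrightarrow> x \<in> set_pmf (P n) \<Longrightarrow> m \<le> N n \<Longrightarrow> \<epsilon> < \<Phi> n m x \<Longrightarrow> l \<le> m \<Longrightarrow>
        real (m - l) / real n \<le> \<delta> \<Longrightarrow> \<epsilon> / 2 < \<Phi> n l x"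
    and average: "\<And>r. 0 < r \<Longrightarrow> \<forall>\<^sub>F n in sequentially. (\<Sum>l<N n. E n (\<Phi> n l)) / real n \<le> r"
  shows "(\<lambda>n. measure_pmf.prob (P n) {x. \<exists>m\<le>N n. \<epsilon> < \<Phi> n m x}) \<longlonglongrightarrow> 0"
proof (rule tendstoI)
  fix r :: real assume r: "0 < r"
  \<comment> \<open>A deviation forces at least \<delta> n / 2 steps with value above \<epsilon> /
    2, hence a time average of at least \<delta> \<epsilon> / 4.\<close>
  define a where "a = \<delta> * \<epsilon> / 4"
  have a: "0 < a" using \<epsilon> \<delta> by (simp add: a_def)
  have "\<forall>\<^sub>F n in sequentially. 2 / \<delta> \<le> real n"
    using filterlim_real_sequentially by (simp add: filterlim_at_top)
  moreover have "\<forall>\<^sub>F n in sequentially. (\<Sum>l<N n. E n (\<Phi> n l)) / real n \<le> r / 2 * a"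
    using r a by (intro average) simp
  ultimately show "\<forall>\<^sub>F n in sequentially. dist (measure_pmf.prob (P n) {x. \<exists>m\<le>N n. \<epsilon> < \<Phi> n m x}) 0 < r"
    using eventually_ge_at_top [of 2]
  proof eventually_elim
    fix n :: nat assume nd: "2 / \<delta> \<le> real n" and n: "2 \<le> n"
      and av: "(\<Sum>l<N n. E n (\<Phi> n l)) / real n \<le> r / 2 * a"
    define H where "H = nat \<lfloor>\<delta> * real n\<rfloor>"
    have H: "real H \<le> \<delta> * real n" "\<delta> * real n / 2 \<le> real H"
    proof -
      have "2 \<le> \<delta> * real n" using nd \<delta> by (simp add: field_simps)
      then show "real H \<le> \<delta> * real n" "\<delta> * real n / 2 \<le> real H"
        unfolding H_def by linarith+
    qed
    have "measure_pmf.prob (P n) {x. \<exists>m\<le>N n. \<epsilon> < \<Phi> n m x} \<le> E n (\<lambda>x. (\<Sum>l<N n. \<Phi> n l x) / real n) / a"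
    proof (rule markov [OF n _ a])
      show "0 \<le> (\<Sum>l<N n. \<Phi> n l x) / real n" for x
        by (intro divide_nonneg_nonneg sum_nonneg nonneg) auto
      fix x assume x: "x \<in> set_pmf (P n)" and "x \<in> {x. \<exists>m\<le>N n. \<epsilon> < \<Phi> n m x}"
      then obtain m where m: "m \<le> N n" "\<epsilon> < \<Phi> n m x" by blast
      have win: "\<epsilon> / 2 < \<Phi> n l x" if l: "l \<le> m" "m - l \<le> H" for l
      proof (rule window [OF n x m l(1)])
        have "real (m - l) \<le> \<delta> * real n" using l(2) H(1) by linarith
        then show "real (m - l) / real n \<le> \<delta>" using n by (simp add: divide_le_eq)
      qed
      \<comment> \<open>The window reaches backwards in time and cannot be cut off at 0, as the
        deviation vanishes there.\<close>
      have Hm: "H \<le> m"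
      proof (rule ccontr)
        assume "\<not> H \<le> m"
        then have "\<epsilon> / 2 < \<Phi> n 0 x" by (intro win) auto
        then show False using start [OF n x] \<epsilon> by simp
      qed
      have "real H * (\<epsilon> / 2) = (\<Sum>l\<in>{m - H..<m}. \<epsilon> / 2)" using Hm by simp
      also have "\<dots> \<le> (\<Sum>l\<in>{m - H..<m}. \<Phi> n l x)"
        using win by (intro sum_mono less_imp_le) auto
      also have "\<dots> \<le> (\<Sum>l<N n. \<Phi> n l x)"
        using m by (intro sum_mono2 nonneg) auto
      finally have "real H * (\<epsilon> / 2) \<le> (\<Sum>l<N n. \<Phi> n l x)" .
      moreover have "\<delta> * real n / 2 * (\<epsilon> / 2) \<le> real H * (\<epsilon> / 2)"
        using H(2) \<epsilon> by (intro mult_right_mono) auto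
      ultimately have "a * real n \<le> (\<Sum>l<N n. \<Phi> n l x)" by (simp add: a_def)
      then show "a \<le> (\<Sum>l<N n. \<Phi> n l x) / real n" using n by (simp add: le_divide_eq)
    qed
    also have "E n (\<lambda>x. (\<Sum>l<N n. \<Phi> n l x) / real n) = (\<Sum>l<N n. E n (\<Phi> n l)) / real n"
      by (simp add: E_sum [OF n])
    also have "\<dots> / a \<le> (r / 2 * a) / a" using av a by (intro divide_right_mono) auto
    also have "\<dots> = r / 2" using a by simp
    finally show "dist (measure_pmf.prob (P n) {x. \<exists>m\<le>N n. \<epsilon> < \<Phi> n m x}) 0 < r"
      using r by (simp add: dist_real_def)
  qed
qed

theorem c_uniform_convergence:
  assumes \<epsilon>: "0 < \<epsilon>"
  shows "(\<lambda>n. measure_pmf.prob (P n) {x. \<exists>m\<le>N n. \<epsilon> < \<bar>c n k (x m) - c_lim p k (real m / real n)\<bar>}) \<longlonglongrightarrow> 0"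
proof -
  obtain \<delta>1 where \<delta>1: "0 < \<delta>1" "\<And>s t. 0 \<le> s \<Longrightarrow> s \<le> T \<Longrightarrow> 0 \<le> t \<Longrightarrow> t \<le> T \<Longrightarrow> \<bar>s - t\<bar> \<le> \<delta>1 \<Longrightarrow>
      \<bar>c_lim p k s - c_lim p k t\<bar> < \<epsilon> / 4"
    using uniformly_continuous_window [OF c_lim_continuous_on [OF p, where T = T and k = k], of "\<epsilon> / 4"] \<epsilon> by auto
  \<comment> \<open>Within the window the process and its limit move by at most \<epsilon> / 4 each,
    which leaves \<epsilon> / 2 of the deviation.\<close>
  define \<delta> where "\<delta> = min \<delta>1 (\<epsilon> / (8 * (real k + 1)))"
  have \<delta>: "0 < \<delta>" "\<delta> \<le> \<delta>1" "2 * real k * \<delta> \<le> \<epsilon> / 4"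
  proof -
    show "0 < \<delta>" "\<delta> \<le> \<delta>1" using \<delta>1 \<epsilon> by (auto simp: \<delta>_def)
    have "2 * real k * \<delta> \<le> 2 * real k * (\<epsilon> / (8 * (real k + 1)))"
      by (intro mult_left_mono) (auto simp: \<delta>_def)
    also have "\<dots> \<le> \<epsilon> / 4" using \<epsilon> by (simp add: field_simps)
    finally show "2 * real k * \<delta> \<le> \<epsilon> / 4" .
  qed
  show ?thesis
  proof (rule window_prob [OF \<epsilon> \<delta>(1)])
    fix n x assume n: "2 \<le> n" and x: "x \<in> set_pmf (P n)"
    show "\<bar>c n k (x 0) - c_lim p k (real 0 / real n)\<bar> = 0"
      by (simp add: path_start [OF n x] c_start [OF n] c_lim_zero [OF p])
    fix m l assume m: "m \<le> N n" and dev: "\<epsilon> < \<bar>c n k (x m) - c_lim p k (real m / real n)\<bar>"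
      and l: "l \<le> m" "real (m - l) / real n \<le> \<delta>"
    have "\<bar>c n k (x m) - c n k (x l)\<bar> \<le> real (m - l) * (2 * real k / real n)"
      using l(1) m
    proof (induction m rule: dec_induct)
      case (step m)
      have "\<bar>c n k (x (Suc m)) - c n k (x m)\<bar> \<le> 2 * real k / real n"
        using step by (intro c_step n path_good [OF n x] path_step [OF n x]) auto
      moreover have "real (Suc m - l) * (2 * real k / real n) = real (m - l) * (2 * real k / real n) + 2 * real k / real n"
        using step by (simp add: of_nat_diff algebra_simps add_divide_distrib diff_divide_distrib)
      moreover have "\<bar>c n k (x m) - c n k (x l)\<bar> \<le> real (m - l) * (2 * real k / real n)"
        using step by simp
      ultimately show ?case by linarith
    qed simp
    also have "\<dots> = 2 * real k * (real (m - l) / real n)" by simp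
    also have "\<dots> \<le> 2 * real k * \<delta>" using l(2) by (intro mult_left_mono) auto
    finally have "\<bar>c n k (x m) - c n k (x l)\<bar> \<le> \<epsilon> / 4" using \<delta>(3) by linarith
    moreover have "\<bar>c_lim p k (real m / real n) - c_lim p k (real l / real n)\<bar> < \<epsilon> / 4"
      using l m \<delta>(2) time_le [of l n] time_le [of m n] by (intro \<delta>1(2)) (auto simp: time_diff)
    ultimately show "\<epsilon> / 2 < \<bar>c n k (x l) - c_lim p k (real l / real n)\<bar>"
      using dev by linarith
  next
    fix r :: real assume "0 < r"
    from unif_smallD [OF unif_small_average [OF unif_small_c] this]
    show "\<forall>\<^sub>F n in sequentially. (\<Sum>l<N n. E n (\<lambda>x. \<bar>c n k (x l) - c_lim p k (real l / real n)\<bar>)) / real n \<le> r"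
      by (rule eventually_mono) auto
  qed auto
qed

text \<open>The downward steps of v are not bounded, but v is nonincreasing: looking backwards it
  can only be larger, so an excess over the continuous limit persists. This argument covers upward
  deviations only.\<close>

lemma v_upper_convergence:
  assumes \<epsilon>: "0 < \<epsilon>"
  shows "(\<lambda>n. measure_pmf.prob (P n) {x. \<exists>m\<le>N n. \<epsilon> < max 0 (v n (x m) - v_lim p (real m / real n))}) \<longlonglongrightarrow> 0"
proof -
  obtain \<delta> where \<delta>: "0 < \<delta>" "\<And>s t. 0 \<le> s \<Longrightarrow> s \<le> T \<Longrightarrow> 0 \<le> t \<Longrightarrow> t \<le> T \<Longrightarrow> \<bar>s - t\<bar> \<le> \<delta> \<Longrightarrow>
      \<bar>v_lim p s - v_lim p t\<bar> < \<epsilon> / 2"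
    using uniformly_continuous_window [OF v_lim_continuous_on [OF p, where T = T], of "\<epsilon> / 2"] \<epsilon> by auto
  show ?thesis
  proof (rule window_prob [OF \<epsilon> \<delta>(1)])
    fix n x assume n: "2 \<le> n" and x: "x \<in> set_pmf (P n)"
    show "max 0 (v n (x 0) - v_lim p (real 0 / real n)) = 0"
      by (simp add: v_path_start [OF n x] v_lim_le_half [OF p])
    fix m l assume m: "m \<le> N n" and dev: "\<epsilon> < max 0 (v n (x m) - v_lim p (real m / real n))"
      and l: "l \<le> m" "real (m - l) / real n \<le> \<delta>"
    have "\<bar>v_lim p (real m / real n) - v_lim p (real l / real n)\<bar> < \<epsilon> / 2"
      using l m time_le [of l n] time_le [of m n] by (intro \<delta>(2)) (auto simp: time_diff)
    moreover have "v n (x m) \<le> v n (x l)" by (rule v_path_antimono [OF n x l(1) m])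
    ultimately show "\<epsilon> / 2 < max 0 (v n (x l) - v_lim p (real l / real n))"
      using dev \<epsilon> by linarith
  next
    fix r :: real assume "0 < r"
    from average_v_small [OF this] eventually_ge_at_top [of 2]
    show "\<forall>\<^sub>F n in sequentially. (\<Sum>l<N n. E n (\<lambda>x. max 0 (v n (x l) - v_lim p (real l / real n)))) / real n \<le> r"
    proof eventually_elim
      case (elim n)
      have "(\<Sum>l<N n. E n (\<lambda>x. max 0 (v n (x l) - v_lim p (real l / real n)))) / real n
        \<le> (\<Sum>l<N n. E n (\<lambda>x. \<bar>v n (x l) - v_lim p (real l / real n)\<bar>)) / real n"
        using elim by (intro divide_right_mono sum_mono E_mono) auto
      then show ?case using elim by linarith
    qed
  qed auto
qed

text \<open>Downward deviations are excluded by v \<ge> u: finitely many sizes carry almost all of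
  v_lim, and their masses converge uniformly.\<close>

theorem v_uniform_convergence:
  assumes \<epsilon>: "0 < \<epsilon>"
  shows "(\<lambda>n. measure_pmf.prob (P n) {x. \<exists>m\<le>N n. \<epsilon> < \<bar>v n (x m) - v_lim p (real m / real n)\<bar>}) \<longlonglongrightarrow> 0"
proof -
  obtain L where L: "\<And>t. 0 \<le> t \<Longrightarrow> v_lim p t - (\<Sum>k\<le>L. c_lim p k t) \<le> \<epsilon> / 2"
    using c_lim_tail [OF p, of "\<epsilon> / 2"] \<epsilon> by auto
  define \<epsilon>' where "\<epsilon>' = \<epsilon> / (2 * (real L + 1))"
  have \<epsilon>': "0 < \<epsilon>'" using \<epsilon> by (simp add: \<epsilon>'_def)
  define A where "A n = {x. \<exists>m\<le>N n. \<epsilon> < max 0 (v n (x m) - v_lim p (real m / real n))}" for n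
  define B where "B k n = {x. \<exists>m\<le>N n. \<epsilon>' < \<bar>c n k (x m) - c_lim p k (real m / real n)\<bar>}" for k n
  have bound: "measure_pmf.prob (P n) {x. \<exists>m\<le>N n. \<epsilon> < \<bar>v n (x m) - v_lim p (real m / real n)\<bar>}
    \<le> measure_pmf.prob (P n) (A n) + (\<Sum>k\<le>L. measure_pmf.prob (P n) (B k n))" if n: "2 \<le> n" for n
  proof (rule prob_le_union_bound)
    fix x assume x: "x \<in> set_pmf (P n)" and "x \<in> {x. \<exists>m\<le>N n. \<epsilon> < \<bar>v n (x m) - v_lim p (real m / real n)\<bar>}"
    then obtain m where m: "m \<le> N n" and dev: "\<epsilon> < \<bar>v n (x m) - v_lim p (real m / real n)\<bar>"
      by blast
    show "x \<in> A n \<or> (\<exists>k\<in>{..L}. x \<in> B k n)"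
    proof (cases "\<exists>k\<le>L. \<epsilon>' < \<bar>c n k (x m) - c_lim p k (real m / real n)\<bar>")
      case True
      then show ?thesis using m by (auto simp: B_def)
    next
      case False
      have "(\<Sum>k\<le>L. c_lim p k (real m / real n)) - u n L (x m) = (\<Sum>k\<le>L. c_lim p k (real m / real n) - c n k (x m))"
        by (simp add: u_def sum_subtractf)
      also have "\<dots> \<le> (\<Sum>k\<le>L. \<epsilon>')" using False by (intro sum_mono) (auto simp: not_less abs_le_iff)
      also have "\<dots> = \<epsilon> / 2" by (simp add: \<epsilon>'_def field_simps)
      finally have "v_lim p (real m / real n) - \<epsilon> \<le> v n (x m)"
        using L [of "real m / real n"] u_le_v [OF n x, of L m] by simp
      then have "\<epsilon> < max 0 (v n (x m) - v_lim p (real m / real n))" using dev by linarith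
      then show ?thesis using m by (auto simp: A_def)
    qed
  qed simp
  have "(\<lambda>n. measure_pmf.prob (P n) (A n) + (\<Sum>k\<le>L. measure_pmf.prob (P n) (B k n))) \<longlonglongrightarrow> 0 + (\<Sum>k\<le>L. 0)"
    unfolding A_def B_def by (intro tendsto_add tendsto_sum v_upper_convergence [OF \<epsilon>] c_uniform_convergence [OF \<epsilon>'])
  then have lim: "(\<lambda>n. measure_pmf.prob (P n) (A n) + (\<Sum>k\<le>L. measure_pmf.prob (P n) (B k n))) \<longlonglongrightarrow> 0" by simp
  show ?thesis
    by (rule tendsto_sandwich [OF _ _ tendsto_const lim])
      (use bound in \<open>auto intro: eventually_mono [OF eventually_ge_at_top [of 2]]\<close>)
qed

end

section \<open>Convergence of the frozen model\<close>

text \<open>Scheffe's argument: beyond \<open>L\<close> the distance is at most the sum of the two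
  tails, and the tail of \<open>a\<close> is its total mass minus its first terms. So convergence of
  each coordinate and of the total mass suffices, given a small tail of the limit.\<close>

lemma scheffe_bound:
  fixes a b :: "nat \<Rightarrow> real"
  assumes a: "a sums A" "\<And>k. 0 \<le> a k" and b: "b sums B" "\<And>k. 0 \<le> b k"
  shows "summable (\<lambda>k. \<bar>a k - b k\<bar>)"
    and "(\<Sum>k. \<bar>a k - b k\<bar>) \<le> 2 * (\<Sum>k\<le>L. \<bar>a k - b k\<bar>) + \<bar>A - B\<bar> + 2 * (B - (\<Sum>k\<le>L. b k))"
proof -
  have le: "\<bar>a k - b k\<bar> \<le> a k + b k" for k using a(2) [of k] b(2) [of k] by (simp add: abs_le_iff)
  have sab: "(\<lambda>k. a k + b k) sums (A + B)" by (intro sums_add a b)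
  show s: "summable (\<lambda>k. \<bar>a k - b k\<bar>)"
    by (rule summable_comparison_test' [of "\<lambda>k. a k + b k" 0]) (use sab le in \<open>auto simp: sums_iff\<close>)
  have "(\<Sum>k. \<bar>a k - b k\<bar>) = (\<Sum>k. \<bar>a (k + Suc L) - b (k + Suc L)\<bar>) + (\<Sum>k<Suc L. \<bar>a k - b k\<bar>)"
    by (rule suminf_split_initial_segment [OF s])
  also have "(\<Sum>k. \<bar>a (k + Suc L) - b (k + Suc L)\<bar>) \<le> (\<Sum>k. a (k + Suc L) + b (k + Suc L))"
  proof (rule suminf_le)
    show "summable (\<lambda>k. \<bar>a (k + Suc L) - b (k + Suc L)\<bar>)"
      using summable_ignore_initial_segment [OF s] .
    show "summable (\<lambda>k. a (k + Suc L) + b (k + Suc L))"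
      using summable_ignore_initial_segment [OF sums_summable [OF sab]] .
  qed (rule le)
  also have "\<dots> = A + B - (\<Sum>k<Suc L. a k + b k)"
    using suminf_minus_initial_segment [OF sums_summable [OF sab], of "Suc L"] sab by (simp add: sums_iff)
  finally have 1: "(\<Sum>k. \<bar>a k - b k\<bar>) \<le> A + B - (\<Sum>k\<le>L. a k) - (\<Sum>k\<le>L. b k) + (\<Sum>k\<le>L. \<bar>a k - b k\<bar>)"
    by (simp add: lessThan_Suc_atMost sum.distrib)
  have "(\<Sum>k\<le>L. b k) - (\<Sum>k\<le>L. a k) = (\<Sum>k\<le>L. b k - a k)" by (simp add: sum_subtractf)
  also have "\<dots> \<le> (\<Sum>k\<le>L. \<bar>a k - b k\<bar>)" by (intro sum_mono) (simp add: abs_le_iff)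
  finally show "(\<Sum>k. \<bar>a k - b k\<bar>) \<le> 2 * (\<Sum>k\<le>L. \<bar>a k - b k\<bar>) + \<bar>A - B\<bar> + 2 * (B - (\<Sum>k\<le>L. b k))"
    using 1 by (simp add: right_diff_distrib)
qed

context coagulation
begin

lemma time_index:
  assumes "t \<in> {0..T}"
  shows "nat \<lfloor>real n * t\<rfloor> \<le> N n"
  unfolding N_def using mult_left_mono [of t T "real n"] assms
  by (intro nat_mono floor_mono) (simp add: mult.commute)

lemma time_grid_approx:
  fixes f :: "real \<Rightarrow> real"
  assumes "continuous_on {0..T} f" "0 < \<eta>"
  shows "\<forall>\<^sub>F n in sequentially. \<forall>t\<in>{0..T}. \<bar>f (real (nat \<lfloor>real n * t\<rfloor>) / real n) - f t\<bar> \<le> \<eta>"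
proof -
  obtain \<delta> where \<delta>: "0 < \<delta>" "\<And>s t. 0 \<le> s \<Longrightarrow> s \<le> T \<Longrightarrow> 0 \<le> t \<Longrightarrow> t \<le> T \<Longrightarrow> \<bar>s - t\<bar> \<le> \<delta> \<Longrightarrow> \<bar>f s - f t\<bar> < \<eta>"
    using uniformly_continuous_window [OF assms] by blast
  have "\<forall>\<^sub>F n in sequentially. 1 / \<delta> \<le> real n"
    using filterlim_real_sequentially by (simp add: filterlim_at_top)
  then show ?thesis
    using eventually_ge_at_top [of 2]
  proof (eventually_elim, intro ballI)
    fix n :: nat and t assume n\<delta>: "1 / \<delta> \<le> real n" and n: "2 \<le> n" and t: "t \<in> {0..T}"
    define m where "m = nat \<lfloor>real n * t\<rfloor>"
    have "real m \<le> real n * t" "real n * t - 1 \<le> real m"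
      using t by (auto simp: m_def)
    then have "\<bar>real m - real n * t\<bar> \<le> 1" by linarith
    then have "\<bar>real m / real n - t\<bar> \<le> 1 / real n"
      using n by (simp add: abs_le_iff field_simps)
    also have "\<dots> \<le> \<delta>" using n\<delta> \<delta>(1) n by (simp add: field_simps)
    finally have "\<bar>f (real m / real n) - f t\<bar> < \<eta>"
      using t time_le [OF time_index [OF t], of n] by (intro \<delta>(2)) (auto simp: m_def)
    then show "\<bar>f (real (nat \<lfloor>real n * t\<rfloor>) / real n) - f t\<bar> \<le> \<eta>" by (simp add: m_def)
  qed
qed

lemma c_sums_v:
  assumes "2 \<le> n" "x \<in> set_pmf (P n)"
  shows "(\<lambda>k. c n k (x m)) sums v n (x m)"
proof -
  have "(\<lambda>k. c n k (x m)) sums (\<Sum>k\<le>n. c n k (x m))"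
    by (rule sums_finite) (auto simp: c_large [OF assms(1) path_good [OF assms]] not_le)
  then show ?thesis using v_eq [OF assms(1) path_good [OF assms]] by simp
qed

theorem l1_convergence:
  assumes \<rho>: "0 < \<rho>"
  shows "(\<lambda>n. measure_pmf.prob (P n) {x. \<exists>t\<in>{0..T}.
      \<rho> < \<bar>v n (x (nat \<lfloor>real n * t\<rfloor>)) - v_lim p t\<bar> \<or>
      \<rho> < (\<Sum>k. \<bar>c n k (x (nat \<lfloor>real n * t\<rfloor>)) - c_lim p k t\<bar>)}) \<longlonglongrightarrow> 0"
    (is "(\<lambda>n. measure_pmf.prob (P n) (?bad n)) \<longlonglongrightarrow> 0")
proof -
  obtain L where L: "\<And>t. 0 \<le> t \<Longrightarrow> v_lim p t - (\<Sum>k\<le>L. c_lim p k t) \<le> \<rho> / 8"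
    using c_lim_tail [OF p, of "\<rho> / 8"] \<rho> by auto
  \<comment> \<open>The total below is then \<rho> / 4 from the first sizes, at most \<rho> / 8 from
    the masses and \<rho> / 4 from the tail.\<close>
  define \<eta> where "\<eta> = \<rho> / (16 * (real L + 1))"
  have \<eta>: "0 < \<eta>" "(real L + 1) * \<eta> = \<rho> / 16" "\<eta> \<le> \<rho> / 16"
    using \<rho> by (auto simp: \<eta>_def field_simps)
  define A where "A n = {x. \<exists>m\<le>N n. \<eta> < \<bar>v n (x m) - v_lim p (real m / real n)\<bar>}" for n
  define B where "B k n = {x. \<exists>m\<le>N n. \<eta> < \<bar>c n k (x m) - c_lim p k (real m / real n)\<bar>}" for k n
  have "\<forall>\<^sub>F n in sequentially. \<forall>k\<in>{..L}. \<forall>t\<in>{0..T}. \<bar>c_lim p k (real (nat \<lfloor>real n * t\<rfloor>) / real n) - c_lim p k t\<bar> \<le> \<eta>"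
    using \<eta> by (intro eventually_ball_finite ballI time_grid_approx c_lim_continuous_on [OF p]) auto
  then have bound: "\<forall>\<^sub>F n in sequentially. measure_pmf.prob (P n) (?bad n)
     \<le> measure_pmf.prob (P n) (A n) + (\<Sum>k\<le>L. measure_pmf.prob (P n) (B k n))"
    using time_grid_approx [OF v_lim_continuous_on [OF p] \<eta>(1)] eventually_ge_at_top [of 2]
  proof eventually_elim
    case (elim n)
    then have n: "2 \<le> n" by simp
    show ?case
    proof (rule prob_le_union_bound, simp, rule ccontr)
      fix x assume x: "x \<in> set_pmf (P n)" and bad: "x \<in> ?bad n" and out: "\<not> (x \<in> A n \<or> (\<exists>k\<in>{..L}. x \<in> B k n))"
      obtain t where t: "t \<in> {0..T}" and dev: "\<rho> < \<bar>v n (x (nat \<lfloor>real n * t\<rfloor>)) - v_lim p t\<bar> \<or>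
          \<rho> < (\<Sum>k. \<bar>c n k (x (nat \<lfloor>real n * t\<rfloor>)) - c_lim p k t\<bar>)" using bad by blast
      define m where "m = nat \<lfloor>real n * t\<rfloor>"
      have m: "m \<le> N n" using time_index [OF t] by (simp add: m_def)
      have "\<bar>v n (x m) - v_lim p (real m / real n)\<bar> \<le> \<eta>" using out m by (auto simp: A_def not_less)
      moreover have "\<bar>v_lim p (real m / real n) - v_lim p t\<bar> \<le> \<eta>" using elim(2) t by (simp add: m_def)
      ultimately have v: "\<bar>v n (x m) - v_lim p t\<bar> \<le> 2 * \<eta>" by linarith
      have c: "\<bar>c n k (x m) - c_lim p k t\<bar> \<le> 2 * \<eta>" if "k \<le> L" for k
      proof -
        have "\<bar>c n k (x m) - c_lim p k (real m / real n)\<bar> \<le> \<eta>" using out m that by (auto simp: B_def not_less)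
        moreover have "\<bar>c_lim p k (real m / real n) - c_lim p k t\<bar> \<le> \<eta>" using elim(1) t that by (simp add: m_def)
        ultimately show ?thesis by linarith
      qed
      have "(\<Sum>k. \<bar>c n k (x m) - c_lim p k t\<bar>)
        \<le> 2 * (\<Sum>k\<le>L. \<bar>c n k (x m) - c_lim p k t\<bar>) + \<bar>v n (x m) - v_lim p t\<bar> + 2 * (v_lim p t - (\<Sum>k\<le>L. c_lim p k t))"
        using t by (intro scheffe_bound(2) c_sums_v n x c_nonneg c_lim_sums(1) [OF p] c_lim_nonneg [OF p]) auto
      also have "\<dots> \<le> 2 * (\<Sum>k\<le>L. 2 * \<eta>) + 2 * \<eta> + 2 * (\<rho> / 8)"
        using t by (intro add_mono mult_left_mono sum_mono c v L) auto
      also have "\<dots> = 4 * ((real L + 1) * \<eta>) + 2 * \<eta> + \<rho> / 4" by (simp add: algebra_simps)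
      also have "\<dots> \<le> \<rho>" using \<eta> \<rho> by simp
      finally show False using dev v \<eta> \<rho> by (simp add: m_def)
    qed
  qed
  have "(\<lambda>n. measure_pmf.prob (P n) (A n) + (\<Sum>k\<le>L. measure_pmf.prob (P n) (B k n))) \<longlonglongrightarrow> 0 + (\<Sum>k\<le>L. 0)"
    unfolding A_def B_def by (intro tendsto_add tendsto_sum v_uniform_convergence c_uniform_convergence \<eta>)
  then have lim: "(\<lambda>n. measure_pmf.prob (P n) (A n) + (\<Sum>k\<le>L. measure_pmf.prob (P n) (B k n))) \<longlonglongrightarrow> 0" by simp
  show ?thesis
    by (rule tendsto_sandwich [OF _ bound tendsto_const lim]) auto
qed

end

lemma frozen_finite_chain:
  assumes "0 < p" "p \<le> 1" "2 \<le> n"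
  shows "finite_chain (frozen_step p n) {#} {G. good_graph n G}"
proof (rule finite_chain.intro)
  show "{#} \<in> {G. good_graph n G}" by (simp add: good_graph_empty)
  fix G assume "G \<in> {G. good_graph n G}"
  then have G: "good_graph n G" by simp
  show "finite (set_pmf (frozen_step p n G))" by (rule finite_set_pmf_frozen_step [OF assms G])
  show "H \<in> {G. good_graph n G}" if "H \<in> set_pmf (frozen_step p n G)" for H
    using good_graph_frozen_step [OF assms G that] by simp
qed

lemma frozen_coagulation:
  assumes p: "0 < p" "p \<le> 1" and T: "0 < T"
  shows "coagulation p T (frozen_step p) {#} (\<lambda>n. {G. good_graph n G}) tree_mass
     (\<lambda>n G. real (forest_V n G) / real n) (\<lambda>n G. real (card (trees n {1..} G)) / real n)"
proof (rule coagulation.intro)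
  fix n :: nat assume n: "2 \<le> n"
  show "finite_chain (frozen_step p n) {#} {G. good_graph n G}"
    by (rule frozen_finite_chain [OF p n])
  show "tree_mass n k {#} = (if k = 1 then 1 else 0)" for k
    using n by (simp add: tree_mass_def num_trees_empty)
  fix G assume "G \<in> {G. good_graph n G}"
  then have G: "good_graph n G" by simp
  show "tree_mass n k G = 0" if "n < k" for k
    using num_trees_eq_0 [OF G that] by (simp add: tree_mass_def)
  show "real (forest_V n G) / real n = (\<Sum>k\<le>n. tree_mass n k G)"
    by (rule tree_mass_sum [OF p n G, symmetric])
  show "real (card (trees n {1..} G)) / real n = (\<Sum>k\<le>n. tree_mass n k G / real k)"
    by (rule tree_count_sum [OF p n G, symmetric])
  show "real (forest_V n H) / real n \<le> real (forest_V n G) / real n" if "H \<in> set_pmf (frozen_step p n G)" for H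
    using tree_mass_step(2) [OF p n G that] by (simp add: divide_right_mono)
  show "\<bar>tree_mass n k H - tree_mass n k G\<bar> \<le> 2 * real k / real n" if "H \<in> set_pmf (frozen_step p n G)" for H k
    by (rule tree_mass_step(1) [OF p n G that])
  show "\<bar>measure_pmf.expectation (frozen_step p n G) (tree_mass n k) - tree_mass n k G
        - real k / real n * ((\<Sum>i\<le>k. tree_mass n i G * tree_mass n (k - i) G)
          - 2 * tree_mass n k G * (real (forest_V n G) / real n + p * (1 - real (forest_V n G) / real n)))\<bar>
      \<le> 8 * (real k)\<^sup>2 / (real n)\<^sup>2" for k
    by (rule tree_mass_drift [OF p n G])
  show "measure_pmf.expectation (frozen_step p n G) (\<lambda>G. real (card (trees n {1..} G)) / real n)
      \<le> real (card (trees n {1..} G)) / real n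
       - ((real (forest_V n G) / real n)\<^sup>2 + 2 * p * (real (forest_V n G) / real n) * (1 - real (forest_V n G) / real n)) / real n
       + 1 / (real n)\<^sup>2"
    by (rule tree_count_drift [OF p n G])
qed (use p T in \<open>auto simp: tree_mass_def\<close>)

lemma ucp_convergesI:
  fixes \<phi> :: "nat \<Rightarrow> multigraph \<Rightarrow> 'b"
  assumes p: "0 < p" "p \<le> 1"
    and proc: "\<And>n. 2 \<le> n \<Longrightarrow> frozen_process p n (M n) (F n)"
    and conv: "\<And>T \<epsilon>. 0 < T \<Longrightarrow> 0 < \<epsilon> \<Longrightarrow>
      (\<lambda>n. measure_pmf.prob (path_pmf (frozen_step p n) {#} (nat \<lfloor>T * real n\<rfloor>))
        {x. \<exists>t\<in>{0..T}. d (\<phi> n (x (nat \<lfloor>real n * t\<rfloor>))) (y t) > ennreal \<epsilon>}) \<longlonglongrightarrow> 0"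
  shows "ucp_converges d M (\<lambda>n t w. \<phi> n (F n (nat \<lfloor>real n * t\<rfloor>) w)) y"
  unfolding ucp_converges_def Let_def
proof (intro allI impI)
  fix K :: "real set" and \<epsilon> :: real
  assume asm: "compact K \<and> K \<subseteq> {0..} \<and> 0 < \<epsilon>"
  then obtain b where b: "\<And>t. t \<in> K \<Longrightarrow> norm t \<le> b"
    using compact_imp_bounded bounded_iff by metis
  \<comment> \<open>The maximum keeps the horizon positive when \<open>K\<close> is empty or
    \<open>{0}\<close>.\<close>
  define T where "T = max b 1"
  have T: "0 < T" "K \<subseteq> {0..T}" using b asm by (fastforce simp: T_def)+
  define N where "N n = nat \<lfloor>T * real n\<rfloor>" for n
  define bad where "bad n = {w \<in> space (M n). \<exists>t\<in>K. d (\<phi> n (F n (nat \<lfloor>real n * t\<rfloor>) w)) (y t) > ennreal \<epsilon>}" for n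
  have bad_eq: "{w \<in> space (M n). ennreal \<epsilon> < (SUP t\<in>K. d (\<phi> n (F n (nat \<lfloor>real n * t\<rfloor>) w)) (y t))} = bad n" for n
    by (simp add: bad_def less_SUP_iff)
  have idx: "nat \<lfloor>real n * t\<rfloor> \<le> N n" if "t \<in> K" for n t
  proof -
    have "t \<le> T" using that T by auto
    then have "real n * t \<le> T * real n" using mult_left_mono [of t T "real n"] by (simp add: mult.commute)
    then show ?thesis unfolding N_def by (intro nat_mono floor_mono)
  qed
  have meas: "bad n \<in> sets (M n)" if n: "2 \<le> n" for n
  proof -
    \<comment> \<open>The compact set may be uncountable. Grouping its times by the step reached
      leaves a finite union of events that each depend on one \<open>F n m\<close>.\<close>
    define C where "C m = {G. \<exists>t\<in>K. nat \<lfloor>real n * t\<rfloor> = m \<and> d (\<phi> n G) (y t) > ennreal \<epsilon>}" for m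
    have "F n m -` C m \<inter> space (M n) \<in> sets (M n)" for m
      using proc [OF n] by (intro measurable_sets [of _ _ "count_space UNIV"]) (auto simp: frozen_process_def)
    then have "(\<Union>m\<le>N n. F n m -` C m \<inter> space (M n)) \<in> sets (M n)"
      by (intro sets.finite_UN) auto
    moreover have "bad n = (\<Union>m\<le>N n. F n m -` C m \<inter> space (M n))"
      using idx [of _ n] by (auto simp: bad_def C_def)
    ultimately show ?thesis by (simp only:)
  qed
  define A where "A n = {x. \<exists>t\<in>{0..T}. d (\<phi> n (x (nat \<lfloor>real n * t\<rfloor>))) (y t) > ennreal \<epsilon>}" for n
  have le: "measure (M n) (bad n) \<le> measure_pmf.prob (path_pmf (frozen_step p n) {#} (N n)) (A n)" if n: "2 \<le> n" for n
  proof -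
    interpret finite_chain "frozen_step p n" "{#}" "{G. good_graph n G}"
      by (rule frozen_finite_chain [OF p n])
    show ?thesis
      unfolding bad_def
    proof (rule realisation_bound)
      show "{w \<in> space (M n). \<exists>t\<in>K. ennreal \<epsilon> < d (\<phi> n (F n (nat \<lfloor>real n * t\<rfloor>) w)) (y t)} \<in> sets (M n)"
        using meas [OF n] by (simp only: bad_def)
      fix w and x :: "nat \<Rightarrow> multigraph"
      assume "\<exists>t\<in>K. ennreal \<epsilon> < d (\<phi> n (F n (nat \<lfloor>real n * t\<rfloor>) w)) (y t)"
        and eq: "\<And>i. i \<le> N n \<Longrightarrow> F n i w = x i"
      then obtain t where t: "t \<in> K" "ennreal \<epsilon> < d (\<phi> n (F n (nat \<lfloor>real n * t\<rfloor>) w)) (y t)" by blast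
      then show "x \<in> A n" using T eq [OF idx [OF t(1)]] by (auto simp: A_def)
    qed (use proc [OF n] in \<open>simp_all only: frozen_process_def\<close>)
  qed
  have "(\<lambda>n. measure (M n) (bad n)) \<longlonglongrightarrow> 0"
  proof (rule tendsto_sandwich [OF _ _ tendsto_const])
    show "(\<lambda>n. measure_pmf.prob (path_pmf (frozen_step p n) {#} (N n)) (A n)) \<longlonglongrightarrow> 0"
      unfolding N_def A_def using asm by (intro conv T) auto
    show "\<forall>\<^sub>F n in sequentially. measure (M n) (bad n) \<le> measure_pmf.prob (path_pmf (frozen_step p n) {#} (N n)) (A n)"
      using eventually_ge_at_top [of 2] by eventually_elim (rule le)
  qed auto
  moreover have "\<forall>\<^sub>F n in sequentially. bad n \<in> sets (M n)"
    using eventually_ge_at_top [of 2] by eventually_elim (rule meas)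
  ultimately show "(\<forall>\<^sub>F n in sequentially.
      {w \<in> space (M n). ennreal \<epsilon> < (SUP t\<in>K. d (\<phi> n (F n (nat \<lfloor>real n * t\<rfloor>) w)) (y t))} \<in> sets (M n)) \<and>
    (\<lambda>n. measure (M n) {w \<in> space (M n). ennreal \<epsilon> < (SUP t\<in>K. d (\<phi> n (F n (nat \<lfloor>real n * t\<rfloor>) w)) (y t))}) \<longlonglongrightarrow> 0"
    unfolding bad_eq by blast
qed

text \<open>Summability is made explicit because the value of \<open>suminf\<close> says nothing
  without it, while \<open>l1_edist\<close> would be infinite.\<close>

definition mass_close :: "real \<Rightarrow> real \<Rightarrow> nat \<Rightarrow> multigraph \<Rightarrow> real \<Rightarrow> bool" where
  "mass_close p \<rho> n G t \<longleftrightarrow> \<bar>real (forest_V n G) / real n - v_lim p t\<bar> \<le> \<rho> \<and>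
     summable (\<lambda>k. \<bar>tree_mass n k G - c_lim p k t\<bar>) \<and>
     (\<Sum>k. \<bar>tree_mass n k G - c_lim p k t\<bar>) \<le> \<rho>"

lemma l1_edist_le:
  assumes "mass_close p \<epsilon> n G t"
  shows "l1_edist (\<lambda>k. real (k * num_trees n k G) / real n) (\<lambda>k. real k * t_lim p k t) \<le> ennreal \<epsilon>"
proof -
  have s: "summable (\<lambda>k. \<bar>tree_mass n k G - c_lim p k t\<bar>)" and le: "(\<Sum>k. \<bar>tree_mass n k G - c_lim p k t\<bar>) \<le> \<epsilon>"
    using assms by (auto simp: mass_close_def)
  have "l1_edist (\<lambda>k. real (k * num_trees n k G) / real n) (\<lambda>k. real k * t_lim p k t)
    = (\<Sum>k. ennreal \<bar>tree_mass n (Suc k) G - c_lim p (Suc k) t\<bar>)"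
    unfolding l1_edist_def tree_mass_def c_lim_def ..
  also have "\<dots> = ennreal (\<Sum>k. \<bar>tree_mass n (Suc k) G - c_lim p (Suc k) t\<bar>)"
    using s by (intro suminf_ennreal2) (auto simp: summable_Suc_iff [of "\<lambda>k. \<bar>tree_mass n k G - c_lim p k t\<bar>"])
  also have "(\<Sum>k. \<bar>tree_mass n (Suc k) G - c_lim p (Suc k) t\<bar>) = (\<Sum>k. \<bar>tree_mass n k G - c_lim p k t\<bar>)"
    using suminf_split_head [OF s] by (simp add: tree_mass_def c_lim_def)
  finally show ?thesis using le by (simp add: ennreal_leI)
qed

lemma quotient_close:
  fixes a b e e' v v' :: real
  assumes "0 < \<beta>" "\<beta> \<le> v'" "\<bar>v - v'\<bar> \<le> \<beta> / 2" "e' = q * v'" "0 \<le> q" "q \<le> C"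
  shows "\<bar>e / v - q\<bar> \<le> 2 / \<beta> * (\<bar>e - e'\<bar> + C * \<bar>v - v'\<bar>)"
proof -
  have v: "\<beta> / 2 \<le> v" using assms by linarith
  then have "v > 0" using assms by linarith
  have "e / v - q = ((e - e') + q * (v' - v)) / v"
    using \<open>v > 0\<close> assms by (simp add: field_simps)
  then have "\<bar>e / v - q\<bar> = \<bar>(e - e') + q * (v' - v)\<bar> / v" using \<open>v > 0\<close> by simp
  also have "\<dots> \<le> (\<bar>e - e'\<bar> + C * \<bar>v - v'\<bar>) / v"
  proof (intro divide_right_mono)
    have "\<bar>(e - e') + q * (v' - v)\<bar> \<le> \<bar>e - e'\<bar> + \<bar>q * (v' - v)\<bar>" by (rule abs_triangle_ineq)
    also have "\<bar>q * (v' - v)\<bar> = q * \<bar>v - v'\<bar>" using assms by (simp add: abs_mult abs_minus_commute)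
    also have "\<dots> \<le> C * \<bar>v - v'\<bar>" using assms by (intro mult_right_mono) auto
    finally show "\<bar>(e - e') + q * (v' - v)\<bar> \<le> \<bar>e - e'\<bar> + C * \<bar>v - v'\<bar>" by simp
  qed (use \<open>v > 0\<close> in auto)
  also have "\<dots> \<le> (\<bar>e - e'\<bar> + C * \<bar>v - v'\<bar>) / (\<beta> / 2)"
    using v assms by (intro divide_left_mono) auto
  finally show ?thesis by (simp add: mult.commute)
qed

section \<open>From the tree masses to vertices, edges and their ratio\<close>

context
  fixes p T :: real
  assumes p: "0 < p" "p \<le> 1" and T: "0 < T"
begin

interpretation coag: coagulation p T "frozen_step p" "{#}" "\<lambda>n. {G. good_graph n G}" tree_mass
     "\<lambda>n G. real (forest_V n G) / real n" "\<lambda>n G. real (card (trees n {1..} G)) / real n"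
  by (rule frozen_coagulation [OF p T])

text \<open>Reduces a limit in probability to a deterministic implication for a single graph and a
  single time.\<close>

lemma frozen_prob_bound:
  assumes \<rho>: "0 < \<rho>"
    and imp: "\<And>n G t. 2 \<le> n \<Longrightarrow> good_graph n G \<Longrightarrow> t \<in> {0..T} \<Longrightarrow>
      mass_close p \<rho> n G t \<Longrightarrow> \<not> Q n G t"
  shows "(\<lambda>n. measure_pmf.prob (path_pmf (frozen_step p n) {#} (nat \<lfloor>T * real n\<rfloor>))
        {x. \<exists>t\<in>{0..T}. Q n (x (nat \<lfloor>real n * t\<rfloor>)) t}) \<longlonglongrightarrow> 0"
proof (rule tendsto_sandwich [OF _ _ tendsto_const coag.l1_convergence [OF \<rho>]])
  show "\<forall>\<^sub>F n in sequentially. measure_pmf.prob (path_pmf (frozen_step p n) {#} (nat \<lfloor>T * real n\<rfloor>))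
        {x. \<exists>t\<in>{0..T}. Q n (x (nat \<lfloor>real n * t\<rfloor>)) t} \<le> measure_pmf.prob (coag.P n) {x. \<exists>t\<in>{0..T}.
      \<rho> < \<bar>real (forest_V n (x (nat \<lfloor>real n * t\<rfloor>))) / real n - v_lim p t\<bar> \<or>
      \<rho> < (\<Sum>k. \<bar>tree_mass n k (x (nat \<lfloor>real n * t\<rfloor>)) - c_lim p k t\<bar>)}"
    using eventually_ge_at_top [of 2]
  proof eventually_elim
    fix n :: nat assume n: "2 \<le> n"
    let ?A = "{x. \<exists>t\<in>{0..T}. Q n (x (nat \<lfloor>real n * t\<rfloor>)) t}"
    let ?B = "{x. \<exists>t\<in>{0..T}.
      \<rho> < \<bar>real (forest_V n (x (nat \<lfloor>real n * t\<rfloor>))) / real n - v_lim p t\<bar> \<or>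
      \<rho> < (\<Sum>k. \<bar>tree_mass n k (x (nat \<lfloor>real n * t\<rfloor>)) - c_lim p k t\<bar>)}"
    have "measure_pmf.prob (coag.P n) ?A \<le> measure_pmf.prob (coag.P n) ?B"
    proof (rule prob_mono_support, rule ccontr)
      fix x assume x: "x \<in> set_pmf (coag.P n)" "x \<in> ?A" and out: "x \<notin> ?B"
      then obtain t where t: "t \<in> {0..T}" and Q: "Q n (x (nat \<lfloor>real n * t\<rfloor>)) t" by blast
      define G where "G = x (nat \<lfloor>real n * t\<rfloor>)"
      have G: "good_graph n G" using coag.path_good [OF n] x by (auto simp: G_def)
      have "summable (\<lambda>k. \<bar>tree_mass n k G - c_lim p k t\<bar>)"
        unfolding G_def using t x
        by (intro scheffe_bound(1) [OF coag.c_sums_v [OF n] coag.c_nonneg c_lim_sums(1) [OF p] c_lim_nonneg [OF p]]) auto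
      then have "\<not> Q n G t" using out t by (intro imp n G) (auto simp: G_def not_less mass_close_def)
      then show False using Q by (simp add: G_def)
    qed
    then show "measure_pmf.prob (path_pmf (frozen_step p n) {#} (nat \<lfloor>T * real n\<rfloor>)) ?A \<le> measure_pmf.prob (coag.P n) ?B"
      by (simp only: coag.N_def)
  qed
qed auto

text \<open>Edges are vertices minus trees, and the number of trees divided by n is the sum of the
  masses divided by their sizes. As sizes are at least 1, this sum inherits the error \<rho> of the
  masses; the vertices add another \<rho>.\<close>

lemma forest_E_close:
  assumes n: "2 \<le> n" and G: "good_graph n G" and t: "t \<in> {0..T}"
    and close: "mass_close p \<rho> n G t"
  shows "\<bar>real (forest_E n G) / real n - e_lim p t\<bar> \<le> 2 * \<rho>"
proof -
  have t0: "0 \<le> t" using t by simp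
  have v: "\<bar>real (forest_V n G) / real n - v_lim p t\<bar> \<le> \<rho>"
    and s: "summable (\<lambda>k. \<bar>tree_mass n k G - c_lim p k t\<bar>)"
    and c: "(\<Sum>k. \<bar>tree_mass n k G - c_lim p k t\<bar>) \<le> \<rho>"
    using close by (auto simp: mass_close_def)
  let ?a = "\<lambda>k. tree_mass n k G / real k" and ?b = "\<lambda>k. c_lim p k t / real k"
  have a: "?a sums (real (card (trees n {1..} G)) / real n)"
    unfolding tree_count_sum [OF p n G, symmetric]
    by (rule sums_finite) (use num_trees_eq_0 [OF G] in \<open>auto simp: tree_mass_def\<close>)
  have b: "?b sums (v_lim p t - t * (v_lim p t)\<^sup>2)" by (rule c_lim_sums(2) [OF p t0])
  have le: "\<bar>?a k - ?b k\<bar> \<le> \<bar>tree_mass n k G - c_lim p k t\<bar>" for k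
  proof (cases "k = 0")
    case False
    have "\<bar>?a k - ?b k\<bar> = \<bar>tree_mass n k G - c_lim p k t\<bar> / real k"
      by (simp add: abs_divide flip: diff_divide_distrib)
    also have "\<dots> \<le> \<bar>tree_mass n k G - c_lim p k t\<bar> / 1"
      using False by (intro divide_left_mono) auto
    finally show ?thesis by simp
  qed simp
  have sab: "summable (\<lambda>k. \<bar>?a k - ?b k\<bar>)"
    by (rule summable_comparison_test' [OF s, of 0]) (use le in auto)
  have "\<bar>real (card (trees n {1..} G)) / real n - (v_lim p t - t * (v_lim p t)\<^sup>2)\<bar> = \<bar>\<Sum>k. ?a k - ?b k\<bar>"
    using sums_diff [OF a b] by (simp add: sums_iff)
  also have "\<dots> \<le> (\<Sum>k. \<bar>?a k - ?b k\<bar>)" by (rule summable_rabs [OF sab])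
  also have "\<dots> \<le> (\<Sum>k. \<bar>tree_mass n k G - c_lim p k t\<bar>)" by (intro suminf_le le sab s)
  also have "\<dots> \<le> \<rho>" by (rule c)
  finally have "\<bar>real (card (trees n {1..} G)) / real n - (v_lim p t - t * (v_lim p t)\<^sup>2)\<bar> \<le> \<rho>" .
  moreover have "real (forest_E n G) / real n = real (forest_V n G) / real n - real (card (trees n {1..} G)) / real n"
    by (simp add: forest_E_eq [OF G, symmetric] flip: diff_divide_distrib)
  moreover have "e_lim p t = v_lim p t - (v_lim p t - t * (v_lim p t)\<^sup>2)"
    by (simp add: e_lim_def v_lim_def)
  ultimately show ?thesis using v by linarith
qed

lemma triple_close:
  assumes \<epsilon>: "0 < \<epsilon>"
  obtains \<rho> where "0 < \<rho>"
    "\<And>n G t. 2 \<le> n \<Longrightarrow> good_graph n G \<Longrightarrow> t \<in> {0..T} \<Longrightarrow>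
      mass_close p \<rho> n G t \<Longrightarrow>
      dist (real (forest_V n G) / real n, real (forest_E n G) / real n, forest_R n G)
        (v_lim p t, e_lim p t, r_lim p t) \<le> \<epsilon>"
proof -
  \<comment> \<open>The smallest value of v_lim on [0, T]; being positive, it keeps the denominator
    of R away from 0.\<close>
  define \<beta> where "\<beta> = v_lim p T"
  have \<beta>: "0 < \<beta>" using v_lim_bounds(1) [OF p] by (simp add: \<beta>_def)
  \<comment> \<open>Adds up \<rho> for V, \<open>2 * \<rho>\<close> for E and the error of the
    quotient, with T as a bound for r_lim.\<close>
  define C where "C = 3 + 2 / \<beta> * (2 + T)"
  have C: "0 < C" using \<beta> T by (simp add: C_def add_pos_nonneg)
  define \<rho> where "\<rho> = min (\<beta> / 2) (\<epsilon> / C)"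
  have \<rho>: "0 < \<rho>" "\<rho> \<le> \<beta> / 2" "C * \<rho> \<le> \<epsilon>"
  proof -
    have "C * \<rho> \<le> C * (\<epsilon> / C)" using C by (intro mult_left_mono) (auto simp: \<rho>_def)
    then show "C * \<rho> \<le> \<epsilon>" using C by simp
    show "0 < \<rho>" using \<beta> C \<epsilon> by (simp add: \<rho>_def)
    show "\<rho> \<le> \<beta> / 2" unfolding \<rho>_def by (rule min.cobounded1)
  qed
  show ?thesis
  proof (rule that [OF \<rho>(1)])
    fix n G t
    assume n: "2 \<le> n" and G: "good_graph n G" and t: "t \<in> {0..T}" and close: "mass_close p \<rho> n G t"
    define V E where "V = real (forest_V n G) / real n" and "E = real (forest_E n G) / real n"
    have E: "\<bar>E - e_lim p t\<bar> \<le> 2 * \<rho>"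
      unfolding E_def by (rule forest_E_close [OF n G t close])
    have V: "\<bar>V - v_lim p t\<bar> \<le> \<rho>" using close by (simp add: V_def mass_close_def)
    have R: "forest_R n G = E / V"
      using n by (simp add: forest_R_def E_def V_def)
    have "\<bar>E / V - r_lim p t\<bar> \<le> 2 / \<beta> * (\<bar>E - e_lim p t\<bar> + T * \<bar>V - v_lim p t\<bar>)"
    proof (rule quotient_close [OF \<beta>])
      show "\<beta> \<le> v_lim p t" using t v_lim_antimono [OF p] by (simp add: \<beta>_def)
      show "\<bar>V - v_lim p t\<bar> \<le> \<beta> / 2" using V \<rho>(2) by linarith
      show "e_lim p t = r_lim p t * v_lim p t"
        by (simp add: e_lim_def r_lim_def v_lim_def power2_eq_square)
      show "0 \<le> r_lim p t" using t v_lim_bounds(1) [OF p, of t] by (simp add: r_lim_def v_lim_def)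
      have "r_lim p t \<le> T * 1"
        unfolding r_lim_def using t T g_lim_bounds [OF p, of t] by (intro mult_mono) auto
      then show "r_lim p t \<le> T" by simp
    qed
    also have "\<dots> \<le> 2 / \<beta> * (2 * \<rho> + T * \<rho>)"
      using \<beta> T by (intro mult_left_mono add_mono E V) auto
    finally have R': "\<bar>E / V - r_lim p t\<bar> \<le> 2 / \<beta> * (2 * \<rho> + T * \<rho>)" .
    have "dist (V, E, E / V) (v_lim p t, e_lim p t, r_lim p t)
      \<le> \<bar>V - v_lim p t\<bar> + (\<bar>E - e_lim p t\<bar> + \<bar>E / V - r_lim p t\<bar>)"
    proof -
      have tri: "dist (a, b) (a', b') \<le> dist a a' + dist b b'" for a a' :: real and b b' :: "'z::metric_space"
        unfolding dist_Pair_Pair using sqrt_sum_squares_le_sum_abs [of "dist a a'" "dist b b'"] by simp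
      show ?thesis
        using tri [of V "(E, E / V)" "v_lim p t" "(e_lim p t, r_lim p t)"] tri [of E "E / V" "e_lim p t" "r_lim p t"]
        by (simp add: dist_real_def)
    qed
    also have "\<dots> \<le> \<rho> + (2 * \<rho> + 2 / \<beta> * (2 * \<rho> + T * \<rho>))" by (intro add_mono V E R')
    also have "\<dots> = C * \<rho>" by (simp add: C_def algebra_simps add_divide_distrib)
    also have "\<dots> \<le> \<epsilon>" by (rule \<rho>(3))
    finally show "dist (real (forest_V n G) / real n, real (forest_E n G) / real n, forest_R n G)
        (v_lim p t, e_lim p t, r_lim p t) \<le> \<epsilon>"
      unfolding R V_def [symmetric] E_def [symmetric] .
  qed
qed

end

theorem theorem1p6:
  fixes p :: real
    and M :: "nat \<Rightarrow> 'w measure"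
    and F :: "nat \<Rightarrow> nat \<Rightarrow> 'w \<Rightarrow> multigraph"
  assumes "0 < p" and "p \<le> 1"
    and "\<And>n. n \<ge> 2 \<Longrightarrow> frozen_process p n (M n) (F n)"
  shows "ucp_converges (\<lambda>a b. ennreal (dist a b)) M
           (\<lambda>n t w. let G = F n (nat \<lfloor>real n * t\<rfloor>) w in
              (real (forest_V n G) / real n, real (forest_E n G) / real n, forest_R n G))
           (\<lambda>t. (v_lim p t, e_lim p t, r_lim p t))
       \<and> ucp_converges l1_edist M
           (\<lambda>n t w k. real (k * num_trees n k (F n (nat \<lfloor>real n * t\<rfloor>) w)) / real n)
           (\<lambda>t k. real k * t_lim p k t)"
proof
  show "ucp_converges (\<lambda>a b. ennreal (dist a b)) M
           (\<lambda>n t w. let G = F n (nat \<lfloor>real n * t\<rfloor>) w in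
              (real (forest_V n G) / real n, real (forest_E n G) / real n, forest_R n G))
           (\<lambda>t. (v_lim p t, e_lim p t, r_lim p t))"
    unfolding Let_def
  proof (rule ucp_convergesI [OF assms, where \<phi> = "\<lambda>n G. (real (forest_V n G) / real n, real (forest_E n G) / real n, forest_R n G)"])
    fix T \<epsilon> :: real assume T: "0 < T" and \<epsilon>: "0 < \<epsilon>"
    obtain \<rho> where \<rho>: "0 < \<rho>"
      "\<And>n G t. 2 \<le> n \<Longrightarrow> good_graph n G \<Longrightarrow> t \<in> {0..T} \<Longrightarrow>
      mass_close p \<rho> n G t \<Longrightarrow>
      dist (real (forest_V n G) / real n, real (forest_E n G) / real n, forest_R n G)
        (v_lim p t, e_lim p t, r_lim p t) \<le> \<epsilon>"
      using triple_close [OF assms(1,2) T \<epsilon>] by blast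
    show "(\<lambda>n. measure_pmf.prob (path_pmf (frozen_step p n) {#} (nat \<lfloor>T * real n\<rfloor>))
        {x. \<exists>t\<in>{0..T}. ennreal \<epsilon> < ennreal (dist (real (forest_V n (x (nat \<lfloor>real n * t\<rfloor>))) / real n,
          real (forest_E n (x (nat \<lfloor>real n * t\<rfloor>))) / real n, forest_R n (x (nat \<lfloor>real n * t\<rfloor>)))
          (v_lim p t, e_lim p t, r_lim p t))}) \<longlonglongrightarrow> 0"
    proof (rule frozen_prob_bound [OF assms(1,2) T \<rho>(1), where Q = "\<lambda>n G t. ennreal \<epsilon> <
        ennreal (dist (real (forest_V n G) / real n, real (forest_E n G) / real n, forest_R n G) (v_lim p t, e_lim p t, r_lim p t))"])
      fix n G t
      assume "2 \<le> n" "good_graph n G" "t \<in> {0..T}" "mass_close p \<rho> n G t"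
      from \<rho>(2) [OF this]
      show "\<not> ennreal \<epsilon> < ennreal (dist (real (forest_V n G) / real n, real (forest_E n G) / real n, forest_R n G)
         (v_lim p t, e_lim p t, r_lim p t))"
        by (simp add: not_less ennreal_leI)
    qed
  qed
  show "ucp_converges l1_edist M
           (\<lambda>n t w k. real (k * num_trees n k (F n (nat \<lfloor>real n * t\<rfloor>) w)) / real n)
           (\<lambda>t k. real k * t_lim p k t)"
  proof (rule ucp_convergesI [OF assms, where \<phi> = "\<lambda>n G k. real (k * num_trees n k G) / real n"])
    fix T \<epsilon> :: real assume T: "0 < T" and \<epsilon>: "0 < \<epsilon>"
    show "(\<lambda>n. measure_pmf.prob (path_pmf (frozen_step p n) {#} (nat \<lfloor>T * real n\<rfloor>))
        {x. \<exists>t\<in>{0..T}. ennreal \<epsilon> < l1_edist (\<lambda>k. real (k * num_trees n k (x (nat \<lfloor>real n * t\<rfloor>))) / real n)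
          (\<lambda>k. real k * t_lim p k t)}) \<longlonglongrightarrow> 0"
      by (rule frozen_prob_bound [OF assms(1,2) T \<epsilon>, where Q = "\<lambda>n G t. ennreal \<epsilon> <
        l1_edist (\<lambda>k. real (k * num_trees n k G) / real n) (\<lambda>k. real k * t_lim p k t)"])
        (simp only: not_less l1_edist_le)
  qed
qed

end
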